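(* Let $\delta>0$. Then $$T(\delta)\overset{\text{in law}}{=}\sum_{n=1}^\infty\frac{\Gamma_{2,n}}{\pi^2n^2/2+\delta}+\bigl(-\log\beta_{0,0}(\delta)\bigr),$$ where $\beta_{0,0}(\delta)$ is independent of the $\Gamma_{2,n}$'s. The density $f_{T(\delta)}$ of $T(\delta)$ is $$f_{T(\delta)}(x)=\delta e^{-\delta x}\Bigl[\frac{\sinh\sqrt{2\delta}}{\sqrt{2\delta}}\Bigr]^2\mathbf{P}(S_2<x),\quad x>0.$$ The Mellin transform $q\mapsto\mathbf{E}[T(\delta)^q]$ is entire and, for $\delta<\pi^2/2$, satisfies the functional equation $$\mathbf{E}[T(\delta)^q]-\frac q\delta\mathbf{E}[T(\delta)^{q-1}]=\Bigl[\frac{\sinh\sqrt{2\delta}}{\sqrt{2\delta}}\Bigr]^2\Bigl(\frac2\pi\Bigr)^q\sum_{n=0}^\infty\frac1{n!}\Bigl(\frac{-2\delta}{\pi}\Bigr)^n2\xi(2q+2n),\quad q\in\mathbb{C}.$$ In particular, $$\lim_{\delta\to0}\Bigl[\mathbf{E}[T(\delta)^q]-\frac q\delta\mathbf{E}[T(\delta)^{q-1}]\Bigr]=\Bigl(\frac2\pi\Bigr)^q2\xi(2q).$$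
   Context: $\theta(t)=1+2\sum_{n=1}^\infty e^{-\pi tn^2}$, $t>0$. The truncated Jacobi triple product is $\theta_M(t)=\prod_{n=1}^M(1-e^{-2n\pi t})\bigl[\prod_{n=1}^M(1+e^{-(2n-1)\pi t})\bigr]^2$. For $\delta>0$, $M\ge1$, $\beta_M(\delta)$ is the probability distribution on $(0,1]$ (a Barnes beta distribution of type $\beta_{2M,3M}$) with $\mathbf{E}[\beta_M(\delta)^q]=\exp\bigl(\int_0^\infty(e^{-qt}-1)e^{-\delta t}\theta_M(\pi t/2)\frac{dt}{t}\bigr)$, $\Re(q)>-\delta$. $T(\delta)$ is the distribution on $(0,\infty)$ such that $\beta_M(\delta)\to\exp(-T(\delta))$ in law as $M\to\infty$; equivalently, $$\mathbf{E}[e^{-qT(\delta)}]=\exp\Bigl(\int_0^\infty(e^{-qt}-1)e^{-\delta t}\theta(\pi t/2)\frac{dt}{t}\Bigr),\quad q>0.$$ $\{\Gamma_{2,n}\}_{n\ge1}$ are i.i.d. with density $xe^{-x}$ on $(0,\infty)$. $S_2=\frac2{\pi^2}\sum_{n=1}^\infty\Gamma_{2,n}/n^2$, which has $\mathbf{E}[e^{-qS_2}]=[\sqrt{2q}/\sinh\sqrt{2q}]^2$, $q>0$. $\beta_{0,0}(\delta)$ has density $\delta x^{\delta-1}$ on $(0,1)$. The Riemann xi function is $\xi(q)=\frac12q(q-1)\pi^{-q/2}\Gamma(q/2)\zeta(q)$ (entire). *)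

theory Defs
  imports "HOL-Probability.Probability" "HOL-Complex_Analysis.Complex_Analysis"
begin

definition theta_trunc :: "nat \<Rightarrow> real \<Rightarrow> real" where
  "theta_trunc M t =
     (\<Prod>n=1..M. 1 - exp (- 2 * real n * pi * t)) *
     (\<Prod>n=1..M. 1 + exp (- (2 * real n - 1) * pi * t))\<^sup>2"

definition mellin :: "real measure \<Rightarrow> complex \<Rightarrow> complex" where
  "mellin \<mu> q = (LINT x|\<mu>. complex_of_real x powr q)"

text \<open>The law on \<open>(0,1]\<close> characterised by its Mellin transform; \<open>theta_trunc M\<close> vanishes to
  order \<open>M\<close> at the origin, so for \<open>M \<ge> 1\<close> the Levy--Khinchine integral converges absolutely.\<close>

definition is_barnes_beta_law :: "nat \<Rightarrow> real \<Rightarrow> real measure \<Rightarrow> bool" where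
  "is_barnes_beta_law M \<delta> \<mu> \<longleftrightarrow>
     real_distribution \<mu> \<and> measure \<mu> {0<..1} = 1 \<and>
     (\<forall>q::complex. Re q > - \<delta> \<longrightarrow>
        mellin \<mu> q =
        exp (LBINT t:{0<..}. (exp (- q * of_real t) - 1) *
               of_real (exp (- \<delta> * t) * theta_trunc M (pi * t / 2) / t)))"

text \<open>\<open>\<mu>\<close> is the law of \<open>T(\<delta>)\<close>: it lives on \<open>(0,\<infinity>)\<close> and the Barnes beta laws converge
  weakly to its image under \<open>x \<mapsto> exp (-x)\<close>.  The entry \<open>\<beta> 0\<close> of the sequence is unconstrained.\<close>

definition is_T_law :: "real \<Rightarrow> real measure \<Rightarrow> bool" where
  "is_T_law \<delta> \<mu> \<longleftrightarrow>
     real_distribution \<mu> \<and> measure \<mu> {0<..} = 1 \<and>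
     (\<exists>\<beta>. (\<forall>M\<ge>1. is_barnes_beta_law M \<delta> (\<beta> M)) \<and>
          weak_conv_m \<beta> (distr \<mu> borel (\<lambda>x. exp (- x))))"

text \<open>Sequences \<open>G\<close> below are indexed from \<open>1\<close>, hence the shifts by \<open>Suc\<close>.\<close>

definition S2 :: "(nat \<Rightarrow> 'a \<Rightarrow> real) \<Rightarrow> 'a \<Rightarrow> real" where
  "S2 G \<omega> = 2 / pi\<^sup>2 * (\<Sum>n. G (Suc n) \<omega> / (real (Suc n))\<^sup>2)"

text \<open>The meromorphic continuation of the Dirichlet series; the value at the pole is set to \<open>0\<close>.\<close>

definition riemann_zeta :: "complex \<Rightarrow> complex" where
  "riemann_zeta = (THE f. f holomorphic_on - {1} \<and> f 1 = 0 \<and>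
     (\<forall>s. Re s > 1 \<longrightarrow> f s = (\<Sum>n. 1 / of_nat (Suc n) powr s)))"

text \<open>\<open>remove_sings\<close> supplies the limiting values at \<open>1\<close> and at \<open>0, -2, -4, \<dots>\<close>, where \<open>riemann_zeta\<close>
  or \<open>Gamma (s / 2)\<close> has a pole.\<close>

definition riemann_xi :: "complex \<Rightarrow> complex" where
  "riemann_xi = remove_sings (\<lambda>s. 1 / 2 * s * (s - 1) * of_real pi powr (- s / 2) *
                                  Gamma (s / 2) * riemann_zeta s)"

end

(* The Levy exponent of T(delta) is a sum of Frullani integrals: by the Jacobi triple product,
   theta_trunc M is a sum of Gaussians with coefficients in [0, 1] tending to 1, so it is dominated
   by theta and converges to it, and the Laplace transform of T(delta) is a product of gamma and
   exponential factors. Laplace transforms at the natural numbers determine a law on [0, oo)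
   (Hausdorff moments of exp (-T)), which yields both the representation and the density.
   The density makes E[T^q] - (q/delta) E[T^(q-1)] an integral of a total derivative, equal to a
   constant times E[S2^q exp (-delta S2)]. Finally S2 has moments of all orders, hence an entire
   Mellin transform, and differentiating log (sinh u / u) twice identifies its law explicitly enough
   to compute the real moments of order above 1/2 as Dirichlet series. This provides
   the continuation of zeta itself and identifies the Mellin transform with xi. *)

theory Submission
  imports Defs "HOL-Real_Asymp.Real_Asymp"
begin

section \<open>Gamma, Frullani and Laplace integrals\<close>

text \<open>The shift by \<delta> is an exponential change of measure. With p(n) = pi^2 n^2 / 2,
  theta(pi t/2) is 1 plus twice the sum of exp(-p(n) t), so the factor exp(-\<delta> t) replaces
  each p(n) by p(n) + \<delta>, and the Laplace transform of T(\<delta>) at q equals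
  \<delta>/(\<delta>+q) * E[exp(-(\<delta>+q) S2)] / E[exp(-\<delta> S2)]. Thus T(\<delta>) is an
  exponential variable of rate \<delta> plus an independent variable distributed as S2 tilted by
  exp(-\<delta> x). The squared factor sinh u / u with u = sqrt(2 \<delta>) is the normalising
  constant of the tilt. The bound pi^2/2 on \<delta> is p(1): below it S2 has exponential moments,
  and these dominate the expansion of exp(-\<delta> S2) that yields the xi series. Transforms are
  compared as limits of the same finite products, by uniqueness of limits. As zeta is given by a
  definite description, the existence of its continuation must be proved before anything can be said
  about xi.\<close>

lemma nn_integral_Gamma:
  fixes s b :: real
  assumes s: "s > 0" and b: "b > 0"
  shows "(\<integral>\<^sup>+x. ennreal (x powr (s - 1) * exp (- b * x) * indicator {0<..} x) \<partial>lborel)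
           = ennreal (Gamma s / b powr s)"
proof -
  have "ennreal (Gamma s) = (\<integral>\<^sup>+t. ennreal (indicator {0..} t * t powr (s - 1) / exp t) \<partial>lborel)"
    using Gamma_conv_nn_integral_real[OF s] by simp
  also have "\<dots> = ennreal b * (\<integral>\<^sup>+x. ennreal (indicator {0..} (b * x) * (b * x) powr (s - 1) / exp (b * x)) \<partial>lborel)"
    using b by (subst nn_integral_real_affine[where c = b and t = 0]) auto
  also have "\<dots> = ennreal b * (\<integral>\<^sup>+x. ennreal (b powr (s - 1)) * ennreal (x powr (s - 1) * exp (- b * x) * indicator {0<..} x) \<partial>lborel)"
  proof -
    have "AE x in lborel. x \<noteq> (0::real)"
      by (rule AE_lborel_singleton)
    then show ?thesis
      using b by (intro arg_cong2[where f = "(*)"] refl nn_integral_cong_AE)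
        (auto simp: indicator_def powr_mult exp_minus field_simps zero_le_mult_iff ennreal_mult[symmetric] elim!: eventually_mono)
  qed
  also have "\<dots> = ennreal (b powr s) * (\<integral>\<^sup>+x. ennreal (x powr (s - 1) * exp (- b * x) * indicator {0<..} x) \<partial>lborel)"
    using b by (subst nn_integral_cmult)
      (auto simp: mult.assoc[symmetric] ennreal_mult[symmetric] powr_mult_base)
  finally have *: "ennreal (Gamma s) = ennreal (b powr s) * (\<integral>\<^sup>+x. ennreal (x powr (s - 1) * exp (- b * x) * indicator {0<..} x) \<partial>lborel)" .
  have "ennreal (Gamma s / b powr s) = ennreal (1 / b powr s) * ennreal (Gamma s)"
    using b s by (subst ennreal_mult[symmetric]) (auto intro!: Gamma_real_pos less_imp_le)
  also have "\<dots> = (\<integral>\<^sup>+x. ennreal (x powr (s - 1) * exp (- b * x) * indicator {0<..} x) \<partial>lborel)"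
    unfolding * using b by (simp add: mult.assoc[symmetric] ennreal_mult[symmetric])
  finally show ?thesis by simp
qed

lemma nn_integral_exp:
  fixes b :: real assumes b: "b > 0"
  shows "(\<integral>\<^sup>+x. ennreal (exp (- b * x) * indicator {0<..} x) \<partial>lborel) = ennreal (1 / b)"
proof -
  have "(\<integral>\<^sup>+x. ennreal (exp (- b * x) * indicator {0<..} x) \<partial>lborel) =
        (\<integral>\<^sup>+x. ennreal (x powr (1 - 1) * exp (- b * x) * indicator {0<..} x) \<partial>lborel)"
    by (intro nn_integral_cong) (auto simp: indicator_def)
  also have "\<dots> = ennreal (1 / b)" using b by (subst nn_integral_Gamma) auto
  finally show ?thesis .
qed

lemma nn_integral_x_exp:
  fixes b :: real assumes b: "b > 0"
  shows "(\<integral>\<^sup>+x. ennreal (x * exp (- b * x) * indicator {0<..} x) \<partial>lborel) = ennreal (1 / b\<^sup>2)"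
proof -
  have "(\<integral>\<^sup>+x. ennreal (x * exp (- b * x) * indicator {0<..} x) \<partial>lborel) =
        (\<integral>\<^sup>+x. ennreal (x powr (2 - 1) * exp (- b * x) * indicator {0<..} x) \<partial>lborel)"
    by (intro nn_integral_cong) (auto simp: indicator_def)
  also have "\<dots> = ennreal (1 / b\<^sup>2)" using b
    by (subst nn_integral_Gamma) (auto simp: Gamma_numeral)
  finally show ?thesis .
qed

lemma nn_integral_powr_from_0:
  fixes s c :: real
  assumes s: "s > 0" and c: "c \<ge> 0"
  shows "(\<integral>\<^sup>+x. ennreal (s * x powr (s - 1)) * indicator {0<..c} x \<partial>lborel) = ennreal (c powr s)"
proof -
  have "(\<integral>\<^sup>+x. ennreal (s * x powr (s - 1)) * indicator {0<..c} x \<partial>lborel) =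
     (\<integral>\<^sup>+x. ennreal (s * x powr (s - 1) * indicator {0..c} x) \<partial>lborel)"
    using AE_lborel_singleton[of 0] by (intro nn_integral_cong_AE) (auto simp: indicator_def elim!: eventually_mono)
  also have "\<dots> = ennreal (c powr s)"
  proof (rule nn_integral_has_integral_lborel)
    have "((\<lambda>x. s * x powr (s - 1)) has_integral (s * (c powr (s - 1 + 1) / (s - 1 + 1)))) {0..c}"
      using s c by (intro has_integral_mult_right has_integral_powr_from_0) auto
    then have "((\<lambda>x. if x \<in> {0..c} then s * x powr (s - 1) else 0) has_integral (c powr s)) UNIV"
      using s by (subst has_integral_restrict_UNIV) simp
    also have "(\<lambda>x. if x \<in> {0..c} then s * x powr (s - 1) else 0) = (\<lambda>x. s * x powr (s - 1) * indicator {0..c} x :: real)"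
      by (auto simp: indicator_def)
    finally show "((\<lambda>x. s * x powr (s - 1) * indicator {0..c} x) has_integral (c powr s)) UNIV" .
  qed (use s in auto)
  finally show ?thesis .
qed

text \<open>The integrand is the integral of exp(-y t) over y in [b, b+q]. Exchanging the order,
  which nonnegativity permits, leaves the integral of 1/y and hence the logarithm.\<close>

lemma nn_integral_frullani:
  fixes q b :: real
  assumes q: "q \<ge> 0" and b: "b > 0"
  shows "(\<integral>\<^sup>+t. ennreal ((1 - exp (- q * t)) * exp (- b * t) / t * indicator {0<..} t) \<partial>lborel)
           = ennreal (ln (1 + q / b))"
proof -
  have "(\<integral>\<^sup>+t. ennreal ((1 - exp (- q * t)) * exp (- b * t) / t * indicator {0<..} t) \<partial>lborel)
     = (\<integral>\<^sup>+t. (\<integral>\<^sup>+y. ennreal (exp (- y * t) * indicator {b..b+q} y * indicator {0<..} t) \<partial>lborel) \<partial>lborel)"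
  proof (intro nn_integral_cong)
    fix t :: real
    show "ennreal ((1 - exp (- q * t)) * exp (- b * t) / t * indicator {0<..} t)
        = (\<integral>\<^sup>+y. ennreal (exp (- y * t) * indicator {b..b+q} y * indicator {0<..} t) \<partial>lborel)"
    proof (cases "t > 0")
      case True
      have "(\<integral>\<^sup>+y. ennreal (exp (- y * t) * indicator {b..b+q} y * indicator {0<..} t) \<partial>lborel)
         = (\<integral>\<^sup>+y. ennreal (exp (- y * t)) * indicator {b..b+q} y \<partial>lborel)"
        using True by (intro nn_integral_cong) (auto simp: indicator_def)
      also have "\<dots> = ennreal (- exp (- (b + q) * t) / t - (- exp (- b * t) / t))"
        using q True
        by (intro nn_integral_FTC_Icc[where F = "\<lambda>y. - exp (- y * t) / t"])
           (auto intro!: derivative_eq_intros simp: field_simps has_real_derivative_iff_has_vector_derivative[symmetric])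
      also have "- exp (- (b + q) * t) / t - (- exp (- b * t) / t) = (1 - exp (- q * t)) * exp (- b * t) / t"
        using True by (simp add: field_simps flip: exp_add)
      finally show ?thesis using True by simp
    qed auto
  qed
  also have "\<dots> = (\<integral>\<^sup>+y. (\<integral>\<^sup>+t. ennreal (exp (- y * t) * indicator {b..b+q} y * indicator {0<..} t) \<partial>lborel) \<partial>lborel)"
    by (rule lborel_pair.Fubini') measurable
  also have "\<dots> = (\<integral>\<^sup>+y. ennreal (1 / y) * indicator {b..b+q} y \<partial>lborel)"
  proof (intro nn_integral_cong)
    fix y :: real
    show "(\<integral>\<^sup>+t. ennreal (exp (- y * t) * indicator {b..b+q} y * indicator {0<..} t) \<partial>lborel)
      = ennreal (1 / y) * indicator {b..b+q} y"
      using b nn_integral_exp[of y] by (cases "y \<in> {b..b+q}") simp_all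
  qed
  also have "\<dots> = ennreal (ln (b + q) - ln b)"
    using b q by (intro nn_integral_FTC_Icc)
       (auto intro!: derivative_eq_intros simp: has_real_derivative_iff_has_vector_derivative[symmetric])
  also have "ln (b + q) - ln b = ln (1 + q / b)"
  proof -
    have "1 + q / b = (b + q) / b" using b by (simp add: field_simps)
    then show ?thesis using b q by (simp add: ln_div)
  qed
  finally show ?thesis .
qed

section \<open>Laws determined by moments and by Laplace transforms\<close>

text \<open>For a law on [-1,1] all moments are at most 1 in absolute value, so the exponential
  series integrates termwise and expresses the characteristic function through the moments at every
  \<open>t\<close>. Levy's uniqueness theorem then applies.\<close>

lemma real_distribution_eqI_moments:
  assumes M: "real_distribution M" and N: "real_distribution N"
  assumes "AE x in M. \<bar>x\<bar> \<le> 1" "AE x in N. \<bar>x\<bar> \<le> 1"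
  assumes mom: "\<And>n::nat. (LINT x|M. x ^ n) = (LINT x|N. x ^ n)"
  shows "M = N"
proof (rule Levy_uniqueness[OF M N], rule ext)
  fix t :: real
  have char_sums: "(\<lambda>n. (\<i> * of_real t) ^ n / fact n * of_real (LINT x|K. x ^ n)) sums char K t"
    if K: "real_distribution K" and bd: "AE x in K. \<bar>x\<bar> \<le> 1" for K
  proof -
    interpret real_distribution K by fact
    have int: "integrable K (\<lambda>x. x ^ n)" for n :: nat
      using bd by (intro integrable_const_bound[where B = 1]) (auto simp: power_abs power_le_one elim!: eventually_mono)
    define f where "f = (\<lambda>n x. (\<i> * of_real t) ^ n / fact n * of_real (x ^ n) :: complex)"
    have f_int: "integrable K (f n)" for n
      unfolding f_def by (intro integrable_mult_right integrable_of_real int)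
    have le: "AE x in K. norm (f n x) \<le> \<bar>t\<bar> ^ n / fact n" for n
      using bd
    proof eventually_elim
      fix x :: real assume "\<bar>x\<bar> \<le> 1"
      then have "\<bar>x\<bar> ^ n \<le> 1" by (simp add: power_le_one)
      then show "norm (f n x) \<le> \<bar>t\<bar> ^ n / fact n"
        by (auto simp: f_def norm_mult norm_power norm_divide divide_right_mono mult_left_le)
    qed
    have sm: "summable (\<lambda>n. \<bar>t\<bar> ^ n / fact n)"
      using summable_exp_generic[of "\<bar>t\<bar>"] by (simp add: divide_inverse_commute)
    have "(\<lambda>n. integral\<^sup>L K (f n)) sums integral\<^sup>L K (\<lambda>x. \<Sum>n. f n x)"
    proof (rule sums_integral)
      show "AE x in K. summable (\<lambda>n. norm (f n x))"
      proof -
        have "AE x in K. \<forall>n. norm (f n x) \<le> \<bar>t\<bar> ^ n / fact n" using le by (simp add: AE_all_countable)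
        then show ?thesis
          by eventually_elim (rule summable_comparison_test'[OF sm, of 0], auto)
      qed
      show "summable (\<lambda>n. LINT x|K. norm (f n x))"
      proof (rule summable_comparison_test'[OF sm, of 0])
        fix n
        have "(LINT x|K. norm (f n x)) \<le> (LINT x|K. \<bar>t\<bar> ^ n / fact n)"
          using f_int le by (intro integral_mono_AE) auto
        then show "norm (LINT x|K. norm (f n x)) \<le> \<bar>t\<bar> ^ n / fact n"
          using prob_space by simp
      qed
    qed (rule f_int)
    moreover have "(\<Sum>n. f n x) = iexp (t * x)" for x
    proof -
      have "(\<lambda>n. (\<i> * of_real (t * x)) ^ n /\<^sub>R fact n) sums iexp (t * x)"
        by (rule exp_converges)
      moreover have "(\<lambda>n. (\<i> * of_real (t * x)) ^ n /\<^sub>R fact n) = (\<lambda>n. f n x)"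
        by (auto simp: f_def scaleR_conv_of_real power_mult_distrib field_simps)
      ultimately show ?thesis using sums_unique by metis
    qed
    moreover have "integral\<^sup>L K (f n) = (\<i> * of_real t) ^ n / fact n * of_real (LINT x|K. x ^ n)" for n
      unfolding f_def by (subst integral_mult_right_zero, subst integral_complex_of_real) (rule refl)
    ultimately show ?thesis
      by (simp add: char_def)
  qed
  show "char M t = char N t"
    using sums_unique2[OF char_sums[OF M assms(3)]] char_sums[OF N assms(4)] mom by simp
qed

text \<open>The transform at \<open>n\<close> is the \<open>n\<close>-th moment of the image under
  exp(-x), and this image lives on [0,1] because the law lives on [0, \<infinity>). The map -ln
  brings the equality back.\<close>

lemma prob_space_eqI_laplace:
  fixes M N :: "real measure"
  assumes "prob_space M" "prob_space N" "sets M = sets borel" "sets N = sets borel"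
  assumes M0: "AE x in M. 0 \<le> x" and N0: "AE x in N. 0 \<le> x"
  assumes L: "\<And>n::nat. (\<integral>\<^sup>+x. ennreal (exp (- real n * x)) \<partial>M) = (\<integral>\<^sup>+x. ennreal (exp (- real n * x)) \<partial>N)"
  shows "M = N"
proof -
  have [measurable_cong]: "sets M = sets borel" "sets N = sets borel" by fact+
  let ?e = "\<lambda>x::real. exp (- x)"
  have "distr M borel ?e = distr N borel ?e"
  proof (rule real_distribution_eqI_moments)
    show "real_distribution (distr M borel ?e)" "real_distribution (distr N borel ?e)"
      using assms by (auto intro!: prob_space.prob_space_distr simp: real_distribution_def real_distribution_axioms_def)
    show "AE x in distr M borel ?e. \<bar>x\<bar> \<le> 1" "AE x in distr N borel ?e. \<bar>x\<bar> \<le> 1"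
      using M0 N0 by (auto simp: AE_distr_iff elim!: eventually_mono)
    fix n :: nat
    have "(LINT x|M. ?e x ^ n) = (LINT x|N. ?e x ^ n)"
      using L[of n] by (simp add: integral_eq_nn_integral exp_of_nat_mult[symmetric] mult.commute)
    then show "(LINT x|distr M borel ?e. x ^ n) = (LINT x|distr N borel ?e. x ^ n)"
      by (simp add: integral_distr)
  qed
  then have "distr (distr M borel ?e) borel (\<lambda>x. - ln x) = distr (distr N borel ?e) borel (\<lambda>x. - ln x)"
    by simp
  then have "distr M borel (\<lambda>x. x) = distr N borel (\<lambda>x. x)"
    by (simp add: distr_distr comp_def)
  moreover have "distr M borel (\<lambda>x. x) = M" "distr N borel (\<lambda>x. x) = N"
    using assms by (auto intro!: distr_id2)
  ultimately show ?thesis by simp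
qed

section \<open>The Jacobi triple product\<close>

text \<open>The value \<open>0\<close> at negative integers makes \<open>inv_qfact_minus_one\<close>, and hence the recursion
  \<open>qcoeff_Suc\<close>, hold for all integers without boundary cases.\<close>

definition inv_qfact :: "real \<Rightarrow> int \<Rightarrow> real" where
  "inv_qfact q n = (if n < 0 then 0 else 1 / (\<Prod>j=1..nat n. 1 - q ^ j))"

lemma inv_qfact_minus_one:
  assumes "0 < q" "q < 1"
  shows "inv_qfact q (n - 1) = (1 - q powi n) * inv_qfact q n"
proof (cases "n \<ge> 1")
  case True
  define m where "m = nat (n - 1)"
  have n: "n = int (Suc m)" using True by (simp add: m_def)
  have "q ^ Suc m < 1" using assms by (metis power_Suc_less_one)
  then show ?thesis
    by (simp add: inv_qfact_def n power_int_def nat_add_distrib prod.nat_ivl_Suc' flip: power_Suc)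
next
  case False
  then show ?thesis by (cases "n = 0") (auto simp: inv_qfact_def)
qed

text \<open>The Gaussian binomial coefficient 2M over M+k in base \<open>q\<close>, centred so that
  it is even in \<open>k\<close>.\<close>

definition qcoeff :: "real \<Rightarrow> nat \<Rightarrow> int \<Rightarrow> real" where
  "qcoeff q M k = inv_qfact q (int M - k) * inv_qfact q (int M + k) / inv_qfact q (2 * int M)"

lemma qcoeff_zero: "\<bar>k\<bar> > int M \<Longrightarrow> qcoeff q M k = 0"
  by (auto simp: qcoeff_def inv_qfact_def)

lemma inv_qfact_pos: "0 < q \<Longrightarrow> q < 1 \<Longrightarrow> n \<ge> 0 \<Longrightarrow> inv_qfact q n > 0"
  unfolding inv_qfact_def by (auto intro!: prod_pos divide_pos_pos simp: power_less_one_iff)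

text \<open>The numbers x^(k^2) * \<open>qcoeff q M k\<close> are the coefficients of z^k in the
  product of (1 + x^(2n-1) z)(1 + x^(2n-1)/z) over n \<le> M. Passing to M+1 multiplies this by 1 +
  x^(4M+2) + x^(2M+1) (z + 1/z), which is the recursion.\<close>

lemma qcoeff_Suc:
  fixes x :: real
  assumes x: "0 < x" "x < 1"
  defines "q \<equiv> x\<^sup>2"
  shows "x powi (k\<^sup>2) * qcoeff q (Suc M) k =
           (1 + x ^ (4 * M + 2)) * (x powi (k\<^sup>2) * qcoeff q M k) +
           x ^ (2 * M + 1) * (x powi ((k - 1)\<^sup>2) * qcoeff q M (k - 1) +
                              x powi ((k + 1)\<^sup>2) * qcoeff q M (k + 1))"
proof -
  have q: "0 < q" "q < 1" using x by (auto simp: q_def power_less_one_iff)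
  \<comment> \<open>In terms of x, X = x^(2M) and Y = x^k every power that occurs is a monomial, so
    the recursion becomes an identity of rational functions.\<close>
  define X Y where "X = x ^ (2 * M)" and "Y = x powi k"
  have Y0: "Y \<noteq> 0" using x by (simp add: Y_def)
  let ?f = "inv_qfact q"
  \<comment> \<open>These, and \<open>c\<close> below, have the largest arguments that occur;
    \<open>inv_qfact_minus_one\<close> turns every other value into an explicit multiple of one of
    them.\<close>
  define a b where "a = ?f (int M + 1 - k)" and "b = ?f (int M + 1 + k)"
  have qk: "q powi n = (x powi n)\<^sup>2" for n
    by (simp add: q_def power_int_mult[symmetric] mult.commute power2_eq_square power_int_mult_distrib)
  have e1: "q powi (int M + 1 - k) = X * x\<^sup>2 / Y\<^sup>2"
    using x by (simp add: qk power_int_diff power_int_add X_def Y_def power_mult_distrib power_mult[symmetric] mult.commute power_divide)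
  have e2: "q powi (int M + 1 + k) = X * x\<^sup>2 * Y\<^sup>2"
    using x by (simp add: qk power_int_add X_def Y_def power_mult_distrib power_mult[symmetric] mult.commute)
  have e3: "q powi (int M - k) = X / Y\<^sup>2"
    using x by (simp add: qk power_int_diff power_int_add X_def Y_def power_mult_distrib power_mult[symmetric] mult.commute power_divide)
  have e4: "q powi (int M + k) = X * Y\<^sup>2"
    using x by (simp add: qk power_int_add X_def Y_def power_mult_distrib power_mult[symmetric] mult.commute)
  have e5: "q powi (2 * int M + 1) = X\<^sup>2 * x\<^sup>2"
    using x by (simp add: qk power_int_add X_def power_mult_distrib power_mult[symmetric] mult.commute power_int_mult)
  have e6: "q powi (2 * int M + 2) = X\<^sup>2 * x ^ 4"
  proof -
    have "q powi (2 * int M + 2) = q powi (2 * int M + 1 + 1)" by (rule arg_cong) simp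
    also have "\<dots> = q powi (2 * int M + 1) * q" using q by (subst power_int_add) auto
    also have "\<dots> = X\<^sup>2 * x ^ 4" unfolding e5 by (simp add: q_def power4_eq_xxxx power2_eq_square)
    finally show ?thesis .
  qed
  define c where "c = ?f (2 * int M + 2)"
  have c0: "c > 0" unfolding c_def using q by (intro inv_qfact_pos) auto
  have "q powi int (2 * M + 1) < 1" "q powi int (2 * M + 2) < 1"
    unfolding power_int_of_nat using q by (simp_all only: power_less_one_iff less_imp_le) auto
  then have "q powi (2 * int M + 1) < 1" "q powi (2 * int M + 2) < 1"
    by (simp_all add: add.commute)
  then have nz: "1 - X\<^sup>2 * x\<^sup>2 \<noteq> 0" "1 - X\<^sup>2 * x ^ 4 \<noteq> 0" by (auto simp: e5 e6)
  have f1: "?f (int M - k) = (1 - X * x\<^sup>2 / Y\<^sup>2) * a"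
    using inv_qfact_minus_one[OF q, of "int M + 1 - k", unfolded e1] by (simp add: a_def)
  have f2: "?f (int M + k) = (1 - X * x\<^sup>2 * Y\<^sup>2) * b"
    using inv_qfact_minus_one[OF q, of "int M + 1 + k", unfolded e2] by (simp add: b_def)
  have f3: "?f (int M - k - 1) = (1 - X / Y\<^sup>2) * ((1 - X * x\<^sup>2 / Y\<^sup>2) * a)"
    using inv_qfact_minus_one[OF q, of "int M - k", unfolded e3] by (simp add: f1)
  have f4: "?f (int M + k - 1) = (1 - X * Y\<^sup>2) * ((1 - X * x\<^sup>2 * Y\<^sup>2) * b)"
    using inv_qfact_minus_one[OF q, of "int M + k", unfolded e4] by (simp add: f2)
  have f5: "?f (2 * int M + 1) = (1 - X\<^sup>2 * x ^ 4) * c"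
    using inv_qfact_minus_one[OF q, of "2 * int M + 2", unfolded e6] by (simp add: c_def add.commute)
  have f6: "?f (2 * int M) = (1 - X\<^sup>2 * x\<^sup>2) * ((1 - X\<^sup>2 * x ^ 4) * c)"
    using inv_qfact_minus_one[OF q, of "2 * int M + 1", unfolded e5] by (simp add: f5)
  define Z where "Z = x powi (k\<^sup>2)"
  have z1: "x powi ((k - 1)\<^sup>2) = Z * x / Y\<^sup>2"
  proof -
    have "(k - 1)\<^sup>2 = k\<^sup>2 + 1 - k * 2" by (simp add: power2_eq_square algebra_simps)
    then show ?thesis using x by (simp add: power_int_diff power_int_add power_int_mult Z_def Y_def)
  qed
  have z2: "x powi ((k + 1)\<^sup>2) = Z * x * Y\<^sup>2"
  proof -
    have "(k + 1)\<^sup>2 = k\<^sup>2 + 1 + k * 2" by (simp add: power2_eq_square algebra_simps)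
    then show ?thesis using x by (simp add: power_int_add power_int_mult Z_def Y_def)
  qed
  have x1: "x ^ (4 * M + 2) = X\<^sup>2 * x\<^sup>2" "x ^ (2 * M + 1) = X * x"
    by (simp_all add: X_def power_add mult.commute power2_eq_square[of x] flip: power_mult)
  have r1: "qcoeff q (Suc M) k = a * b / c"
    by (simp add: qcoeff_def a_def b_def c_def algebra_simps)
  have r2: "qcoeff q M k = (1 - X * x\<^sup>2 / Y\<^sup>2) * a * ((1 - X * x\<^sup>2 * Y\<^sup>2) * b) / ((1 - X\<^sup>2 * x\<^sup>2) * ((1 - X\<^sup>2 * x ^ 4) * c))"
    by (simp add: qcoeff_def f1 f2 f6)
  have r3: "qcoeff q M (k - 1) = a * ((1 - X * Y\<^sup>2) * ((1 - X * x\<^sup>2 * Y\<^sup>2) * b)) / ((1 - X\<^sup>2 * x\<^sup>2) * ((1 - X\<^sup>2 * x ^ 4) * c))"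
  proof -
    have "int M - (k - 1) = int M + 1 - k" "int M + (k - 1) = int M + k - 1" by simp_all
    then show ?thesis by (simp only: qcoeff_def f4 f6 a_def)
  qed
  have r4: "qcoeff q M (k + 1) = (1 - X / Y\<^sup>2) * ((1 - X * x\<^sup>2 / Y\<^sup>2) * a) * b / ((1 - X\<^sup>2 * x\<^sup>2) * ((1 - X\<^sup>2 * x ^ 4) * c))"
  proof -
    have "int M - (k + 1) = int M - k - 1" "int M + (k + 1) = int M + 1 + k" by simp_all
    then show ?thesis by (simp only: qcoeff_def f3 f6 b_def)
  qed
  have key: "(1 - X\<^sup>2 * x\<^sup>2) * (1 - X\<^sup>2 * x ^ 4) =
     (1 + X\<^sup>2 * x\<^sup>2) * ((1 - X * x\<^sup>2 / Y\<^sup>2) * (1 - X * x\<^sup>2 * Y\<^sup>2)) +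
     X * x * (x / Y\<^sup>2 * ((1 - X * Y\<^sup>2) * (1 - X * x\<^sup>2 * Y\<^sup>2)) + x * Y\<^sup>2 * ((1 - X / Y\<^sup>2) * (1 - X * x\<^sup>2 / Y\<^sup>2)))"
    using Y0 by (simp add: field_simps power_numeral_even)
  \<comment> \<open>The factors are abstracted to variables; apart from the nonvanishing of
    \<open>d1\<close> and \<open>d2\<close>, the identity \<open>key\<close> is the only relation
    among them that enters.\<close>
  have alg: "Z * (a * b / c) = e * (Z * (p * a * (r * b) / (d1 * (d2 * c)))) +
      X * x * (Z * x / Y\<^sup>2 * (a * (s * (r * b)) / (d1 * (d2 * c))) +
               Z * x * Y\<^sup>2 * (t * (p * a) * b / (d1 * (d2 * c))))"
    if "d1 \<noteq> 0" "d2 \<noteq> 0" and e: "d1 * d2 = e * (p * r) + X * x * (x / Y\<^sup>2 * (s * r) + x * Y\<^sup>2 * (t * p))"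
    for d1 d2 e p r s t
  proof -
    have "Z * (a * b / c) = Z * (a * b / c) / (d1 * d2) * (d1 * d2)" using that(1,2) by simp
    also have "\<dots> = Z * (a * b / c) / (d1 * d2) * (e * (p * r) + X * x * (x / Y\<^sup>2 * (s * r) + x * Y\<^sup>2 * (t * p)))"
      unfolding e ..
    also have "\<dots> = e * (Z * (p * a * (r * b) / (d1 * (d2 * c)))) +
      X * x * (Z * x / Y\<^sup>2 * (a * (s * (r * b)) / (d1 * (d2 * c))) +
               Z * x * Y\<^sup>2 * (t * (p * a) * b / (d1 * (d2 * c))))"
      by (simp add: divide_inverse algebra_simps)
    finally show ?thesis .
  qed
  show ?thesis
    unfolding Z_def[symmetric] z1 z2 x1 r1 r2 r3 r4 by (rule alg[OF nz key])
qed

text \<open>The finite triple product at z = 1. Summed over k, all three terms of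
  \<open>qcoeff_Suc\<close> give the same total, because the coefficients vanish for k beyond M, so
  each step multiplies by (1 + x^(2M+1))^2.\<close>

lemma jacobi_finite:
  fixes x :: real
  assumes x: "0 < x" "x < 1"
  shows "(\<Sum>k\<in>{- int M..int M}. x powi (k\<^sup>2) * qcoeff (x\<^sup>2) M k) = (\<Prod>n=1..M. 1 + x ^ (2 * n - 1))\<^sup>2"
proof (induction M)
  case 0
  show ?case by (simp add: qcoeff_def inv_qfact_def)
next
  case (Suc M)
  define f where "f = (\<lambda>k. x powi (k\<^sup>2) * qcoeff (x\<^sup>2) M k)"
  have f0: "f k = 0" if "\<bar>k\<bar> > int M" for k
    using qcoeff_zero[OF that] by (simp add: f_def)
  define s where "s = sum f {- int M..int M}"
  let ?I = "{- int (Suc M)..int (Suc M)}"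
  have s0: "sum f J = s" if "finite J" "{- int M..int M} \<subseteq> J" for J
    unfolding s_def using that by (intro sum.mono_neutral_right) (auto intro!: f0)
  have s1: "(\<Sum>k\<in>?I. f (k - 1)) = s"
  proof -
    have "(\<Sum>k\<in>?I. f (k - 1)) = sum f {- int M - 2..int M}"
      by (rule sum.reindex_bij_witness[of _ "\<lambda>k. k + 1" "\<lambda>k. k - 1"]) auto
    then show ?thesis by (simp add: s0)
  qed
  have s2: "(\<Sum>k\<in>?I. f (k + 1)) = s"
  proof -
    have "(\<Sum>k\<in>?I. f (k + 1)) = sum f {- int M..int M + 2}"
      by (rule sum.reindex_bij_witness[of _ "\<lambda>k. k - 1" "\<lambda>k. k + 1"]) auto
    then show ?thesis by (simp add: s0)
  qed
  have "(\<Sum>k\<in>?I. x powi (k\<^sup>2) * qcoeff (x\<^sup>2) (Suc M) k) =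
        (\<Sum>k\<in>?I. (1 + x ^ (4 * M + 2)) * f k + x ^ (2 * M + 1) * (f (k - 1) + f (k + 1)))"
    unfolding f_def by (intro sum.cong refl qcoeff_Suc x)
  also have "\<dots> = (1 + x ^ (4 * M + 2)) * s + x ^ (2 * M + 1) * (s + s)"
    by (simp only: sum.distrib sum_distrib_left[symmetric] s1 s2) (simp add: s0)
  also have "\<dots> = s * (1 + x ^ (2 * M + 1))\<^sup>2"
    by (simp add: power2_eq_square algebra_simps flip: power_add)
  also have "s = (\<Prod>n=1..M. 1 + x ^ (2 * n - 1))\<^sup>2"
    using Suc.IH by (simp add: s_def f_def)
  finally show ?case
    by (simp add: power_mult_distrib)
qed

section \<open>Coefficients of the truncated theta function\<close>

definition theta :: "real \<Rightarrow> real" where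
  "theta t = 1 + 2 * (\<Sum>n. exp (- pi * t * (real (Suc n))\<^sup>2))"

text \<open>The Gaussian binomial times the product of 1 - q^j over j \<le> M, with the quotients
  cancelled. For k \<le> M there remain exactly M factors, each in [0,1] and with exponent above
  M-k; bounds and limit can be read off from this form.\<close>

definition theta_coeff :: "real \<Rightarrow> nat \<Rightarrow> nat \<Rightarrow> real" where
  "theta_coeff q M k = (if k \<le> M then (\<Prod>j\<in>{M - k<..M}. 1 - q ^ j) * (\<Prod>j\<in>{M + k<..2 * M}. 1 - q ^ j) else 0)"

lemma theta_coeff_eq:
  assumes q: "0 < q" "q < 1"
  shows "(\<Prod>j=1..M. 1 - q ^ j) * qcoeff q M (int k) = theta_coeff q M k"
proof (cases "k \<le> M")
  case True
  let ?p = "\<lambda>n. \<Prod>j=1..n. 1 - q ^ j"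
  have pos: "?p n > 0" for n
    using q by (intro prod_pos) (auto simp: power_less_one_iff)
  have split: "?p n = ?p m * (\<Prod>j\<in>{m<..n}. 1 - q ^ j)" if "m \<le> n" for m n
  proof -
    have "{1..n} = {1..m} \<union> {m<..n}" using that by auto
    then show ?thesis by (simp only:) (subst prod.union_disjoint, auto)
  qed
  have *: "int M - int k = int (M - k)" "int M + int k = int (M + k)" "2 * int M = int (2 * M)"
    using True by auto
  have inv: "inv_qfact q (int n) = 1 / ?p n" for n by (simp add: inv_qfact_def)
  have alg: "(a * A) * (1 / a * (1 / b) / (1 / (b * B))) = A * B" if "a > 0" "b > 0" for a b A B :: real
    using that by (cases "B = 0") (auto simp: field_simps)
  have "M - k \<le> M" "M + k \<le> 2 * M" using True by auto
  note split' = split[OF this(1)] split[OF this(2)]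
  show ?thesis
    unfolding qcoeff_def theta_coeff_def * inv if_P[OF True] split'
    by (rule alg pos)+
next
  case False
  then show ?thesis by (simp add: theta_coeff_def qcoeff_zero)
qed

lemma qcoeff_minus: "qcoeff q M (- k) = qcoeff q M k"
  by (simp add: qcoeff_def algebra_simps)

lemma sum_int_symmetric:
  fixes f :: "int \<Rightarrow> real"
  assumes "\<And>k. f (- k) = f k"
  shows "sum f {- int M..int M} = f 0 + 2 * (\<Sum>k<M. f (int (Suc k)))"
proof (induction M)
  case (Suc M)
  have "{- int (Suc M)..int (Suc M)} = insert (- int (Suc M)) (insert (int (Suc M)) {- int M..int M})"
    by auto
  then show ?case using Suc assms[of "int (Suc M)"] by simp
qed simp

lemma theta_coeff_bounds:
  assumes q: "0 < q" "q < 1"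
  shows "0 \<le> theta_coeff q M k" "theta_coeff q M k \<le> 1"
proof -
  have 1: "0 \<le> 1 - q ^ j" "1 - q ^ j \<le> 1" for j using q by (auto simp: power_le_one)
  show "0 \<le> theta_coeff q M k" "theta_coeff q M k \<le> 1"
    unfolding theta_coeff_def using 1 by (auto intro!: mult_nonneg_nonneg prod_nonneg mult_le_one prod_le_1)
qed

text \<open>Each of the M factors is at least 1 - q^(M-k), so Bernoulli's inequality bounds the
  product below by 1 - 2 M q^(M-k), the exponent 2M being a generous substitute for M.\<close>

lemma theta_coeff_tendsto:
  assumes q: "0 < q" "q < 1"
  shows "(\<lambda>M. theta_coeff q M k) \<longlonglongrightarrow> 1"
proof (rule tendsto_sandwich)
  show "\<forall>\<^sub>F M in sequentially. theta_coeff q M k \<le> 1"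
    using theta_coeff_bounds[OF q] by simp
  show "\<forall>\<^sub>F M in sequentially. 1 + real (2 * M) * (- (q ^ (M - k))) \<le> theta_coeff q M k"
    using eventually_ge_at_top[of k]
  proof eventually_elim
    case (elim M)
    have u: "q ^ (M - k) \<le> 1" using q by (simp add: power_le_one)
    have le: "1 - q ^ (M - k) \<le> 1 - q ^ j" if "M - k < j" for j
      using q that by (simp add: power_decreasing)
    have "1 + real (2 * M) * (- (q ^ (M - k))) \<le> (1 + - (q ^ (M - k))) ^ (2 * M)"
      using u by (intro Bernoulli_inequality) simp
    also have "\<dots> \<le> (1 - q ^ (M - k)) ^ M"
      using u q by (auto intro!: power_decreasing)
    also have "(1 - q ^ (M - k)) ^ M = (1 - q ^ (M - k)) ^ (card {M - k<..M} + card {M + k<..2 * M})"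
      using elim by simp
    also have "\<dots> = (\<Prod>j\<in>{M - k<..M}. 1 - q ^ (M - k)) * (\<Prod>j\<in>{M + k<..2 * M}. 1 - q ^ (M - k))"
      by (simp only: prod_constant power_add)
    also have "\<dots> \<le> theta_coeff q M k"
      unfolding theta_coeff_def if_P[OF elim]
      by (intro mult_mono prod_mono prod_nonneg) (use u le q in \<open>auto simp: power_le_one\<close>)
    finally show ?case .
  qed
  have "(\<lambda>M. 1 + 2 / q ^ k * - (real M * q ^ M)) \<longlonglongrightarrow> 1 + 2 / q ^ k * - 0"
    using q by (intro tendsto_intros powser_times_n_limit_0) auto
  moreover have "\<forall>\<^sub>F M in sequentially. 1 + 2 / q ^ k * - (real M * q ^ M) = 1 + real (2 * M) * (- (q ^ (M - k)))"
    using eventually_ge_at_top[of k] by eventually_elim (use q in \<open>simp add: power_diff\<close>)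
  ultimately show "(\<lambda>M. 1 + real (2 * M) * (- (q ^ (M - k)))) \<longlonglongrightarrow> 1"
    by (auto elim: Lim_transform_eventually)
qed simp

text \<open>Here the nome is x = exp(-pi t) and the base of the q-factorials is x^2. Writing the
  finite sum as a full series confines M to the coefficients, so that domination and limit can be
  taken termwise.\<close>

lemma theta_trunc_eq:
  assumes t: "t > 0"
  shows "theta_trunc M t = theta_coeff (exp (- 2 * pi * t)) M 0 +
     2 * (\<Sum>k. exp (- pi * t * (real (Suc k))\<^sup>2) * theta_coeff (exp (- 2 * pi * t)) M (Suc k))"
proof -
  define x where "x = exp (- pi * t)"
  have x: "0 < x" "x < 1" using t by (auto simp: x_def)
  have x2: "x\<^sup>2 = exp (- 2 * pi * t)" by (simp add: x_def flip: exp_double)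
  have xk: "x powi ((int k)\<^sup>2) = exp (- pi * t * (real k)\<^sup>2)" for k
  proof -
    have "x powi ((int k)\<^sup>2) = x ^ (k\<^sup>2)" by (simp flip: of_nat_power)
    then show ?thesis by (simp add: x_def mult.commute flip: exp_of_nat_mult)
  qed
  let ?c = "theta_coeff (x\<^sup>2) M"
  have q: "0 < x\<^sup>2" "x\<^sup>2 < 1" using x by (auto simp: power_less_one_iff)
  have p1: "(\<Prod>n=1..M. 1 - exp (- 2 * real n * pi * t)) = (\<Prod>n=1..M. 1 - (x\<^sup>2) ^ n)"
    unfolding x2 by (intro prod.cong refl) (simp add: algebra_simps flip: exp_of_nat_mult)
  have p2: "(\<Prod>n=1..M. 1 + exp (- (2 * real n - 1) * pi * t)) = (\<Prod>n=1..M. 1 + x ^ (2 * n - 1))"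
    by (intro prod.cong refl) (simp add: x_def algebra_simps of_nat_diff flip: exp_of_nat_mult)
  have "theta_trunc M t = (\<Prod>n=1..M. 1 - (x\<^sup>2) ^ n) * (\<Sum>k\<in>{- int M..int M}. x powi (k\<^sup>2) * qcoeff (x\<^sup>2) M k)"
    unfolding theta_trunc_def p1 p2 jacobi_finite[OF x] ..
  also have "\<dots> = ?c 0 + 2 * (\<Sum>k<M. exp (- pi * t * (real (Suc k))\<^sup>2) * ?c (Suc k))"
  proof -
    have c: "(\<Prod>n=1..M. 1 - (x\<^sup>2) ^ n) * (x powi ((int k)\<^sup>2) * qcoeff (x\<^sup>2) M (int k)) =
        exp (- pi * t * (real k)\<^sup>2) * ?c k" for k
      by (simp only: xk theta_coeff_eq[OF q, symmetric] mult.left_commute)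
    show ?thesis
      using c[of 0] c[of "Suc k" for k]
      by (subst sum_int_symmetric) (simp_all add: qcoeff_minus distrib_left sum_distrib_left mult.left_commute[of _ 2])
  qed
  also have "(\<Sum>k<M. exp (- pi * t * (real (Suc k))\<^sup>2) * ?c (Suc k)) = (\<Sum>k. exp (- pi * t * (real (Suc k))\<^sup>2) * ?c (Suc k))"
    by (rule suminf_finite[symmetric]) (auto simp: theta_coeff_def)
  finally show ?thesis by (simp only: x2)
qed

lemma summable_theta:
  assumes t: "t > 0"
  shows "summable (\<lambda>k. exp (- pi * t * (real (Suc k))\<^sup>2))"
proof (rule summable_comparison_test'[of "\<lambda>k. exp (- pi * t) ^ k" 0])
  show "summable (\<lambda>k. exp (- pi * t) ^ k)" using t by (intro summable_geometric) simp
  fix k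
  have "real k \<le> (real (Suc k))\<^sup>2" by (simp add: power2_eq_square algebra_simps)
  then show "norm (exp (- pi * t * (real (Suc k))\<^sup>2)) \<le> exp (- pi * t) ^ k"
    using t by (simp flip: exp_of_nat_mult add: mult.commute mult_left_mono)
qed

lemma theta_trunc_bounds:
  assumes t: "t > 0"
  shows "0 \<le> theta_trunc M t" "theta_trunc M t \<le> theta t"
proof -
  show "0 \<le> theta_trunc M t"
    unfolding theta_trunc_def using t by (intro mult_nonneg_nonneg prod_nonneg) auto
  have q: "0 < exp (- 2 * pi * t)" "exp (- 2 * pi * t) < 1" using t by auto
  note b = theta_coeff_bounds[OF q, of M]
  have le: "exp (- pi * t * (real (Suc k))\<^sup>2) * theta_coeff (exp (- 2 * pi * t)) M (Suc k) \<le> exp (- pi * t * (real (Suc k))\<^sup>2)" for k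
    using b by (intro mult_left_le) auto
  have "summable (\<lambda>k. exp (- pi * t * (real (Suc k))\<^sup>2) * theta_coeff (exp (- 2 * pi * t)) M (Suc k))"
    using le b by (intro summable_comparison_test'[OF summable_theta[OF t], of 0]) (simp add: abs_mult)
  then show "theta_trunc M t \<le> theta t"
    unfolding theta_trunc_eq[OF t] theta_def using b le summable_theta[OF t]
    by (intro add_mono mult_left_mono suminf_le) auto
qed

lemma theta_trunc_tendsto:
  assumes t: "t > 0"
  shows "(\<lambda>M. theta_trunc M t) \<longlonglongrightarrow> theta t"
proof -
  have q: "0 < exp (- 2 * pi * t)" "exp (- 2 * pi * t) < 1" using t by auto
  let ?f = "\<lambda>k M. exp (- pi * t * (real (Suc k))\<^sup>2) * theta_coeff (exp (- 2 * pi * t)) M (Suc k)"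
  have "(\<lambda>M. \<Sum>k. ?f k M) \<longlonglongrightarrow> (\<Sum>k. exp (- pi * t * (real (Suc k))\<^sup>2) * 1)"
  proof (rule tannerys_theorem[of ?f _ sequentially "\<lambda>k. exp (- pi * t * (real (Suc k))\<^sup>2)", THEN conjunct2, THEN conjunct2])
    show "\<forall>\<^sub>F (k, M) in at_top \<times>\<^sub>F sequentially. norm (?f k M) \<le> exp (- pi * t * (real (Suc k))\<^sup>2)"
      using theta_coeff_bounds[OF q] by (intro always_eventually) (auto simp: abs_mult mult_left_le)
    show "(\<lambda>M. ?f k M) \<longlonglongrightarrow> exp (- pi * t * (real (Suc k))\<^sup>2) * 1" for k
      by (intro tendsto_mult tendsto_const theta_coeff_tendsto q)
  qed (use summable_theta[OF t] in auto)
  then show ?thesis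
    unfolding theta_trunc_eq[OF t] theta_def
    by (intro tendsto_add tendsto_mult tendsto_const theta_coeff_tendsto q) simp
qed

section \<open>Products and partial fractions for the hyperbolic sine\<close>

text \<open>The decay rates of the exponentials in theta(pi t/2), and at the same time minus the
  zeros of sinh(sqrt(2l))/sqrt(2l) in l. Indexing starts at 0, so \<open>pole 0\<close> is
  pi^2/2.\<close>

definition pole :: "nat \<Rightarrow> real" where
  "pole n = pi\<^sup>2 * (real (Suc n))\<^sup>2 / 2"

lemma pole_pos: "pole n > 0"
  by (simp add: pole_def)

lemma pole_ge: "pole n \<ge> pi\<^sup>2 / 2"
proof -
  have "1 \<le> (real (Suc n))\<^sup>2" by (rule one_le_power) simp
  then show ?thesis unfolding pole_def by (simp add: divide_right_mono)
qed

lemma summable_inverse_pole: "summable (\<lambda>n. 1 / pole n)"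
proof -
  have "summable (\<lambda>n. 2 / pi\<^sup>2 * inverse ((real (Suc n)) ^ 2))"
    by (intro summable_mult iffD2[OF summable_Suc_iff] inverse_power_summable) auto
  then show ?thesis by (simp add: pole_def field_simps)
qed

text \<open>Euler's product for the sine at the imaginary point i u / pi with u = sqrt(2l).\<close>

lemma sinh_product:
  assumes l: "l > 0"
  shows "(\<lambda>N. \<Prod>n<N. 1 + l / pole n) \<longlonglongrightarrow> sinh (sqrt (2 * l)) / sqrt (2 * l)"
proof -
  define u where "u = sqrt (2 * l)"
  have u: "u > 0" "u\<^sup>2 = 2 * l" using l by (auto simp: u_def)
  have "(\<lambda>n. of_real pi * (\<i> * of_real u / of_real pi) * (\<Prod>k=1..n. 1 - (\<i> * of_real u / of_real pi)^2 / of_nat k^2)) \<longlonglongrightarrow> sin (of_real pi * (\<i> * of_real u / of_real pi) :: complex)"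
    by (rule sin_product_formula_complex)
  moreover have "(\<Prod>k=1..n. 1 - (\<i> * of_real u / of_real pi)^2 / of_nat k^2) = (of_real (\<Prod>n<n. 1 + l / pole n) :: complex)" for n
  proof -
    have "(\<Prod>k=1..n. 1 - (\<i> * of_real u / of_real pi)^2 / of_nat k^2) = (\<Prod>k<n. 1 - (\<i> * of_real u / of_real pi)^2 / of_nat (Suc k) ^2 :: complex)"
      by (rule prod.reindex_bij_witness[of _ Suc "\<lambda>k. k - 1"]) auto
    also have "\<dots> = (\<Prod>k<n. of_real (1 + l / pole k))"
    proof (intro prod.cong refl)
      fix k
      have "1 - (\<i> * of_real u / of_real pi)^2 / of_nat (Suc k) ^2 = (of_real (1 + u\<^sup>2 / pi\<^sup>2 / (real (Suc k))\<^sup>2) :: complex)"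
        by (simp add: power_divide power_mult_distrib del: of_nat_Suc)
      then show "1 - (\<i> * of_real u / of_real pi)^2 / of_nat (Suc k) ^2 = (of_real (1 + l / pole k) :: complex)"
        by (simp add: u(2) pole_def field_simps)
    qed
    finally show ?thesis by simp
  qed
  ultimately have "(\<lambda>n. \<i> * of_real u * of_real (\<Prod>n<n. 1 + l / pole n)) \<longlonglongrightarrow> sin (\<i> * of_real u)"
    by simp
  then have "(\<lambda>n. (\<i> * of_real u * of_real (\<Prod>n<n. 1 + l / pole n)) / (\<i> * of_real u)) \<longlonglongrightarrow> sin (\<i> * of_real u) / (\<i> * of_real u)"
    using u by (intro tendsto_divide) auto
  moreover have "sin (\<i> * of_real u) / (\<i> * of_real u) = of_real (sinh u / u)"
  proof -
    have "sinh (of_real u :: complex) = of_real (sinh u)"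
      by (simp add: sinh_def exp_minus scaleR_conv_of_real exp_of_real)
    then show ?thesis by (simp add: sin_conv_sinh sinh_minus flip: mult.assoc)
  qed
  ultimately have "(\<lambda>n. of_real (\<Prod>n<n. 1 + l / pole n) :: complex) \<longlonglongrightarrow> of_real (sinh u / u)"
    using u by simp
  then show ?thesis unfolding tendsto_of_real_iff u_def .
qed

text \<open>Euler's product at the real point z = sqrt(2l)/pi. Below the first pole z lies in (0,1),
  where sin(pi z) > 0; the positive limit is what keeps the exponential moments of \<open>S2\<close>
  finite.\<close>

lemma sin_product:
  assumes l: "0 < l" "l < pi\<^sup>2 / 2"
  obtains L where "L > 0" "(\<lambda>N. \<Prod>n<N. 1 - l / pole n) \<longlonglongrightarrow> L"
proof -
  define z where "z = sqrt (2 * l) / pi"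
  have z0: "z > 0" "z\<^sup>2 = 2 * l / pi\<^sup>2" using l by (auto simp: z_def power_divide)
  have "sqrt (2 * l) < sqrt (pi\<^sup>2)" using l by (intro real_sqrt_less_mono) auto
  then have z1: "z < 1" by (simp add: z_def field_simps)
  have "(\<lambda>n. \<Prod>k=1..n. 1 - z^2 / of_nat k^2) \<longlonglongrightarrow> sin (pi * z) / (pi * z)"
    using z0 by (intro sin_product_formula_real') auto
  moreover have "(\<Prod>k=1..n. 1 - z^2 / of_nat k^2) = (\<Prod>k<n. 1 - l / pole k)" for n
  proof -
    have "(\<Prod>k=1..n. 1 - z^2 / of_nat k^2) = (\<Prod>k<n. 1 - z^2 / of_nat (Suc k)^2)"
      by (rule prod.reindex_bij_witness[of _ Suc "\<lambda>k. k - 1"]) auto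
    also have "\<dots> = (\<Prod>k<n. 1 - l / pole k)"
      by (intro prod.cong refl) (simp add: z0(2) pole_def field_simps)
    finally show ?thesis .
  qed
  ultimately have "(\<lambda>n. \<Prod>k<n. 1 - l / pole k) \<longlonglongrightarrow> sin (pi * z) / (pi * z)" by simp
  moreover have "sin (pi * z) / (pi * z) > 0"
    using z0 z1 by (intro divide_pos_pos sin_gt_zero) auto
  ultimately show ?thesis using that by blast
qed

lemma summable_inverse_pole_shift:
  assumes l: "l > 0"
  shows "summable (\<lambda>n. 1 / (l + pole n))" "summable (\<lambda>n. 1 / (l + pole n)\<^sup>2)"
proof -
  note pp = pole_pos
  show 1: "summable (\<lambda>n. 1 / (l + pole n))"
    using pp l by (intro summable_comparison_test'[OF summable_inverse_pole, of 0]) (auto simp: divide_simps add_pos_pos abs_of_pos)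
  show "summable (\<lambda>n. 1 / (l + pole n)\<^sup>2)"
  proof (rule summable_comparison_test'[OF summable_mult[OF 1, of "1 / l"], of 0])
    fix n
    have "l * (l + pole n) \<le> (l + pole n) * (l + pole n)"
      using pp[of n] l by (intro mult_right_mono) auto
    then have "1 / ((l + pole n) * (l + pole n)) \<le> 1 / (l * (l + pole n))"
      using pp[of n] l by (intro divide_left_mono) auto
    then show "norm (1 / (l + pole n)\<^sup>2) \<le> 1 / l * (1 / (l + pole n))"
      using pp[of n] l by (simp add: power2_eq_square)
  qed
qed

text \<open>With \<open>u = sqrt (2 * l)\<close>, this is the second logarithmic derivative of the product for
  \<open>sinh u / u\<close>.\<close>

lemma sinh_partial_fractions:
  assumes l: "l > 0"
  shows "(1 - (sqrt (2 * l) / sinh (sqrt (2 * l)))\<^sup>2) / l =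
           2 * (\<Sum>n. 1 / (l + pole n)) - 4 * l * (\<Sum>n. 1 / (l + pole n)\<^sup>2)"
proof -
  \<comment> \<open>The logarithm of the product and, by termwise differentiation, its first two
    derivatives. Uniqueness of derivatives, compared with ln(sinh u / u), evaluates both derived
    series in closed form.\<close>
  define L where "L = (\<lambda>x. \<Sum>n. ln (1 + x / pole n))"
  define L1 where "L1 = (\<lambda>x. \<Sum>n. 1 / (x + pole n))"
  define L2 where "L2 = (\<lambda>x. \<Sum>n. - 1 / (x + pole n)\<^sup>2)"
  let ?S = "{0<..} :: real set"
  note pp = pole_pos
  have nz: "x + pole n \<noteq> 0" if "x > 0" for x n using pp[of n] that by linarith
  have dL: "((\<lambda>x. \<Sum>n. ln (1 + x / pole n)) has_field_derivative L1 x) (at x)"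
    and sL: "summable (\<lambda>n. ln (1 + x / pole n))" if x: "x > 0" for x
  proof -
    have uc: "uniformly_convergent_on ?S (\<lambda>n x. \<Sum>i<n. 1 / (x + pole i))"
      using summable_inverse_pole pp
      by (intro Weierstrass_m_test'[of _ _ "\<lambda>n. 1 / pole n"])
         (auto simp: divide_simps add_pos_pos abs_of_pos intro!: mult_mono add_increasing)
    have d: "((\<lambda>x. ln (1 + x / pole n)) has_field_derivative 1 / (x + pole n)) (at x within ?S)"
      if "x \<in> ?S" for n x
      using that pp[of n] nz[of x n] by (auto intro!: derivative_eq_intros simp: field_simps add_pos_pos)
    have s: "summable (\<lambda>n. ln (1 + 1 / pole n))"
    proof (rule summable_comparison_test'[OF summable_inverse_pole, of 0])
      fix n show "norm (ln (1 + 1 / pole n)) \<le> 1 / pole n"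
        using pp[of n] ln_add_one_self_le_self[of "1 / pole n"] by simp
    qed
    note D = has_field_derivative_series'[of ?S "\<lambda>n x. ln (1 + x / pole n)" "\<lambda>n x. 1 / (x + pole n)" 1 x, OF _ d uc _ s]
    show "((\<lambda>x. \<Sum>n. ln (1 + x / pole n)) has_field_derivative L1 x) (at x)"
      unfolding L1_def using D(2) x by (simp add: interior_open)
    show "summable (\<lambda>n. ln (1 + x / pole n))" using D(1) x by (simp add: interior_open)
  qed
  have dL1: "(L1 has_field_derivative L2 x) (at x)" if x: "x > 0" for x
  proof -
    have uc: "uniformly_convergent_on ?S (\<lambda>n x. \<Sum>i<n. - 1 / (x + pole i)\<^sup>2)"
    proof (rule Weierstrass_m_test'[of _ _ "\<lambda>n. 2 / pi\<^sup>2 * (1 / pole n)"])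
      fix n and x :: real assume x: "x \<in> ?S"
      have "pi\<^sup>2 / 2 * pole n \<le> (x + pole n) * (x + pole n)"
        using pole_ge[of n] pp[of n] x by (intro mult_mono) auto
      then show "norm (- 1 / (x + pole n)\<^sup>2) \<le> 2 / pi\<^sup>2 * (1 / pole n)"
        using pp[of n] nz[of x n] x by (simp add: power2_eq_square divide_simps)
    qed (intro summable_mult summable_inverse_pole)
    have d: "((\<lambda>x. 1 / (x + pole n)) has_field_derivative - 1 / (x + pole n)\<^sup>2) (at x within ?S)"
      if "x \<in> ?S" for n x
      using that pp[of n] nz[of x n] by (auto intro!: derivative_eq_intros simp: field_simps power2_eq_square)
    have s: "summable (\<lambda>n. 1 / (1 + pole n))"
      using pp by (intro summable_comparison_test'[OF summable_inverse_pole, of 0]) (auto simp: divide_simps add_pos_pos abs_of_pos)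
    show ?thesis
      unfolding L1_def L2_def
      using has_field_derivative_series'(2)[of ?S "\<lambda>n x. 1 / (x + pole n)" "\<lambda>n x. - 1 / (x + pole n)\<^sup>2" 1 x, OF _ d uc _ s] x by (simp add: interior_open)
  qed
  have L_eq: "L x = ln (sinh (sqrt (2 * x))) - ln (sqrt (2 * x))" if x: "x > 0" for x
  proof -
    have "(\<lambda>N. \<Sum>n<N. ln (1 + x / pole n)) \<longlonglongrightarrow> ln (sinh (sqrt (2 * x)) / sqrt (2 * x))"
    proof -
      have "ln (\<Prod>n<N. 1 + x / pole n) = (\<Sum>n<N. ln (1 + x / pole n))" for N
        using less_imp_neq[OF add_pos_pos[OF zero_less_one divide_pos_pos[OF x pp]]] by (intro ln_prod) auto
      moreover have "(\<lambda>N. ln (\<Prod>n<N. 1 + x / pole n)) \<longlonglongrightarrow> ln (sinh (sqrt (2 * x)) / sqrt (2 * x))"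
        using x by (intro tendsto_ln sinh_product) auto
      ultimately show ?thesis by simp
    qed
    moreover have "(\<lambda>N. \<Sum>n<N. ln (1 + x / pole n)) \<longlonglongrightarrow> L x"
      unfolding L_def using summable_LIMSEQ[OF sL[OF x]] .
    ultimately have "L x = ln (sinh (sqrt (2 * x)) / sqrt (2 * x))" using LIMSEQ_unique by blast
    then show ?thesis using x by (simp add: ln_div)
  qed
  define K1 where "K1 = (\<lambda>x. cosh (sqrt (2 * x)) / (sinh (sqrt (2 * x)) * sqrt (2 * x)) - 1 / (2 * x))"
  have L1_eq: "L1 x = K1 x" if x: "x > 0" for x
  proof -
    have "((\<lambda>x. ln (sinh (sqrt (2 * x))) - ln (sqrt (2 * x))) has_field_derivative K1 x) (at x)"
      unfolding K1_def using x
      by (auto intro!: derivative_eq_intros simp: field_simps)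
    moreover have "\<forall>\<^sub>F y in nhds x. ln (sinh (sqrt (2 * y))) - ln (sqrt (2 * y)) = L y"
      using eventually_nhds_in_open[of ?S x] x by (auto elim!: eventually_mono simp: L_eq)
    ultimately have "(L has_field_derivative K1 x) (at x)"
      by (subst (asm) DERIV_cong_ev[OF refl _ refl]) auto
    then show ?thesis using dL[OF x] DERIV_unique unfolding L_def by blast
  qed
  define u where "u = sqrt (2 * l)"
  have u: "u > 0" "u\<^sup>2 = 2 * l" "sinh u > 0" using l by (auto simp: u_def)
  have L2_eq: "L2 l = ((sinh u)\<^sup>2 - (cosh u)\<^sup>2) / ((sinh u)\<^sup>2 * u\<^sup>2) - cosh u / (sinh u * u ^ 3) + 2 / u ^ 4"
  proof -
    have "(K1 has_field_derivative ((sinh u)\<^sup>2 - (cosh u)\<^sup>2) / ((sinh u)\<^sup>2 * u\<^sup>2) - cosh u / (sinh u * u ^ 3) + 2 / u ^ 4) (at l)"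
    proof -
      have s: "((\<lambda>x. sqrt (2 * x)) has_field_derivative 1 / u) (at l)"
        using l by (auto intro!: derivative_eq_intros simp: u_def field_simps)
      have g: "((\<lambda>v. cosh v / (sinh v * v)) has_field_derivative
          (sinh u * (sinh u * u) - cosh u * (cosh u * u + sinh u)) / (sinh u * u)\<^sup>2) (at (sqrt (2 * l)))"
        unfolding u_def[symmetric] using u
        by (auto intro!: derivative_eq_intros simp: power2_eq_square algebra_simps)
      have h: "((\<lambda>x. 1 / (2 * x)) has_field_derivative - 1 / (2 * l\<^sup>2)) (at l)"
        using l by (auto intro!: derivative_eq_intros simp: power2_eq_square field_simps)
      have l4: "l\<^sup>2 = u ^ 4 / 4" using u(2) by (simp add: power4_eq_xxxx power2_eq_square)
      have "(sinh u * (sinh u * u) - cosh u * (cosh u * u + sinh u)) / (sinh u * u)\<^sup>2 * (1 / u) - - 1 / (2 * l\<^sup>2) =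
        ((sinh u)\<^sup>2 - (cosh u)\<^sup>2) / ((sinh u)\<^sup>2 * u\<^sup>2) - cosh u / (sinh u * u ^ 3) + 2 / u ^ 4"
        unfolding l4 using u(1,3) by (simp add: field_simps power2_eq_square power3_eq_cube power4_eq_xxxx)
      then show ?thesis
        using DERIV_diff[OF DERIV_chain2[OF g s] h] by (simp only: K1_def)
    qed
    moreover have "\<forall>\<^sub>F y in nhds l. K1 y = L1 y"
      using eventually_nhds_in_open[of ?S l] l by (auto elim!: eventually_mono simp: L1_eq)
    ultimately have "(L1 has_field_derivative ((sinh u)\<^sup>2 - (cosh u)\<^sup>2) / ((sinh u)\<^sup>2 * u\<^sup>2) - cosh u / (sinh u * u ^ 3) + 2 / u ^ 4) (at l)"
      by (subst (asm) DERIV_cong_ev[OF refl _ refl]) auto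
    then show ?thesis using dL1[OF l] DERIV_unique by blast
  qed
  have sq: "(cosh u)\<^sup>2 = (sinh u)\<^sup>2 + 1" by (rule cosh_square_eq)
  have f1: "L1 l = cosh u / (sinh u * u) - 1 / u\<^sup>2"
    unfolding L1_eq[OF l] K1_def using u by (simp add: u_def)
  have f2: "L2 l = - 1 / ((sinh u)\<^sup>2 * u\<^sup>2) - cosh u / (sinh u * u ^ 3) + 2 / u ^ 4"
    unfolding L2_eq sq by simp
  have f3: "(1 - (u / sinh u)\<^sup>2) / l = 2 * (cosh u / (sinh u * u) - 1 / u\<^sup>2) + 2 * u\<^sup>2 * (- 1 / ((sinh u)\<^sup>2 * u\<^sup>2) - cosh u / (sinh u * u ^ 3) + 2 / u ^ 4)"
  proof -
    have l_eq: "l = u\<^sup>2 / 2" using u by simp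
    show ?thesis
      unfolding l_eq using u(1,3) by (simp add: field_simps power2_eq_square power3_eq_cube power4_eq_xxxx)
  qed
  have f4: "L2 l = - (\<Sum>n. 1 / (l + pole n)\<^sup>2)"
  proof -
    show ?thesis unfolding L2_def using suminf_minus[OF summable_inverse_pole_shift(2)[OF l]] by simp
  qed
  have "(1 - (u / sinh u)\<^sup>2) / l = 2 * L1 l + 2 * u\<^sup>2 * L2 l"
    unfolding f1 f2 f3 ..
  then show ?thesis
    unfolding f4 u(2) L1_def by (simp add: u_def)
qed

section \<open>Series of gamma variables\<close>

locale gamma_variables = prob_space P for P :: "'a measure" +
  fixes G :: "nat \<Rightarrow> 'a \<Rightarrow> real"
  assumes G_distributed: "\<And>n. n \<ge> 1 \<Longrightarrow>
      distributed P lborel (G n) (\<lambda>x. ennreal (x * exp (- x) * indicator {0<..} x))"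
    and G_indep: "indep_vars (\<lambda>_. borel) G {1..}"
begin

lemma G_measurable[measurable]: "G (Suc n) \<in> borel_measurable P"
  using distributed_measurable[OF G_distributed[of "Suc n"]] by simp

lemma G_nn_integral:
  assumes [measurable]: "f \<in> borel_measurable borel"
  shows "(\<integral>\<^sup>+\<omega>. f (G (Suc n) \<omega>) \<partial>P) = (\<integral>\<^sup>+x. ennreal (x * exp (- x) * indicator {0<..} x) * f x \<partial>lborel)"
  using distributed_nn_integral[OF G_distributed[of "Suc n"], of f] by simp

lemma G_pos: "AE \<omega> in P. \<forall>n. 0 < G (Suc n) \<omega>"
proof -
  have "AE \<omega> in P. 0 < G (Suc n) \<omega>" for n
  proof -
    have "AE x in distr P lborel (G (Suc n)). 0 < x"
      unfolding distributed_distr_eq_density[OF G_distributed[of "Suc n"], simplified]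
      by (subst AE_density) (auto simp: indicator_def)
    then show ?thesis by (subst (asm) AE_distr_iff) auto
  qed
  then show ?thesis by (simp add: AE_all_countable)
qed

lemma G_exp:
  assumes c: "c > -1"
  shows "(\<integral>\<^sup>+\<omega>. ennreal (exp (- c * G (Suc n) \<omega>)) \<partial>P) = ennreal (1 / (1 + c)\<^sup>2)"
proof -
  have "(\<integral>\<^sup>+\<omega>. ennreal (exp (- c * G (Suc n) \<omega>)) \<partial>P) =
      (\<integral>\<^sup>+x. ennreal (x * exp (- x) * indicator {0<..} x) * ennreal (exp (- c * x)) \<partial>lborel)"
    by (subst G_nn_integral) auto
  also have "\<dots> = (\<integral>\<^sup>+x. ennreal (x * exp (- (1 + c) * x) * indicator {0<..} x) \<partial>lborel)"
    by (intro nn_integral_cong) (auto simp: indicator_def ennreal_mult[symmetric] algebra_simps simp flip: exp_add)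
  finally show ?thesis using c by (simp only: nn_integral_x_exp)
qed

lemma G_inverse: "(\<integral>\<^sup>+\<omega>. ennreal (c / G (Suc n) \<omega>) \<partial>P) = ennreal c" if c: "c > 0"
proof -
  have "(\<integral>\<^sup>+\<omega>. ennreal (c / G (Suc n) \<omega>) \<partial>P) =
      (\<integral>\<^sup>+x. ennreal (x * exp (- x) * indicator {0<..} x) * ennreal (c / x) \<partial>lborel)"
    by (subst G_nn_integral[of "\<lambda>x. ennreal (c / x)"]) auto
  also have "\<dots> = (\<integral>\<^sup>+x. ennreal c * ennreal (exp (- 1 * x) * indicator {0<..} x) \<partial>lborel)"
    using c by (intro nn_integral_cong) (auto simp: indicator_def ennreal_mult[symmetric])
  also have "\<dots> = ennreal c"
    using c by (subst nn_integral_cmult) (auto simp only: nn_integral_exp, auto)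
  finally show ?thesis .
qed

lemma G_expectation: "(\<integral>\<^sup>+\<omega>. ennreal (G (Suc n) \<omega>) \<partial>P) = 2"
proof -
  have "(\<integral>\<^sup>+\<omega>. ennreal (G (Suc n) \<omega>) \<partial>P) =
      (\<integral>\<^sup>+x. ennreal (x * exp (- x) * indicator {0<..} x) * ennreal x \<partial>lborel)"
    by (subst G_nn_integral[of "\<lambda>x. ennreal x"]) auto
  also have "\<dots> = (\<integral>\<^sup>+x. ennreal (x powr (3 - 1) * exp (- 1 * x) * indicator {0<..} x) \<partial>lborel)"
    by (intro nn_integral_cong) (auto simp: indicator_def ennreal_mult[symmetric] power2_eq_square)
  also have "\<dots> = 2"
    by (subst nn_integral_Gamma) (auto simp: Gamma_numeral fact_numeral)
  finally show ?thesis .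
qed

lemma G_prod:
  assumes [measurable]: "\<And>i. f i \<in> borel_measurable borel"
  shows "(\<integral>\<^sup>+\<omega>. (\<Prod>i<N. f i (G (Suc i) \<omega>)) \<partial>P) = (\<Prod>i<N. (\<integral>\<^sup>+\<omega>. f i (G (Suc i) \<omega>) \<partial>P) :: ennreal)"
proof -
  have "indep_vars (\<lambda>_. borel) (\<lambda>i \<omega>. f (i - 1) (G i \<omega>)) {1..N}"
    by (rule indep_vars_compose2[OF indep_vars_subset[OF G_indep]]) auto
  then have "(\<integral>\<^sup>+\<omega>. (\<Prod>i\<in>{1..N}. f (i - 1) (G i \<omega>)) \<partial>P) = (\<Prod>i\<in>{1..N}. \<integral>\<^sup>+\<omega>. f (i - 1) (G i \<omega>) \<partial>P)"
    by (intro indep_vars_nn_integral) auto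
  moreover have reindex: "(\<Prod>i\<in>{1..N}. g (i - 1) i) = (\<Prod>i<N. g i (Suc i))" for g :: "nat \<Rightarrow> nat \<Rightarrow> ennreal"
    by (rule prod.reindex_bij_witness[of _ Suc "\<lambda>k. k - 1"]) auto
  ultimately show ?thesis
    by (simp only: reindex[of "\<lambda>i j. f i (G j \<omega>)" for \<omega>] reindex[of "\<lambda>i j. \<integral>\<^sup>+\<omega>. f i (G j \<omega>) \<partial>P"])
qed

text \<open>Each gamma variable has mean 2, so the series has the finite mean given by the sum of 2
  / \<open>c n\<close>, and a nonnegative variable of finite mean is almost surely finite.\<close>

lemma G_series_summable:
  assumes c: "\<And>n. c n > 0" "summable (\<lambda>n. 1 / c n)"
  shows "AE \<omega> in P. summable (\<lambda>n. G (Suc n) \<omega> / c n)"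
proof -
  have "(\<integral>\<^sup>+\<omega>. (\<Sum>n. ennreal (G (Suc n) \<omega> / c n)) \<partial>P) = (\<Sum>n. \<integral>\<^sup>+\<omega>. ennreal (G (Suc n) \<omega> / c n) \<partial>P)"
    by (rule nn_integral_suminf) auto
  also have "\<dots> = (\<Sum>n. ennreal (2 / c n))"
  proof (intro suminf_cong)
    fix n
    have "(\<integral>\<^sup>+\<omega>. ennreal (G (Suc n) \<omega> / c n) \<partial>P) = (\<integral>\<^sup>+\<omega>. ennreal (1 / c n) * ennreal (G (Suc n) \<omega>) \<partial>P)"
      using G_pos c by (intro nn_integral_cong_AE) (auto elim!: eventually_mono simp: ennreal_mult'[symmetric] less_imp_le)
    also have "\<dots> = ennreal (1 / c n) * ennreal 2"
      by (subst nn_integral_cmult) (auto simp: G_expectation)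
    also have "\<dots> = ennreal (2 / c n)" using c(1)[of n] by (simp add: ennreal_mult'[symmetric] flip: ennreal_numeral)
    finally show "(\<integral>\<^sup>+\<omega>. ennreal (G (Suc n) \<omega> / c n) \<partial>P) = ennreal (2 / c n)" .
  qed
  also have "\<dots> < top"
  proof -
    have "summable (\<lambda>n. 2 / c n)" using summable_mult[OF c(2), of 2] by simp
    then show ?thesis using c(1) by (subst suminf_ennreal2) (auto simp: less_imp_le)
  qed
  finally have "AE \<omega> in P. (\<Sum>n. ennreal (G (Suc n) \<omega> / c n)) \<noteq> \<infinity>"
    by (intro nn_integral_PInf_AE) auto
  with G_pos show ?thesis
    by eventually_elim (rule summable_suminf_not_top, auto intro!: divide_nonneg_pos c intro: less_imp_le)
qed

text \<open>The factor \<open>H\<close> lets one limit serve two purposes: H = 1 for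
  \<open>S2\<close>, and H = B powr l for the extra summand -ln B of the representation. All
  products are bounded by 1.\<close>

lemma laplace_partial_tendsto:
  assumes c: "\<And>n. c n > 0" "summable (\<lambda>n. 1 / c n)" and l: "l \<ge> 0"
    and [measurable]: "H \<in> borel_measurable P" and H: "AE \<omega> in P. 0 \<le> H \<omega> \<and> H \<omega> \<le> 1"
  shows "(\<lambda>N. \<integral>\<^sup>+\<omega>. ennreal (H \<omega>) * (\<Prod>n<N. ennreal (exp (- (l / c n) * G (Suc n) \<omega>))) \<partial>P)
     \<longlonglongrightarrow> (\<integral>\<^sup>+\<omega>. ennreal (H \<omega> * exp (- l * (\<Sum>n. G (Suc n) \<omega> / c n))) \<partial>P)"
proof (rule nn_integral_dominated_convergence[where w = "\<lambda>_. 1"])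
  have eq: "ennreal (H \<omega>) * (\<Prod>n<N. ennreal (exp (- (l / c n) * G (Suc n) \<omega>))) =
     ennreal (H \<omega> * exp (- l * (\<Sum>n<N. G (Suc n) \<omega> / c n)))" if "0 \<le> H \<omega>" for \<omega> N
    using that by (subst prod_ennreal) (auto simp: ennreal_mult[symmetric] exp_sum[symmetric] sum_distrib_left sum_negf)
  show "AE \<omega> in P. ennreal (H \<omega>) * (\<Prod>n<N. ennreal (exp (- (l / c n) * G (Suc n) \<omega>))) \<le> 1" for N
    using H G_pos
  proof eventually_elim
    case (elim \<omega>)
    have "0 \<le> (\<Sum>n<N. G (Suc n) \<omega> / c n)"
      using elim c by (intro sum_nonneg divide_nonneg_pos) (auto simp: less_imp_le)
    then have "exp (- l * (\<Sum>n<N. G (Suc n) \<omega> / c n)) \<le> 1" using l by simp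
    then show ?case using elim by (subst eq) (auto intro!: mult_le_one)
  qed
  show "AE \<omega> in P. (\<lambda>N. ennreal (H \<omega>) * (\<Prod>n<N. ennreal (exp (- (l / c n) * G (Suc n) \<omega>))))
      \<longlonglongrightarrow> ennreal (H \<omega> * exp (- l * (\<Sum>n. G (Suc n) \<omega> / c n)))"
    using H G_series_summable[OF c]
  proof eventually_elim
    case (elim \<omega>)
    then show ?case
      by (simp only: eq) (intro tendsto_ennrealI tendsto_intros summable_LIMSEQ, simp)
  qed
qed (auto simp: emeasure_space_1)

lemma laplace_tendsto:
  assumes c: "\<And>n. c n > 0" "summable (\<lambda>n. 1 / c n)" and l: "l \<ge> 0"
  shows "(\<lambda>N. ennreal (\<Prod>n<N. 1 / (1 + l / c n)\<^sup>2))
     \<longlonglongrightarrow> (\<integral>\<^sup>+\<omega>. ennreal (exp (- l * (\<Sum>n. G (Suc n) \<omega> / c n))) \<partial>P)"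
proof -
  have "(\<integral>\<^sup>+\<omega>. (\<Prod>n<N. ennreal (exp (- (l / c n) * G (Suc n) \<omega>))) \<partial>P) = ennreal (\<Prod>n<N. 1 / (1 + l / c n)\<^sup>2)" for N
  proof -
    have "l / c n > -1" for n using l c(1)[of n] by (smt (verit) divide_nonneg_pos)
    then have "(\<integral>\<^sup>+\<omega>. (\<Prod>n<N. ennreal (exp (- (l / c n) * G (Suc n) \<omega>))) \<partial>P) = (\<Prod>n<N. ennreal (1 / (1 + l / c n)\<^sup>2))"
      by (subst G_prod[of "\<lambda>n x. ennreal (exp (- (l / c n) * x))"]) (auto simp only: G_exp, measurable)
    then show ?thesis by (simp add: prod_ennreal)
  qed
  then show ?thesis
    using laplace_partial_tendsto[OF c l, of "\<lambda>_. 1"] by simp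
qed

lemma S2_measurable[measurable]: "S2 G \<in> borel_measurable P"
  unfolding S2_def[abs_def] by measurable

lemma S2_AE: "AE \<omega> in P. (\<forall>n. 0 < G (Suc n) \<omega>) \<and> summable (\<lambda>n. G (Suc n) \<omega> / pole n) \<and>
   S2 G \<omega> = (\<Sum>n. G (Suc n) \<omega> / pole n)"
  using G_pos G_series_summable[OF pole_pos summable_inverse_pole]
proof eventually_elim
  case (elim \<omega>)
  have eq: "G (Suc n) \<omega> / pole n = 2 / pi\<^sup>2 * (G (Suc n) \<omega> / (real (Suc n))\<^sup>2)" for n
    by (simp add: pole_def del: of_nat_Suc)
  have "summable (\<lambda>n. pi\<^sup>2 / 2 * (G (Suc n) \<omega> / pole n))" using elim by (intro summable_mult) auto
  then have "summable (\<lambda>n. G (Suc n) \<omega> / (real (Suc n))\<^sup>2)" by (simp add: eq del: of_nat_Suc)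
  then have "(\<Sum>n. G (Suc n) \<omega> / pole n) = S2 G \<omega>" unfolding eq S2_def by (rule suminf_mult)
  with elim show ?case by simp
qed

lemma S2_ge: "AE \<omega> in P. \<forall>n. 0 < G (Suc n) \<omega> \<and> G (Suc n) \<omega> / pole n \<le> S2 G \<omega>"
  using S2_AE
proof eventually_elim
  case (elim \<omega>)
  have "G (Suc n) \<omega> / pole n \<le> (\<Sum>n. G (Suc n) \<omega> / pole n)" for n
    using elim pole_pos sum_le_suminf[of "\<lambda>n. G (Suc n) \<omega> / pole n" "{n}"] by (auto simp: less_imp_le)
  with elim show ?case by simp
qed

lemma S2_pos: "AE \<omega> in P. 0 < S2 G \<omega>"
  using S2_ge
proof eventually_elim
  case (elim \<omega>)
  then show ?case using pole_pos[of 0] by (smt (verit) divide_pos_pos)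
qed

lemma laplace_S2:
  assumes l: "l > 0"
  shows "(\<integral>\<^sup>+\<omega>. ennreal (exp (- l * S2 G \<omega>)) \<partial>P) = ennreal ((sqrt (2 * l) / sinh (sqrt (2 * l)))\<^sup>2)"
proof -
  have "(\<integral>\<^sup>+\<omega>. ennreal (exp (- l * S2 G \<omega>)) \<partial>P) = (\<integral>\<^sup>+\<omega>. ennreal (exp (- l * (\<Sum>n. G (Suc n) \<omega> / pole n))) \<partial>P)"
    by (rule nn_integral_cong_AE) (use S2_AE in \<open>auto elim!: eventually_mono\<close>)
  moreover have "(\<lambda>N. ennreal (\<Prod>n<N. 1 / (1 + l / pole n)\<^sup>2)) \<longlonglongrightarrow> ennreal (1 / (sinh (sqrt (2 * l)) / sqrt (2 * l))\<^sup>2)"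
  proof -
    have "(\<lambda>N. 1 / (\<Prod>n<N. 1 + l / pole n)\<^sup>2) \<longlonglongrightarrow> 1 / (sinh (sqrt (2 * l)) / sqrt (2 * l))\<^sup>2"
      using l by (intro tendsto_intros sinh_product) auto
    then show ?thesis by (intro tendsto_ennrealI) (simp add: prod_dividef prod_power_distrib)
  qed
  ultimately show ?thesis
    using LIMSEQ_unique[OF laplace_tendsto[OF pole_pos summable_inverse_pole, of l]] l
    by (simp add: power_divide)
qed

text \<open>Only finiteness is wanted, so Fatou's lemma suffices: the partial products have
  expectation equal to the inverse square of the products in \<open>sin_product\<close>, and these
  converge to a positive limit.\<close>

lemma S2_exp_moment:
  assumes l: "0 < l" "l < pi\<^sup>2 / 2"
  shows "(\<integral>\<^sup>+\<omega>. ennreal (exp (l * S2 G \<omega>)) \<partial>P) < \<infinity>"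
proof -
  have lp: "l / pole n < 1" for n using pole_ge[of n] pole_pos[of n] l by (simp add: field_simps)
  obtain L where L: "L > 0" "(\<lambda>N. \<Prod>n<N. 1 - l / pole n) \<longlonglongrightarrow> L" using sin_product[OF l] .
  have eq: "(\<integral>\<^sup>+\<omega>. (\<Prod>n<N. ennreal (exp (l / pole n * G (Suc n) \<omega>))) \<partial>P) = ennreal (1 / (\<Prod>n<N. 1 - l / pole n)\<^sup>2)" for N
  proof -
    have "(\<integral>\<^sup>+\<omega>. (\<Prod>n<N. ennreal (exp (l / pole n * G (Suc n) \<omega>))) \<partial>P) = (\<Prod>n<N. \<integral>\<^sup>+\<omega>. ennreal (exp (l / pole n * G (Suc n) \<omega>)) \<partial>P)"
      by (rule G_prod) measurable
    also have "\<dots> = (\<Prod>n<N. ennreal (1 / (1 - l / pole n)\<^sup>2))"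
      using G_exp[of "- (l / pole n)" n for n] lp by (intro prod.cong refl) simp
    finally show ?thesis by (simp add: prod_ennreal prod_dividef prod_power_distrib)
  qed
  have "(\<integral>\<^sup>+\<omega>. ennreal (exp (l * S2 G \<omega>)) \<partial>P) = (\<integral>\<^sup>+\<omega>. liminf (\<lambda>N. \<Prod>n<N. ennreal (exp (l / pole n * G (Suc n) \<omega>))) \<partial>P)"
  proof (rule nn_integral_cong_AE)
    show "AE \<omega> in P. ennreal (exp (l * S2 G \<omega>)) = liminf (\<lambda>N. \<Prod>n<N. ennreal (exp (l / pole n * G (Suc n) \<omega>)))"
      using S2_AE
    proof eventually_elim
      case (elim \<omega>)
      have "(\<lambda>N. ennreal (exp (l * (\<Sum>n<N. G (Suc n) \<omega> / pole n)))) \<longlonglongrightarrow> ennreal (exp (l * S2 G \<omega>))"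
        using elim by (intro tendsto_ennrealI tendsto_intros) (auto intro: summable_LIMSEQ)
      then have "(\<lambda>N. \<Prod>n<N. ennreal (exp (l / pole n * G (Suc n) \<omega>))) \<longlonglongrightarrow> ennreal (exp (l * S2 G \<omega>))"
        by (simp add: prod_ennreal sum_distrib_left exp_sum)
      then show ?case by (intro lim_imp_Liminf[symmetric]) auto
    qed
  qed
  also have "\<dots> \<le> liminf (\<lambda>N. \<integral>\<^sup>+\<omega>. (\<Prod>n<N. ennreal (exp (l / pole n * G (Suc n) \<omega>))) \<partial>P)"
    by (rule nn_integral_liminf) measurable
  also have "\<dots> = ennreal (1 / L\<^sup>2)"
    unfolding eq using L by (intro lim_imp_Liminf tendsto_ennrealI tendsto_intros) auto
  finally show ?thesis by (simp add: order_le_less_trans)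
qed

text \<open>\<open>S2\<close> dominates each \<open>G (n + 1) / pole n\<close>, so \<open>1 / S2 ^ N\<close> is at most a product of \<open>N\<close> independent
  factors, each of finite mean because the density \<open>x exp (-x)\<close> vanishes at \<open>0\<close>.\<close>

lemma S2_inverse_moment: "(\<integral>\<^sup>+\<omega>. ennreal (1 / S2 G \<omega> ^ N) \<partial>P) < \<infinity>"
proof -
  have "(\<integral>\<^sup>+\<omega>. ennreal (1 / S2 G \<omega> ^ N) \<partial>P) \<le> (\<integral>\<^sup>+\<omega>. (\<Prod>n<N. ennreal (pole n / G (Suc n) \<omega>)) \<partial>P)"
  proof (rule nn_integral_mono_AE)
    show "AE \<omega> in P. ennreal (1 / S2 G \<omega> ^ N) \<le> (\<Prod>n<N. ennreal (pole n / G (Suc n) \<omega>))"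
      using S2_ge S2_pos
    proof eventually_elim
      case (elim \<omega>)
      have "1 / S2 G \<omega> ^ N = (\<Prod>n<N. 1 / S2 G \<omega>)" by (simp add: power_divide)
      also have "\<dots> \<le> (\<Prod>n<N. pole n / G (Suc n) \<omega>)"
        using elim pole_pos by (intro prod_mono) (auto simp: field_simps)
      finally show ?case using elim pole_pos by (subst prod_ennreal) (auto simp: less_imp_le intro!: ennreal_leI)
    qed
  qed
  also have "\<dots> = (\<Prod>n<N. ennreal (pole n))"
    by (subst G_prod[of "\<lambda>n x. ennreal (pole n / x)"]) (auto simp: G_inverse pole_pos)
  also have "\<dots> < \<infinity>" by (simp add: prod_ennreal pole_pos less_imp_le)
  finally show ?thesis .
qed

end

section \<open>The Laplace transform, representation and density of \<open>T\<close>\<close>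

lemma theta_measurable[measurable]: "theta \<in> borel_measurable borel"
  unfolding theta_def[abs_def] by measurable

lemma theta_trunc_measurable[measurable]: "theta_trunc M \<in> borel_measurable borel"
  unfolding theta_trunc_def[abs_def] by measurable

lemma summable_ln_pole:
  assumes q: "q \<ge> 0" and d: "d > 0"
  shows "summable (\<lambda>k. ln (1 + q / (pole k + d)))"
proof (rule summable_comparison_test'[OF summable_mult[OF summable_inverse_pole, of q], of 0])
  fix k
  have p: "pole k > 0" by (rule pole_pos)
  have "ln (1 + q / (pole k + d)) \<le> q / (pole k + d)"
    using q d p by (intro ln_add_one_self_le_self) (auto intro!: divide_nonneg_pos add_pos_pos)
  also have "\<dots> \<le> q * (1 / pole k)" using p q d by (simp add: frac_le)
  finally show "norm (ln (1 + q / (pole k + d))) \<le> q * (1 / pole k)"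
    using q d p by (simp add: abs_of_nonneg)
qed

text \<open>For t > 0 the theta factor is 1 plus twice the sum of exp(-\<open>pole k\<close> * t),
  which splits the integrand into nonnegative Frullani integrands with b = d and b =
  \<open>pole k\<close> + d.\<close>

lemma levy_integral:
  assumes q: "q \<ge> 0" and d: "d > 0"
  shows "(\<integral>\<^sup>+t. ennreal ((1 - exp (- q * t)) * exp (- d * t) * theta (pi * t / 2) / t * indicator {0<..} t) \<partial>lborel)
     = ennreal (ln (1 + q / d) + 2 * (\<Sum>k. ln (1 + q / (pole k + d))))"
proof -
  define K where "K = (\<lambda>b t. (1 - exp (- q * t)) * exp (- b * t) / t * indicator {0<..} t :: real)"
  have K0: "K b t \<ge> 0" for b t
    using q by (auto simp: K_def indicator_def)
  have [measurable]: "K b \<in> borel_measurable borel" for b unfolding K_def by measurable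
  have KI: "(\<integral>\<^sup>+t. ennreal (K b t) \<partial>lborel) = ennreal (ln (1 + q / b))" if "b > 0" for b
    unfolding K_def by (rule nn_integral_frullani[OF q that])
  have ln0: "ln (1 + q / b) \<ge> 0" if "b > 0" for b
    using q that by simp
  have "(\<integral>\<^sup>+t. ennreal ((1 - exp (- q * t)) * exp (- d * t) * theta (pi * t / 2) / t * indicator {0<..} t) \<partial>lborel)
    = (\<integral>\<^sup>+t. ennreal (K d t) + (\<Sum>k. 2 * ennreal (K (pole k + d) t)) \<partial>lborel)"
  proof (intro nn_integral_cong)
    fix t :: real
    show "ennreal ((1 - exp (- q * t)) * exp (- d * t) * theta (pi * t / 2) / t * indicator {0<..} t)
       = ennreal (K d t) + (\<Sum>k. 2 * ennreal (K (pole k + d) t))"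
    proof (cases "t > 0")
      case True
      have e: "exp (- pi * (pi * t / 2) * (real (Suc k))\<^sup>2) = exp (- pole k * t)" for k
        by (simp add: pole_def power2_eq_square algebra_simps)
      have s: "summable (\<lambda>k. exp (- pole k * t))"
        using summable_theta[of "pi * t / 2"] True unfolding e by simp
      have K2: "2 * K (pole k + d) t = 2 * K d t * exp (- pole k * t)" for k
        by (simp add: K_def algebra_simps exp_add[symmetric] flip: exp_diff)
      have "summable (\<lambda>k. 2 * K (pole k + d) t)" unfolding K2 by (intro summable_mult s)
      then have "(\<Sum>k. 2 * ennreal (K (pole k + d) t)) = ennreal (\<Sum>k. 2 * K (pole k + d) t)"
        using K0 by (subst suminf_ennreal2[symmetric]) (auto simp: ennreal_mult)
      also have "(\<Sum>k. 2 * K (pole k + d) t) = 2 * K d t * (\<Sum>k. exp (- pole k * t))"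
        unfolding K2 by (rule suminf_mult[OF s])
      finally have "ennreal (K d t) + (\<Sum>k. 2 * ennreal (K (pole k + d) t)) = ennreal (K d t + 2 * K d t * (\<Sum>k. exp (- pole k * t)))"
        using K0 s by (simp add: ennreal_plus suminf_nonneg)
      also have "K d t + 2 * K d t * (\<Sum>k. exp (- pole k * t)) = K d t * theta (pi * t / 2)"
        unfolding theta_def e by (simp add: algebra_simps)
      finally show ?thesis using True by (simp add: K_def)
    qed (simp add: K_def)
  qed
  also have "\<dots> = ennreal (ln (1 + q / d)) + (\<Sum>k. 2 * ennreal (ln (1 + q / (pole k + d))))"
    using d pole_pos by (subst nn_integral_add, simp, simp, subst nn_integral_suminf)
       (simp_all add: nn_integral_cmult KI add_pos_pos)
  also have "(\<Sum>k. 2 * ennreal (ln (1 + q / (pole k + d)))) = ennreal (\<Sum>k. 2 * ln (1 + q / (pole k + d)))"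
    using ln0[OF add_pos_pos[OF pole_pos d]] summable_mult[OF summable_ln_pole[OF q d], of 2]
    by (subst suminf_ennreal2[symmetric]) (auto simp: ennreal_mult)
  also have "(\<Sum>k. 2 * ln (1 + q / (pole k + d))) = 2 * (\<Sum>k. ln (1 + q / (pole k + d)))"
    by (intro suminf_mult summable_ln_pole q d)
  also have "ennreal (ln (1 + q / d)) + ennreal (2 * (\<Sum>k. ln (1 + q / (pole k + d)))) =
     ennreal (ln (1 + q / d) + 2 * (\<Sum>k. ln (1 + q / (pole k + d))))"
    using ln0[OF add_pos_pos[OF pole_pos d]] ln0[OF d] summable_ln_pole[OF q d]
    by (intro ennreal_plus[symmetric]) (auto intro!: suminf_nonneg)
  finally show ?thesis .
qed

text \<open>The integrand with theta in place of its truncation is a majorant by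
  \<open>theta_trunc_bounds\<close> and integrable by \<open>levy_integral\<close>. The minus sign
  comes from exp(-q t) - 1 \<le> 0.\<close>

lemma levy_trunc_tendsto:
  assumes q: "q \<ge> 0" and d: "d > 0"
  shows "(\<lambda>M. LBINT t:{0<..}. (exp (- q * t) - 1) * (exp (- d * t) * theta_trunc M (pi * t / 2) / t))
     \<longlonglongrightarrow> - (ln (1 + q / d) + 2 * (\<Sum>k. ln (1 + q / (pole k + d))))"
proof -
  define h where "h = (\<lambda>\<theta> t. (exp (- q * t) - 1) * (exp (- d * t) * \<theta> (pi * t / 2) / t) :: real)"
  define w where "w = (\<lambda>t. (1 - exp (- q * t)) * exp (- d * t) * theta (pi * t / 2) / t * indicator {0<..} t :: real)"
  have th0: "theta s \<ge> 0" if "s > 0" for s using theta_trunc_bounds[OF that, of 0] by simp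
  have w0: "w t \<ge> 0" for t using q th0[of "pi * t / 2"] by (auto simp: w_def indicator_def)
  have [measurable]: "w \<in> borel_measurable borel" unfolding w_def by measurable
  have nn: "0 \<le> ln (1 + q / d) + 2 * (\<Sum>k. ln (1 + q / (pole k + d)))"
    using q d divide_nonneg_pos[OF q add_pos_pos[OF pole_pos d]]
    by (intro add_nonneg_nonneg mult_nonneg_nonneg suminf_nonneg summable_ln_pole ln_ge_zero) auto
  have w: "has_bochner_integral lborel w (ln (1 + q / d) + 2 * (\<Sum>k. ln (1 + q / (pole k + d))))"
    using levy_integral[OF q d] w0 nn by (intro has_bochner_integral_nn_integral) (auto simp: w_def)
  have "(\<lambda>M. LINT t|lborel. indicator {0<..} t *\<^sub>R h (theta_trunc M) t) \<longlonglongrightarrow> (LINT t|lborel. - w t)"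
  proof (rule integral_dominated_convergence[where w = w])
    show "AE t in lborel. (\<lambda>M. indicator {0<..} t *\<^sub>R h (theta_trunc M) t) \<longlonglongrightarrow> - w t"
    proof (intro AE_I2)
      fix t :: real
      show "(\<lambda>M. indicator {0<..} t *\<^sub>R h (theta_trunc M) t) \<longlonglongrightarrow> - w t"
      proof (cases "t > 0")
        case True
        have "(\<lambda>M. h (theta_trunc M) t) \<longlonglongrightarrow> h theta t"
          unfolding h_def using True by (intro tendsto_intros theta_trunc_tendsto) auto
        moreover have "h theta t = - w t" using True by (simp add: h_def w_def algebra_simps diff_divide_distrib)
        ultimately show ?thesis using True by simp
      qed (simp add: w_def)
    qed
    show "AE t in lborel. norm (indicator {0<..} t *\<^sub>R h (theta_trunc M) t) \<le> w t" for M
    proof (intro AE_I2)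
      fix t :: real
      show "norm (indicator {0<..} t *\<^sub>R h (theta_trunc M) t) \<le> w t"
      proof (cases "t > 0")
        case True
        have "\<bar>exp (- q * t) - 1\<bar> = 1 - exp (- q * t)" using True q by simp
        then have "norm (h (theta_trunc M) t) = (1 - exp (- q * t)) * (exp (- d * t) * theta_trunc M (pi * t / 2) / t)"
          using True theta_trunc_bounds(1)[of "pi * t / 2" M] by (simp add: h_def abs_mult)
        also have "\<dots> \<le> (1 - exp (- q * t)) * (exp (- d * t) * theta (pi * t / 2) / t)"
          using True q theta_trunc_bounds(2)[of "pi * t / 2" M]
          by (intro mult_left_mono divide_right_mono) auto
        finally show ?thesis using True by (simp add: w_def)
      qed (simp add: w_def)
    qed
  qed (use w in \<open>auto simp: has_bochner_integral_iff h_def\<close>)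
  then show ?thesis
    using w by (simp add: set_lebesgue_integral_def h_def has_bochner_integral_iff)
qed

text \<open>The value is left as a limit of finite products because \<open>T_sum_laplace\<close> and
  \<open>T_density_laplace\<close> exhibit limits of the very same sequence; equality of the
  transforms then needs no evaluation.\<close>

lemma T_law_laplace:
  fixes n :: nat
  assumes d: "d > 0" and T: "is_T_law d \<mu>"
  shows "(\<lambda>N. ennreal (d / (d + real n) * (\<Prod>k<N. 1 / (1 + real n / (pole k + d))\<^sup>2)))
     \<longlonglongrightarrow> (\<integral>\<^sup>+x. ennreal (exp (- real n * x)) \<partial>\<mu>)"
proof (cases "n = 0")
  case True
  interpret real_distribution \<mu> using T by (simp add: is_T_law_def)
  show ?thesis using d True emeasure_space_1 by simp
next
  case False
  obtain \<beta> where \<beta>: "\<And>M. M \<ge> 1 \<Longrightarrow> is_barnes_beta_law M d (\<beta> M)"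
    and wc: "weak_conv_m \<beta> (distr \<mu> borel (\<lambda>x. exp (- x)))"
    using T by (auto simp: is_T_law_def)
  interpret real_distribution \<mu> using T by (simp add: is_T_law_def)
  have pos: "AE x in \<mu>. x > 0"
    using T AE_in_set_eq_1[of "{0<..}"] by (simp add: is_T_law_def)
  \<comment> \<open>Weak convergence needs a bounded continuous test function on the whole line. The
    clamped power is one, and it agrees with x^n on (0,1], which carries the laws \<beta> M for M
    \<ge> 1 and their limit.\<close>
  define f where "f = (\<lambda>x::real. min 1 (max 0 x) ^ n)"
  define J where "J = (\<lambda>M. LBINT t:{0<..}. (exp (- real n * t) - 1) * (exp (- d * t) * theta_trunc M (pi * t / 2) / t))"
  have beta_int: "(LINT x|\<beta> M. f x) = exp (J M)" if M: "M \<ge> 1" for M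
  proof -
    interpret b: real_distribution "\<beta> M" using \<beta>[OF M] by (simp add: is_barnes_beta_law_def)
    have "AE x in \<beta> M. x \<in> {0<..1}"
      using \<beta>[OF M] b.AE_in_set_eq_1[of "{0<..1}"] by (simp add: is_barnes_beta_law_def)
    then have "(LINT x|\<beta> M. complex_of_real x powr of_nat n) = (LINT x|\<beta> M. complex_of_real (f x))"
    proof (intro integral_cong_AE)
      assume "AE x in \<beta> M. x \<in> {0<..1}"
      then show "AE x in \<beta> M. complex_of_real x powr of_nat n = complex_of_real (f x)"
        by eventually_elim (simp add: f_def powr_nat)
    qed (auto simp: f_def)
    also have "\<dots> = of_real (LINT x|\<beta> M. f x)" by simp
    finally have "complex_of_real (LINT x|\<beta> M. f x) = mellin (\<beta> M) (of_nat n)"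
      by (simp add: mellin_def)
    also have "\<dots> = exp (LBINT t:{0<..}. (exp (- of_nat n * of_real t) - 1) *
               of_real (exp (- d * t) * theta_trunc M (pi * t / 2) / t))"
      using \<beta>[OF M] d by (simp add: is_barnes_beta_law_def)
    also have "(LBINT t:{0<..}. (exp (- of_nat n * of_real t) - 1) *
               of_real (exp (- d * t) * theta_trunc M (pi * t / 2) / t)) = complex_of_real (J M)"
    proof -
      have "exp (- of_nat n * of_real t) - 1 = complex_of_real (exp (- real n * t) - 1)" for t
        by (simp flip: exp_of_real)
      then have "(LBINT t:{0<..}. (exp (- of_nat n * of_real t) - 1) *
               of_real (exp (- d * t) * theta_trunc M (pi * t / 2) / t)) =
          (LBINT t:{0<..}. complex_of_real ((exp (- real n * t) - 1) * (exp (- d * t) * theta_trunc M (pi * t / 2) / t)))"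
        by (simp only: of_real_mult)
      then show ?thesis unfolding J_def by (simp only: set_integral_complex_of_real)
    qed
    finally show ?thesis by (simp only: exp_of_real of_real_eq_iff)
  qed
  \<comment> \<open>The shift skips \<beta> 0, about which nothing is known.\<close>
  have "(\<lambda>M. LINT x|\<beta> (Suc M). f x) \<longlonglongrightarrow> (LINT x|distr \<mu> borel (\<lambda>x. exp (- x)). f x)"
  proof (rule weak_conv_imp_integral_bdd_continuous_conv)
    show "real_distribution (\<beta> (Suc M))" for M using \<beta>[of "Suc M"] by (simp add: is_barnes_beta_law_def)
    show "real_distribution (distr \<mu> borel (\<lambda>x. exp (- x)))"
      by (auto intro!: prob_space_distr simp: real_distribution_def real_distribution_axioms_def)
    show "weak_conv_m (\<lambda>M. \<beta> (Suc M)) (distr \<mu> borel (\<lambda>x. exp (- x)))"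
      using wc by (auto simp: weak_conv_m_def weak_conv_def intro: LIMSEQ_Suc)
    show "isCont f x" for x unfolding f_def by (intro continuous_intros)
    show "norm (f x) \<le> 1" for x unfolding f_def by (auto simp: power_abs power_le_one)
  qed
  also have "(LINT x|distr \<mu> borel (\<lambda>x. exp (- x)). f x) = (LINT x|\<mu>. exp (- real n * x))"
  proof -
    have "(LINT x|distr \<mu> borel (\<lambda>x. exp (- x)). f x) = (LINT x|\<mu>. f (exp (- x)))"
      by (intro integral_distr) (auto simp: f_def)
    also have "\<dots> = (LINT x|\<mu>. exp (- real n * x))"
      using pos by (intro integral_cong_AE)
         (auto simp: f_def max_def min_def mult.commute simp flip: exp_of_nat_mult elim!: eventually_mono)
    finally show ?thesis .
  qed
  finally have "(\<lambda>M. exp (J (Suc M))) \<longlonglongrightarrow> (LINT x|\<mu>. exp (- real n * x))"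
    using beta_int by simp
  moreover have "(\<lambda>M. exp (J (Suc M))) \<longlonglongrightarrow> exp (- (ln (1 + real n / d) + 2 * (\<Sum>k. ln (1 + real n / (pole k + d)))))"
    unfolding J_def using d by (intro tendsto_exp LIMSEQ_Suc levy_trunc_tendsto) auto
  ultimately have "(LINT x|\<mu>. exp (- real n * x)) = exp (- (ln (1 + real n / d) + 2 * (\<Sum>k. ln (1 + real n / (pole k + d)))))"
    using LIMSEQ_unique by blast
  moreover have "(\<lambda>N. d / (d + real n) * (\<Prod>k<N. 1 / (1 + real n / (pole k + d))\<^sup>2)) \<longlonglongrightarrow>
     exp (- (ln (1 + real n / d) + 2 * (\<Sum>k. ln (1 + real n / (pole k + d)))))"
  proof -
    have "(\<lambda>N. exp (- (ln (1 + real n / d) + 2 * (\<Sum>k<N. ln (1 + real n / (pole k + d)))))) \<longlonglongrightarrow>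
      exp (- (ln (1 + real n / d) + 2 * (\<Sum>k. ln (1 + real n / (pole k + d)))))"
      using d by (intro tendsto_intros summable_LIMSEQ summable_ln_pole) auto
    moreover have "exp (- (ln (1 + real n / d) + 2 * (\<Sum>k<N. ln (1 + real n / (pole k + d))))) =
        d / (d + real n) * (\<Prod>k<N. 1 / (1 + real n / (pole k + d))\<^sup>2)" for N
    proof -
      have p: "1 + real n / (pole k + d) > 0" for k
        using pole_pos[of k] d by (intro add_pos_nonneg divide_nonneg_pos) auto
      have "exp (- (ln (1 + real n / d) + 2 * (\<Sum>k<N. ln (1 + real n / (pole k + d))))) =
         exp (- ln (1 + real n / d)) * (\<Prod>k<N. exp (- (2 * ln (1 + real n / (pole k + d)))))"
      proof -
        have "- (ln (1 + real n / d) + 2 * (\<Sum>k<N. ln (1 + real n / (pole k + d)))) =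
            - ln (1 + real n / d) + (\<Sum>k<N. - (2 * ln (1 + real n / (pole k + d))))"
          by (simp add: sum_negf sum_distrib_left)
        then show ?thesis by (simp only: exp_add exp_sum[OF finite_lessThan])
      qed
      also have "exp (- ln (1 + real n / d)) = d / (d + real n)"
        using d by (simp add: exp_minus add_pos_nonneg field_simps)
      also have "(\<Prod>k<N. exp (- (2 * ln (1 + real n / (pole k + d))))) = (\<Prod>k<N. 1 / (1 + real n / (pole k + d))\<^sup>2)"
        using p by (intro prod.cong refl) (simp add: exp_minus exp_double divide_inverse)
      finally show ?thesis .
    qed
    ultimately show ?thesis by simp
  qed
  ultimately have "(\<lambda>N. ennreal (d / (d + real n) * (\<Prod>k<N. 1 / (1 + real n / (pole k + d))\<^sup>2))) \<longlonglongrightarrow> ennreal (LINT x|\<mu>. exp (- real n * x))"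
    by (intro tendsto_ennrealI) simp
  moreover have "ennreal (LINT x|\<mu>. exp (- real n * x)) = (\<integral>\<^sup>+x. ennreal (exp (- real n * x)) \<partial>\<mu>)"
  proof (rule nn_integral_eq_integral[symmetric])
    show "integrable \<mu> (\<lambda>x. exp (- real n * x))"
      using pos by (intro integrable_const_bound[where B = 1]) (auto elim!: eventually_mono)
  qed auto
  ultimately show ?thesis by simp
qed

section \<open>The random series representation\<close>

lemma nn_integral_exp_tail:
  fixes b s :: real
  assumes b: "b > 0"
  shows "(\<integral>\<^sup>+x. ennreal (exp (- b * x) * indicator {s<..} x) \<partial>lborel) = ennreal (exp (- b * s) / b)"
proof -
  have "(\<integral>\<^sup>+x. ennreal (exp (- b * x) * indicator {s<..} x) \<partial>lborel) = (\<integral>\<^sup>+x. ennreal (exp (- b * x)) * indicator {s..} x \<partial>lborel)"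
    using AE_lborel_singleton[of s] by (intro nn_integral_cong_AE) (auto simp: indicator_def elim!: eventually_mono)
  also have "\<dots> = ennreal (0 - - exp (- b * s) / b)"
  proof (rule nn_integral_FTC_atLeast)
    show "((\<lambda>x. - exp (- b * x) / b) \<longlongrightarrow> 0) at_top" using b by real_asymp
  qed (use b in \<open>auto intro!: derivative_eq_intros\<close>)
  finally show ?thesis by simp
qed

locale gamma_beta_variables = gamma_variables P G for P :: "'a measure" and G +
  fixes B :: "'a \<Rightarrow> real" and d :: real
  assumes d: "d > 0"
    and B_distributed: "distributed P lborel B (\<lambda>x. ennreal (d * x powr (d - 1) * indicator {0<..<1} x))"
    and GB_indep: "indep_vars (\<lambda>_. borel) (\<lambda>n. if n = 0 then B else G n) UNIV"
begin

lemma B_measurable[measurable]: "B \<in> borel_measurable P"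
  using distributed_measurable[OF B_distributed] by simp

lemma B_range: "AE \<omega> in P. 0 < B \<omega> \<and> B \<omega> < 1"
proof -
  have "AE x in distr P lborel B. 0 < x \<and> x < 1"
    unfolding distributed_distr_eq_density[OF B_distributed]
    by (subst AE_density) (auto simp: indicator_def)
  then show ?thesis by (subst (asm) AE_distr_iff) auto
qed

lemma B_moment:
  assumes l: "l \<ge> 0"
  shows "(\<integral>\<^sup>+\<omega>. ennreal (B \<omega> powr l) \<partial>P) = ennreal (d / (d + l))"
proof -
  have "(\<integral>\<^sup>+\<omega>. ennreal (B \<omega> powr l) \<partial>P) = (\<integral>\<^sup>+x. ennreal (d * x powr (d - 1) * indicator {0<..<1} x) * ennreal (x powr l) \<partial>lborel)"
    using distributed_nn_integral[OF B_distributed, of "\<lambda>x. ennreal (x powr l)"] by simp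
  also have "\<dots> = (\<integral>\<^sup>+x. ennreal (d / (d + l)) * (ennreal ((d + l) * x powr (d + l - 1)) * indicator {0<..1} x) \<partial>lborel)"
  proof (intro nn_integral_cong_AE)
    show "AE x in lborel. ennreal (d * x powr (d - 1) * indicator {0<..<1} x) * ennreal (x powr l) =
        ennreal (d / (d + l)) * (ennreal ((d + l) * x powr (d + l - 1)) * indicator {0<..1} x)"
      using AE_lborel_singleton[of 1]
    proof eventually_elim
      case (elim x)
      show ?case
      proof (cases "0 < x \<and> x < 1")
        case True
        have pw: "x powr (d - 1) * x powr l = x powr (d + l - 1)"
          by (simp add: algebra_simps flip: powr_add)
        have "ennreal (d * x powr (d - 1)) * ennreal (x powr l) = ennreal (d * x powr (d + l - 1))"
          using d by (simp add: ennreal_mult[symmetric] mult.assoc pw)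
        moreover have "ennreal (d / (d + l)) * ennreal ((d + l) * x powr (d + l - 1)) = ennreal (d * x powr (d + l - 1))"
          using d l by (subst ennreal_mult[symmetric]) auto
        ultimately show ?thesis using True by simp
      qed (use elim in auto)
    qed
  qed
  also have "\<dots> = ennreal (d / (d + l))"
    using d l by (subst nn_integral_cmult) (simp_all add: nn_integral_powr_from_0)
  finally show ?thesis .
qed

definition T_sum :: "'a \<Rightarrow> real" where
  "T_sum \<omega> = (\<Sum>n. G (Suc n) \<omega> / (pole n + d)) + - ln (B \<omega>)"

lemma T_sum_measurable[measurable]: "T_sum \<in> borel_measurable P"
  unfolding T_sum_def[abs_def] by measurable

lemma pole_shift: "pole n + d > 0" "summable (\<lambda>n. 1 / (pole n + d))"
proof -
  show pos: "pole n + d > 0" for n using pole_pos[of n] d by simp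
  show "summable (\<lambda>n. 1 / (pole n + d))"
  proof (rule summable_comparison_test'[OF summable_inverse_pole, of 0])
    fix n show "norm (1 / (pole n + d)) \<le> 1 / pole n"
      using pos[of n] pole_pos[of n] d by (simp add: frac_le)
  qed
qed

text \<open>Since exp(-l * (-ln B)) = B powr l, the beta variable contributes its moment d/(d+l),
  and by independence each gamma variable contributes one factor of the product.\<close>

lemma T_sum_laplace:
  assumes l: "l \<ge> 0"
  shows "(\<lambda>N. ennreal (d / (d + l) * (\<Prod>k<N. 1 / (1 + l / (pole k + d))\<^sup>2)))
     \<longlonglongrightarrow> (\<integral>\<^sup>+\<omega>. ennreal (exp (- l * T_sum \<omega>)) \<partial>P)"
proof -
  define c where "c n = pole n + d" for n
  have c: "c n > 0" "summable (\<lambda>n. 1 / c n)" for n unfolding c_def by (rule pole_shift)+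
  have "(\<integral>\<^sup>+\<omega>. ennreal (exp (- l * T_sum \<omega>)) \<partial>P) = (\<integral>\<^sup>+\<omega>. ennreal (B \<omega> powr l * exp (- l * (\<Sum>n. G (Suc n) \<omega> / c n))) \<partial>P)"
    using B_range by (intro nn_integral_cong_AE)
      (auto simp: T_sum_def c_def powr_def algebra_simps simp flip: exp_add elim!: eventually_mono)
  moreover have "(\<integral>\<^sup>+\<omega>. ennreal (B \<omega> powr l) * (\<Prod>n<N. ennreal (exp (- (l / c n) * G (Suc n) \<omega>))) \<partial>P)
     = ennreal (d / (d + l) * (\<Prod>k<N. 1 / (1 + l / c k)\<^sup>2))" for N
  proof -
    \<comment> \<open>Index 0 belongs to \<open>B\<close> and index n > 0 to \<open>G n\<close>,
      whose rate is \<open>c (n - 1)\<close>.\<close>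
    define f where "f = (\<lambda>n x. if n = 0 then ennreal (x powr l) else ennreal (exp (- (l / c (n - 1)) * x)))"
    define X where "X = (\<lambda>n. if n = 0 then B else G n)"
    have [measurable]: "f n \<in> borel_measurable borel" for n by (cases n) (simp_all add: f_def)
    have "indep_vars (\<lambda>_. borel) (\<lambda>n \<omega>. f n (X n \<omega>)) {..<Suc N}"
      unfolding X_def by (rule indep_vars_compose2[OF indep_vars_subset[OF GB_indep]]) auto
    then have "(\<integral>\<^sup>+\<omega>. (\<Prod>n<Suc N. f n (X n \<omega>)) \<partial>P) = (\<Prod>n<Suc N. \<integral>\<^sup>+\<omega>. f n (X n \<omega>) \<partial>P)"
      by (intro indep_vars_nn_integral) auto
    then have "(\<integral>\<^sup>+\<omega>. ennreal (B \<omega> powr l) * (\<Prod>n<N. ennreal (exp (- (l / c n) * G (Suc n) \<omega>))) \<partial>P) =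
       (\<integral>\<^sup>+\<omega>. ennreal (B \<omega> powr l) \<partial>P) * (\<Prod>n<N. \<integral>\<^sup>+\<omega>. ennreal (exp (- (l / c n) * G (Suc n) \<omega>)) \<partial>P)"
      by (simp only: prod.lessThan_Suc_shift) (simp add: f_def X_def)
    also have "\<dots> = ennreal (d / (d + l)) * (\<Prod>n<N. ennreal (1 / (1 + l / c n)\<^sup>2))"
    proof -
      have "l / c n > -1" for n using divide_nonneg_pos[OF l c(1)[of n]] by simp
      then show ?thesis by (simp only: B_moment[OF l] G_exp)
    qed
    also have "\<dots> = ennreal (d / (d + l) * (\<Prod>k<N. 1 / (1 + l / c k)\<^sup>2))"
      using d l by (simp add: prod_ennreal ennreal_mult[symmetric] prod_nonneg)
    finally show ?thesis .
  qed
  moreover have "AE \<omega> in P. 0 \<le> B \<omega> powr l \<and> B \<omega> powr l \<le> 1"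
    using B_range by eventually_elim (use l in \<open>auto intro!: powr_le1\<close>)
  ultimately show ?thesis
    using laplace_partial_tendsto[OF c l, of "\<lambda>\<omega>. B \<omega> powr l"] by (simp add: c_def)
qed

lemma T_sum_nonneg: "AE \<omega> in P. 0 \<le> T_sum \<omega>"
  using B_range G_pos G_series_summable[OF pole_shift]
proof eventually_elim
  case (elim \<omega>)
  then have "(\<Sum>n. G (Suc n) \<omega> / (pole n + d)) \<ge> 0"
    using pole_shift(1) by (intro suminf_nonneg) (auto intro!: divide_nonneg_pos intro: less_imp_le)
  moreover have "ln (B \<omega>) \<le> 0" using elim by simp
  ultimately show ?case by (simp add: T_sum_def)
qed

lemma T_law_eq_distr:
  assumes T: "is_T_law d \<mu>"
  shows "\<mu> = distr P borel T_sum"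
proof (rule prob_space_eqI_laplace)
  interpret T: real_distribution \<mu> using T by (simp add: is_T_law_def)
  show "prob_space \<mu>" "sets \<mu> = sets borel" by (unfold_locales, simp)
  show "prob_space (distr P borel T_sum)" by (rule prob_space_distr) simp
  show "AE x in \<mu>. 0 \<le> x"
  proof -
    have "AE x in \<mu>. x \<in> {0<..}" using T T.AE_in_set_eq_1[of "{0<..}"] by (simp add: is_T_law_def)
    then show ?thesis by eventually_elim simp
  qed
  show "AE x in distr P borel T_sum. 0 \<le> x"
    using T_sum_nonneg by (subst AE_distr_iff) auto
  fix n :: nat
  show "(\<integral>\<^sup>+x. ennreal (exp (- real n * x)) \<partial>\<mu>) = (\<integral>\<^sup>+x. ennreal (exp (- real n * x)) \<partial>distr P borel T_sum)"
    using LIMSEQ_unique[OF T_law_laplace[OF d T] T_sum_laplace[of "real n"]] by (simp add: nn_integral_distr)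
qed auto

end

section \<open>The density as a convolution with the tilted law of \<open>S2\<close>\<close>

context gamma_variables
begin

text \<open>The exponential density of rate d convolved with the law of \<open>S2\<close> tilted by
  exp(-d y): in d exp(-d (x-y)) exp(-d y) the variable y cancels, and integration over y < x leaves
  the distribution function.\<close>

definition T_density :: "real \<Rightarrow> real \<Rightarrow> real" where
  "T_density d x = d * exp (- d * x) * (sinh (sqrt (2 * d)) / sqrt (2 * d))\<^sup>2 *
     measure P {\<omega> \<in> space P. S2 G \<omega> < x} * indicator {0<..} x"

lemma S2_cdf_measurable[measurable]: "(\<lambda>x. measure P {\<omega> \<in> space P. S2 G \<omega> < x}) \<in> borel_measurable borel"
  by measurable

lemma T_density_measurable[measurable]: "T_density d \<in> borel_measurable borel"
  unfolding T_density_def[abs_def] by measurable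

text \<open>By \<open>laplace_S2\<close> this is the reciprocal of E[exp(-d S2)] for d > 0, the
  normalising constant of the tilt.\<close>

definition sinh_factor :: "real \<Rightarrow> real" where
  "sinh_factor d = (sinh (sqrt (2 * d)) / sqrt (2 * d))\<^sup>2"

lemma sinh_factor_pos: "d > 0 \<Longrightarrow> sinh_factor d > 0"
  by (simp add: sinh_factor_def)

lemma T_density_nonneg: "d > 0 \<Longrightarrow> T_density d x \<ge> 0"
  unfolding T_density_def by (auto intro!: mult_nonneg_nonneg)

text \<open>Turning the distribution function into an integral over \<open>P\<close> prepares the
  exchange of integrals. On the right, x \<le> 0 contributes nothing because \<open>S2\<close> is
  almost surely positive.\<close>

lemma T_density_eq:
  assumes d: "d > 0"
  shows "ennreal (T_density d x) = (\<integral>\<^sup>+\<omega>. ennreal (d * sinh_factor d * exp (- d * x) * indicator {S2 G \<omega><..} x) \<partial>P)"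
proof (cases "x > 0")
  case True
  have "(\<integral>\<^sup>+\<omega>. ennreal (d * sinh_factor d * exp (- d * x) * indicator {S2 G \<omega><..} x) \<partial>P) =
     (\<integral>\<^sup>+\<omega>. ennreal (d * sinh_factor d * exp (- d * x)) * indicator {\<omega> \<in> space P. S2 G \<omega> < x} \<omega> \<partial>P)"
    by (intro nn_integral_cong) (auto simp: indicator_def)
  also have "\<dots> = ennreal (d * sinh_factor d * exp (- d * x)) * emeasure P {\<omega> \<in> space P. S2 G \<omega> < x}"
    by (subst nn_integral_cmult_indicator) auto
  also have "\<dots> = ennreal (T_density d x)"
    using d True sinh_factor_pos[OF d]
    by (simp add: emeasure_eq_measure T_density_def sinh_factor_def ennreal_mult[symmetric] mult_ac)
  finally show ?thesis ..
next
  case False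
  have "(\<integral>\<^sup>+\<omega>. ennreal (d * sinh_factor d * exp (- d * x) * indicator {S2 G \<omega><..} x) \<partial>P) = (\<integral>\<^sup>+\<omega>. 0 \<partial>P)"
    using S2_pos False by (intro nn_integral_cong_AE) (auto elim!: eventually_mono)
  then show ?thesis using False by (simp add: T_density_def)
qed

text \<open>Integrating in x first leaves exp(-(d+q) S2)/(d+q), so the transform is d/(d+q) times
  the quotient of the transforms of \<open>S2\<close> at d+q and at d.\<close>

lemma T_density_laplace:
  assumes d: "d > 0" and q: "q \<ge> 0"
  shows "(\<lambda>N. ennreal (d / (d + q) * (\<Prod>k<N. 1 / (1 + q / (pole k + d))\<^sup>2)))
     \<longlonglongrightarrow> (\<integral>\<^sup>+x. ennreal (T_density d x) * ennreal (exp (- q * x)) \<partial>lborel)"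
proof -
  have dq: "d + q > 0" using d q by simp
  let ?u = "\<lambda>x. sqrt (2 * x)"
  have "(\<integral>\<^sup>+x. ennreal (T_density d x) * ennreal (exp (- q * x)) \<partial>lborel) =
     (\<integral>\<^sup>+x. (\<integral>\<^sup>+\<omega>. ennreal (d * sinh_factor d * (exp (- (d + q) * x) * indicator {S2 G \<omega><..} x)) \<partial>P) \<partial>lborel)"
    unfolding T_density_eq[OF d]
    by (intro nn_integral_cong, subst nn_integral_multc[symmetric])
       (auto intro!: nn_integral_cong simp: ennreal_mult'[symmetric] indicator_def algebra_simps simp flip: exp_add)
  also have "\<dots> = (\<integral>\<^sup>+\<omega>. (\<integral>\<^sup>+x. ennreal (d * sinh_factor d * (exp (- (d + q) * x) * indicator {S2 G \<omega><..} x)) \<partial>lborel) \<partial>P)"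
  proof -
    interpret pair_sigma_finite lborel P by unfold_locales
    show ?thesis unfolding indicator_def greaterThan_iff by (rule Fubini'[symmetric]) measurable
  qed
  also have "\<dots> = (\<integral>\<^sup>+\<omega>. ennreal (d * sinh_factor d / (d + q)) * ennreal (exp (- (d + q) * S2 G \<omega>)) \<partial>P)"
  proof (intro nn_integral_cong)
    fix \<omega>
    have "(\<integral>\<^sup>+x. ennreal (d * sinh_factor d * (exp (- (d + q) * x) * indicator {S2 G \<omega><..} x)) \<partial>lborel) =
       ennreal (d * sinh_factor d) * (\<integral>\<^sup>+x. ennreal (exp (- (d + q) * x) * indicator {S2 G \<omega><..} x) \<partial>lborel)"
      using d sinh_factor_pos[OF d] by (subst nn_integral_cmult[symmetric]) (auto simp: ennreal_mult)
    also have "\<dots> = ennreal (d * sinh_factor d / (d + q)) * ennreal (exp (- (d + q) * S2 G \<omega>))"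
      unfolding nn_integral_exp_tail[OF dq] using d dq sinh_factor_pos[OF d] by (simp add: ennreal_mult[symmetric])
    finally show "(\<integral>\<^sup>+x. ennreal (d * sinh_factor d * (exp (- (d + q) * x) * indicator {S2 G \<omega><..} x)) \<partial>lborel) =
        ennreal (d * sinh_factor d / (d + q)) * ennreal (exp (- (d + q) * S2 G \<omega>))" .
  qed
  also have "\<dots> = ennreal (d * sinh_factor d / (d + q)) * ennreal ((?u (d + q) / sinh (?u (d + q)))\<^sup>2)"
    by (subst nn_integral_cmult) (simp_all only: laplace_S2[OF dq], measurable)
  also have "\<dots> = ennreal (d / (d + q) * ((sinh (?u d) / ?u d) / (sinh (?u (d + q)) / ?u (d + q)))\<^sup>2)"
  proof -
    have alg: "d / (d + q) * ((a / b) / (c / e))\<^sup>2 = d * (a / b)\<^sup>2 / (d + q) * (e / c)\<^sup>2" for a b c e :: real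
      by (simp add: power_divide power_mult_distrib mult_ac)
    show ?thesis
      unfolding sinh_factor_def alg using d dq by (subst ennreal_mult) auto
  qed
  finally have eq: "(\<integral>\<^sup>+x. ennreal (T_density d x) * ennreal (exp (- q * x)) \<partial>lborel) =
     ennreal (d / (d + q) * ((sinh (?u d) / ?u d) / (sinh (?u (d + q)) / ?u (d + q)))\<^sup>2)" .
  have "(\<lambda>N. d / (d + q) * ((\<Prod>k<N. 1 + d / pole k) / (\<Prod>k<N. 1 + (d + q) / pole k))\<^sup>2) \<longlonglongrightarrow>
      d / (d + q) * ((sinh (?u d) / ?u d) / (sinh (?u (d + q)) / ?u (d + q)))\<^sup>2"
    using d dq by (intro tendsto_intros sinh_product) auto
  moreover have "((\<Prod>k<N. 1 + d / pole k) / (\<Prod>k<N. 1 + (d + q) / pole k))\<^sup>2 = (\<Prod>k<N. 1 / (1 + q / (pole k + d))\<^sup>2)" for N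
  proof -
    \<comment> \<open>This is where the tilt becomes a shift of the poles: the quotient of the
      factors at d and d+q is the factor at q for the pole p + d.\<close>
    have "(1 + d / pole k) / (1 + (d + q) / pole k) = 1 / (1 + q / (pole k + d))" for k
    proof -
      have p: "pole k > 0" "pole k + d > 0" "pole k + d + q > 0" using pole_pos[of k] d q by auto
      have "1 + d / pole k = (pole k + d) / pole k" "1 + (d + q) / pole k = (pole k + d + q) / pole k"
        "1 + q / (pole k + d) = (pole k + d + q) / (pole k + d)"
        using p by (simp_all add: add_divide_distrib)
      then show ?thesis using p by simp
    qed
    then have "(\<Prod>k<N. (1 + d / pole k) / (1 + (d + q) / pole k)) = (\<Prod>k<N. 1 / (1 + q / (pole k + d)))"
      by simp
    then show ?thesis by (simp add: prod_dividef[symmetric] prod_power_distrib power_divide)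
  qed
  ultimately show ?thesis unfolding eq by (intro tendsto_ennrealI) simp
qed

lemma T_law_eq_density:
  assumes d: "d > 0" and T: "is_T_law d \<mu>"
  shows "\<mu> = density lborel (\<lambda>x. ennreal (T_density d x))"
proof (rule prob_space_eqI_laplace)
  interpret T: real_distribution \<mu> using T by (simp add: is_T_law_def)
  show "prob_space \<mu>" "sets \<mu> = sets borel" by (unfold_locales, simp)
  have L: "(\<integral>\<^sup>+x. ennreal (exp (- real n * x)) \<partial>density lborel (\<lambda>x. ennreal (T_density d x))) = (\<integral>\<^sup>+x. ennreal (exp (- real n * x)) \<partial>\<mu>)" for n
    using LIMSEQ_unique[OF T_law_laplace[OF d T] T_density_laplace[OF d, of "real n"]] by (simp add: nn_integral_density)
  \<comment> \<open>The transform at n = 0 is the total mass, so the density integrates to 1 because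
    \<mu> is a probability law.\<close>
  show "prob_space (density lborel (\<lambda>x. ennreal (T_density d x)))"
    using L[of 0] T.emeasure_space_1 by (intro prob_spaceI) simp
  show "AE x in \<mu>. 0 \<le> x"
  proof -
    have "AE x in \<mu>. x \<in> {0<..}" using T T.AE_in_set_eq_1[of "{0<..}"] by (simp add: is_T_law_def)
    then show ?thesis by eventually_elim simp
  qed
  show "AE x in density lborel (\<lambda>x. ennreal (T_density d x)). 0 \<le> x"
    by (subst AE_density) (auto simp: T_density_def indicator_def)
  show "(\<integral>\<^sup>+x. ennreal (exp (- real n * x)) \<partial>\<mu>) = (\<integral>\<^sup>+x. ennreal (exp (- real n * x)) \<partial>density lborel (\<lambda>x. ennreal (T_density d x)))" for n
    using L[of n] ..
qed auto

end

section \<open>Mellin transforms\<close>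

text \<open>Continuity fails across the branch cut of the logarithm, so measurability is read off
  from the formula Ln x = ln |x| + pi i on the negative axis.\<close>

lemma borel_measurable_of_real_powr[measurable]:
  "(\<lambda>x::real. complex_of_real x powr q) \<in> borel_measurable borel"
proof -
  have "(\<lambda>x::real. complex_of_real x powr q) = (\<lambda>x. if x = 0 then 0
      else exp (q * (of_real (ln \<bar>x\<bar>) + (if x < 0 then of_real pi else 0) * \<i>)))"
    by (intro ext) (simp add: powr_def Ln_of_real')
  also have "\<dots> \<in> borel_measurable borel" by measurable
  finally show ?thesis .
qed

lemma norm_of_real_powr: "x > 0 \<Longrightarrow> norm (complex_of_real x powr q) = x powr Re q"
  by (subst norm_powr_real_powr) auto

text \<open>A single integrable bound on all partial sums of norms suits exponential series, where
  \<open>sum_exp_le\<close> supplies it.\<close>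

lemma sums_integral_dominated:
  fixes f :: "nat \<Rightarrow> 'a \<Rightarrow> 'b::{banach, second_countable_topology}"
  assumes [measurable]: "\<And>n. f n \<in> borel_measurable M" "h \<in> borel_measurable M"
    and g: "integrable M g"
    and sums: "AE x in M. (\<lambda>n. f n x) sums h x"
    and le: "AE x in M. \<forall>N. (\<Sum>n<N. norm (f n x)) \<le> g x"
  shows "(\<lambda>n. integral\<^sup>L M (f n)) sums integral\<^sup>L M h"
proof -
  have int: "integrable M (f n)" for n
  proof (rule Bochner_Integration.integrable_bound[OF g])
    show "AE x in M. norm (f n x) \<le> norm (g x)"
      using le
    proof eventually_elim
      case (elim x)
      have "norm (f n x) \<le> (\<Sum>n<Suc n. norm (f n x))" by (simp add: sum_nonneg)
      also have "\<dots> \<le> g x" using elim by blast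
      finally show ?case by simp
    qed
  qed simp
  have "(\<lambda>N. integral\<^sup>L M (\<lambda>x. \<Sum>n<N. f n x)) \<longlonglongrightarrow> integral\<^sup>L M h"
  proof (rule integral_dominated_convergence[OF _ _ g])
    show "AE x in M. (\<lambda>N. \<Sum>n<N. f n x) \<longlonglongrightarrow> h x" using sums by (simp add: sums_def)
    show "AE x in M. norm (\<Sum>n<N. f n x) \<le> g x" for N
      using le
    proof eventually_elim
      case (elim x)
      have "norm (\<Sum>n<N. f n x) \<le> (\<Sum>n<N. norm (f n x))" by (rule norm_sum)
      with elim show ?case by (meson order_trans)
    qed
  qed auto
  then show ?thesis using int by (simp add: sums_def)
qed

lemma sum_exp_le:
  fixes y :: real assumes "y \<ge> 0"
  shows "(\<Sum>n<N. y ^ n / fact n) \<le> exp y"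
proof -
  have "(\<lambda>n. y ^ n / fact n) sums exp y"
    using exp_converges[of y] by (simp add: divide_inverse_commute)
  then show ?thesis
    using sum_le_suminf[of "\<lambda>n. y ^ n / fact n" "{..<N}"] assms
    by (auto simp: sums_iff)
qed

text \<open>Expanding \<open>x powr q = exp (q * ln x)\<close> makes the Mellin transform an everywhere convergent
  power series, since \<open>exp (r * \<bar>ln x\<bar>) \<le> x powr r + x powr - r\<close>.\<close>

lemma entire_moments:
  fixes X :: "'a \<Rightarrow> real"
  assumes [measurable]: "X \<in> borel_measurable M" and pos: "AE x in M. X x > 0"
    and int: "\<And>s::real. integrable M (\<lambda>x. X x powr s)"
  shows "integrable M (\<lambda>x. complex_of_real (X x) powr q)"
    and "(\<lambda>q. LINT x|M. complex_of_real (X x) powr q) holomorphic_on UNIV"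
proof -
  show "integrable M (\<lambda>x. complex_of_real (X x) powr q)"
    by (rule Bochner_Integration.integrable_bound[OF int[of "Re q"]])
       (use pos in \<open>auto elim!: eventually_mono simp: norm_of_real_powr\<close>)
  define a where "a = (\<lambda>n. LINT x|M. complex_of_real (ln (X x) ^ n / fact n))"
  have "(\<lambda>n. a n * (w - 0) ^ n) sums (LINT x|M. complex_of_real (X x) powr w)" for w
  proof -
    have "(\<lambda>n. LINT x|M. complex_of_real (ln (X x) ^ n / fact n) * w ^ n) sums (LINT x|M. complex_of_real (X x) powr w)"
    proof (rule sums_integral_dominated)
      show "integrable M (\<lambda>x. X x powr norm w + X x powr - norm w)"
        by (intro Bochner_Integration.integrable_add int)
      show "AE x in M. (\<lambda>n. complex_of_real (ln (X x) ^ n / fact n) * w ^ n) sums (complex_of_real (X x) powr w)"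
        using pos
      proof eventually_elim
        case (elim x)
        have "(\<lambda>n. (w * of_real (ln (X x))) ^ n /\<^sub>R fact n) sums exp (w * of_real (ln (X x)))" by (rule exp_converges)
        then show ?case using elim
          by (simp add: powr_def Ln_of_real scaleR_conv_of_real power_mult_distrib field_simps)
      qed
      show "AE x in M. \<forall>N. (\<Sum>n<N. norm (complex_of_real (ln (X x) ^ n / fact n) * w ^ n)) \<le> X x powr norm w + X x powr - norm w"
        using pos
      proof eventually_elim
        case (elim x)
        have "norm (complex_of_real (ln (X x) ^ n / fact n) * w ^ n) = (norm w * \<bar>ln (X x)\<bar>) ^ n / fact n" for n
          by (simp add: norm_mult norm_power norm_divide power_mult_distrib)
        moreover have "(\<Sum>n<N. (norm w * \<bar>ln (X x)\<bar>) ^ n / fact n) \<le> exp (norm w * \<bar>ln (X x)\<bar>)" for N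
          by (rule sum_exp_le) simp
        moreover have "exp (norm w * \<bar>ln (X x)\<bar>) \<le> X x powr norm w + X x powr - norm w"
          using elim by (cases "ln (X x) \<ge> 0") (auto simp: powr_def mult.commute)
        ultimately show ?case by (simp only:) (blast intro: order_trans)
      qed
    qed measurable
    then show ?thesis by (simp add: a_def)
  qed
  then have "(\<lambda>q. LINT x|M. complex_of_real (X x) powr q) holomorphic_on ball 0 r" for r
    by (intro power_series_holomorphic[of 0 r a]) auto
  then have "\<exists>d. ((\<lambda>q. LINT x|M. complex_of_real (X x) powr q) has_field_derivative d) (at z)" for z
    using holomorphic_on_imp_differentiable_at[OF _ open_ball, of _ 0 "norm z + 1" z]
    by (auto simp: field_differentiable_def)
  then show "(\<lambda>q. LINT x|M. complex_of_real (X x) powr q) holomorphic_on UNIV"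
    by (auto simp: holomorphic_on_open)
qed

section \<open>Moments of \<open>S2\<close> of every complex order\<close>

context gamma_variables
begin

text \<open>Near 0 the power is controlled by 1/x^N, and at infinity it is absorbed into exp((l-k)
  x) for some l between k and pi^2/2. Both majorants have finite mean, by
  \<open>S2_inverse_moment\<close> and \<open>S2_exp_moment\<close>.\<close>

lemma S2_weighted_moment:
  assumes k: "k < pi\<^sup>2 / 2"
  shows "integrable P (\<lambda>\<omega>. S2 G \<omega> powr s * exp (k * S2 G \<omega>))"
proof -
  \<comment> \<open>The midpoint between max k 0 and pi^2/2, which is positive even for negative k,
    as \<open>S2_exp_moment\<close> demands.\<close>
  define l where "l = (max k 0 + pi\<^sup>2 / 2) / 2"
  have l: "0 < l" "l < pi\<^sup>2 / 2" "k < l"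
    using k pi_gt_zero by (auto simp: l_def max_def field_simps)
  define N where "N = nat \<lceil>\<bar>s\<bar>\<rceil>"
  have N: "\<bar>s\<bar> \<le> real N" unfolding N_def by linarith
  \<comment> \<open>The constant comes from y^N / N! \<le> exp y at y = (l-k) x.\<close>
  define C where "C = fact N / (l - k) ^ N"
  have bound: "x powr s * exp (k * x) \<le> exp \<bar>k\<bar> * (1 / x ^ N) + C * exp (l * x)" if x: "x > 0" for x
  proof (cases "x \<le> 1")
    case True
    have "x powr s \<le> x powr (- real N)" using x True N by (intro powr_mono') auto
    also have "\<dots> = 1 / x ^ N" using x by (simp add: powr_minus powr_realpow divide_inverse)
    finally have 1: "x powr s \<le> 1 / x ^ N" .
    have "k * x \<le> \<bar>k\<bar> * 1" using x True by (intro mult_mono) auto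
    then have "x powr s * exp (k * x) \<le> 1 / x ^ N * exp \<bar>k\<bar>" using 1 x by (intro mult_mono) auto
    moreover have "0 \<le> C * exp (l * x)" using l by (simp add: C_def)
    ultimately show ?thesis by (simp add: mult.commute)
  next
    case False
    have "x powr s \<le> x powr real N" using False N by (intro powr_mono) auto
    also have "\<dots> = x ^ N" using x by (simp add: powr_realpow)
    also have "\<dots> \<le> C * exp ((l - k) * x)"
    proof -
      have nn: "0 \<le> (l - k) * x" using l x by simp
      have "((l - k) * x) ^ N / fact N \<le> (\<Sum>n<Suc N. ((l - k) * x) ^ n / fact n)"
        using nn by (auto intro!: sum_nonneg)
      also have "\<dots> \<le> exp ((l - k) * x)" by (rule sum_exp_le[OF nn])
      finally have "((l - k) * x) ^ N \<le> fact N * exp ((l - k) * x)"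
        by (simp add: pos_divide_le_eq mult.commute)
      then have "x ^ N * (l - k) ^ N \<le> fact N * exp ((l - k) * x)"
        by (simp only: power_mult_distrib mult.commute)
      then show ?thesis using l by (simp add: C_def pos_le_divide_eq)
    qed
    finally have "x powr s * exp (k * x) \<le> C * exp ((l - k) * x) * exp (k * x)" by (intro mult_right_mono) auto
    also have "\<dots> = C * exp (l * x)" by (simp add: algebra_simps flip: exp_add)
    finally show ?thesis using x by (simp add: add_increasing)
  qed
  have i1: "integrable P (\<lambda>\<omega>. 1 / S2 G \<omega> ^ N)"
    using S2_inverse_moment[of N] S2_pos
    by (intro integrableI_nonneg) (auto elim!: eventually_mono)
  have i2: "integrable P (\<lambda>\<omega>. exp (l * S2 G \<omega>))"
    using S2_exp_moment[OF l(1,2)] by (intro integrableI_nonneg) auto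
  show ?thesis
  proof (rule Bochner_Integration.integrable_bound)
    show "integrable P (\<lambda>\<omega>. exp \<bar>k\<bar> * (1 / S2 G \<omega> ^ N) + C * exp (l * S2 G \<omega>))"
      by (intro Bochner_Integration.integrable_add integrable_mult_right i1 i2)
    show "AE \<omega> in P. norm (S2 G \<omega> powr s * exp (k * S2 G \<omega>)) \<le> norm (exp \<bar>k\<bar> * (1 / S2 G \<omega> ^ N) + C * exp (l * S2 G \<omega>))"
      using S2_pos
    proof eventually_elim
      case (elim \<omega>)
      have "norm (S2 G \<omega> powr s * exp (k * S2 G \<omega>)) = S2 G \<omega> powr s * exp (k * S2 G \<omega>)" by simp
      also have "\<dots> \<le> exp \<bar>k\<bar> * (1 / S2 G \<omega> ^ N) + C * exp (l * S2 G \<omega>)" by (rule bound[OF elim])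
      finally show ?case by simp
    qed
  qed measurable
qed

lemma S2_moment: "integrable P (\<lambda>\<omega>. S2 G \<omega> powr s)"
  using S2_weighted_moment[of 0 s] by simp

definition S2_mellin :: "complex \<Rightarrow> complex" where
  "S2_mellin q = (LINT \<omega>|P. complex_of_real (S2 G \<omega>) powr q)"

lemma S2_mellin_holomorphic: "S2_mellin holomorphic_on UNIV"
  unfolding S2_mellin_def[abs_def] by (rule entire_moments(2)) (auto simp: S2_pos S2_moment)

text \<open>Taking absolute values in the expansion of exp(-d S2) produces exp(d S2), whose weighted
  moment is finite because d lies below the first pole.\<close>

lemma S2_mellin_series:
  assumes d: "0 < d" "d < pi\<^sup>2 / 2"
  shows "(\<lambda>n. of_real ((- d) ^ n / fact n) * S2_mellin (q + of_nat n)) sums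
     (LINT \<omega>|P. complex_of_real (S2 G \<omega>) powr q * of_real (exp (- d * S2 G \<omega>)))"
proof -
  have "(\<lambda>n. LINT \<omega>|P. of_real ((- d) ^ n / fact n) * complex_of_real (S2 G \<omega>) powr (q + of_nat n)) sums
     (LINT \<omega>|P. complex_of_real (S2 G \<omega>) powr q * of_real (exp (- d * S2 G \<omega>)))"
  proof (rule sums_integral_dominated)
    show "integrable P (\<lambda>\<omega>. S2 G \<omega> powr Re q * exp (d * S2 G \<omega>))" by (rule S2_weighted_moment[OF d(2)])
    have eq: "of_real ((- d) ^ n / fact n) * complex_of_real x powr (q + of_nat n) =
        complex_of_real x powr q * of_real ((- d * x) ^ n / fact n)" if "x > 0" for x n
    proof -
      have "(- d * x) ^ n = (- d) ^ n * x ^ n" by (rule power_mult_distrib)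
      then show ?thesis using that by (simp add: powr_add)
    qed
    show "AE \<omega> in P. (\<lambda>n. of_real ((- d) ^ n / fact n) * complex_of_real (S2 G \<omega>) powr (q + of_nat n)) sums
       (complex_of_real (S2 G \<omega>) powr q * of_real (exp (- d * S2 G \<omega>)))"
      using S2_pos
    proof eventually_elim
      case (elim \<omega>)
      have "(\<lambda>n. (- d * S2 G \<omega>) ^ n / fact n) sums exp (- d * S2 G \<omega>)"
        using exp_converges[of "- d * S2 G \<omega>"] by (simp add: divide_inverse_commute)
      then show ?case unfolding eq[OF elim] by (intro sums_mult sums_of_real)
    qed
    show "AE \<omega> in P. \<forall>N. (\<Sum>n<N. norm (of_real ((- d) ^ n / fact n) * complex_of_real (S2 G \<omega>) powr (q + of_nat n)))
        \<le> S2 G \<omega> powr Re q * exp (d * S2 G \<omega>)"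
      using S2_pos
    proof (eventually_elim, intro allI)
      fix \<omega> N assume *: "S2 G \<omega> > 0"
      have "norm (of_real ((- d) ^ n / fact n) * complex_of_real (S2 G \<omega>) powr (q + of_nat n)) =
          S2 G \<omega> powr Re q * ((d * S2 G \<omega>) ^ n / fact n)" for n
        unfolding eq[OF *] using * d by (simp add: norm_mult norm_of_real_powr norm_divide norm_power abs_mult)
      then have "(\<Sum>n<N. norm (of_real ((- d) ^ n / fact n) * complex_of_real (S2 G \<omega>) powr (q + of_nat n))) =
          S2 G \<omega> powr Re q * (\<Sum>n<N. (d * S2 G \<omega>) ^ n / fact n)"
        by (simp add: sum_distrib_left)
      also have "\<dots> \<le> S2 G \<omega> powr Re q * exp (d * S2 G \<omega>)"
        using * d by (intro mult_left_mono sum_exp_le) auto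
      finally show "(\<Sum>n<N. norm (of_real ((- d) ^ n / fact n) * complex_of_real (S2 G \<omega>) powr (q + of_nat n)))
        \<le> S2 G \<omega> powr Re q * exp (d * S2 G \<omega>)" .
    qed
  qed measurable
  then show ?thesis by (simp add: S2_mellin_def)
qed

text \<open>For d > 0 the exponential is at most 1, so S2 powr Re q is a majorant. The limit is
  taken under the expectation and not in the xi series.\<close>

lemma S2_mellin_limit:
  "((\<lambda>d. LINT \<omega>|P. complex_of_real (S2 G \<omega>) powr q * of_real (exp (- d * S2 G \<omega>))) \<longlongrightarrow> S2_mellin q) (at_right 0)"
proof (rule tendsto_at_right_sequentially[of 0 1])
  fix d :: "nat \<Rightarrow> real" assume d: "\<And>n. 0 < d n" "d \<longlonglongrightarrow> 0"
  have "(\<lambda>n. LINT \<omega>|P. complex_of_real (S2 G \<omega>) powr q * of_real (exp (- d n * S2 G \<omega>))) \<longlonglongrightarrow>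
      (LINT \<omega>|P. complex_of_real (S2 G \<omega>) powr q)"
  proof (rule integral_dominated_convergence[OF _ _ S2_moment[of "Re q"]])
    show "AE \<omega> in P. (\<lambda>n. complex_of_real (S2 G \<omega>) powr q * of_real (exp (- d n * S2 G \<omega>))) \<longlonglongrightarrow> complex_of_real (S2 G \<omega>) powr q"
    proof (intro AE_I2)
      fix \<omega>
      have "(\<lambda>n. complex_of_real (S2 G \<omega>) powr q * of_real (exp (- d n * S2 G \<omega>))) \<longlonglongrightarrow>
          complex_of_real (S2 G \<omega>) powr q * of_real (exp (- 0 * S2 G \<omega>))"
        by (intro tendsto_intros d)
      then show "(\<lambda>n. complex_of_real (S2 G \<omega>) powr q * of_real (exp (- d n * S2 G \<omega>))) \<longlonglongrightarrow> complex_of_real (S2 G \<omega>) powr q"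
        by simp
    qed
    show "AE \<omega> in P. norm (complex_of_real (S2 G \<omega>) powr q * of_real (exp (- d n * S2 G \<omega>))) \<le> S2 G \<omega> powr Re q" for n
      using S2_pos
      by eventually_elim (use d(1)[of n] in \<open>auto simp: norm_mult norm_of_real_powr intro!: mult_left_le\<close>)
  qed measurable
  then show "(\<lambda>n. LINT \<omega>|P. complex_of_real (S2 G \<omega>) powr q * of_real (exp (- d n * S2 G \<omega>))) \<longlonglongrightarrow> S2_mellin q"
    by (simp add: S2_mellin_def)
qed simp

lemma sinh_factor_tendsto: "(sinh_factor \<longlongrightarrow> 1) (at_right 0)"
proof -
  have "((\<lambda>d::real. (sinh (sqrt (2 * d)) / sqrt (2 * d))\<^sup>2) \<longlongrightarrow> 1) (at_right 0)"
    by real_asymp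
  then show ?thesis unfolding sinh_factor_def[abs_def] .
qed

end

section \<open>Recurrence and holomorphy of the Mellin transform of T\<close>

text \<open>For x > s > 0 one has x^r \<le> x^(r+N) / s^N. Raising the exponent makes the Gamma
  integral converge at 0 even for very negative r; the price 1/s^N is affordable for s =
  \<open>S2\<close> thanks to \<open>S2_inverse_moment\<close>.\<close>

lemma nn_integral_tail_le:
  fixes d s r :: real
  assumes d: "d > 0" and s: "s > 0" and r: "r + real N \<ge> 0"
  shows "(\<integral>\<^sup>+x. ennreal (exp (- d * x) * indicator {s<..} x * x powr r) \<partial>lborel)
     \<le> ennreal (Gamma (r + real N + 1) / d powr (r + real N + 1)) * ennreal (1 / s ^ N)"
proof -
  have "(\<integral>\<^sup>+x. ennreal (exp (- d * x) * indicator {s<..} x * x powr r) \<partial>lborel) \<le>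
    (\<integral>\<^sup>+x. ennreal (x powr (r + real N + 1 - 1) * exp (- d * x) * indicator {0<..} x) * ennreal (1 / s ^ N) \<partial>lborel)"
  proof (intro nn_integral_mono)
    fix x :: real
    show "ennreal (exp (- d * x) * indicator {s<..} x * x powr r) \<le>
      ennreal (x powr (r + real N + 1 - 1) * exp (- d * x) * indicator {0<..} x) * ennreal (1 / s ^ N)"
    proof (cases "x > s")
      case True
      then have x: "x > 0" using s by simp
      have "1 \<le> (x / s) ^ N" using True s by (intro one_le_power) simp
      then have "x powr r * 1 \<le> x powr r * (x / s) ^ N" by (intro mult_left_mono) auto
      also have "\<dots> = x powr (r + real N) * (1 / s ^ N)"
        using x by (simp add: powr_add powr_realpow power_divide)
      finally have "exp (- d * x) * x powr r \<le> exp (- d * x) * (x powr (r + real N) * (1 / s ^ N))"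
        by (intro mult_left_mono) auto
      then show ?thesis using True x s by (subst ennreal_mult[symmetric]) (auto intro!: ennreal_leI simp: mult_ac)
    qed auto
  qed
  also have "\<dots> = ennreal (Gamma (r + real N + 1) / d powr (r + real N + 1)) * ennreal (1 / s ^ N)"
    using d r by (subst nn_integral_multc) (simp_all only: nn_integral_Gamma, auto)
  finally show ?thesis .
qed

text \<open>\<open>tail_kernel_recurrence\<close> integrates the derivative of \<open>- x powr q * exp (- d * x)\<close> over \<open>{s<..}\<close>.\<close>

definition tail_kernel :: "real \<Rightarrow> complex \<Rightarrow> real \<Rightarrow> real \<Rightarrow> complex" where
  "tail_kernel d q s x = of_real (exp (- d * x) * (if s < x then 1 else 0)) * of_real x powr q"

lemma tail_kernel_measurable[measurable]:
  assumes [measurable]: "f \<in> borel_measurable M" "g \<in> borel_measurable M"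
  shows "(\<lambda>x. tail_kernel d q (f x) (g x)) \<in> borel_measurable M"
  unfolding tail_kernel_def by measurable

lemma norm_tail_kernel:
  assumes "s > 0"
  shows "norm (tail_kernel d q s x) = exp (- d * x) * indicator {s<..} x * x powr Re q"
  using assms by (auto simp: tail_kernel_def norm_mult norm_of_real_powr indicator_def)

lemma tail_kernel_integrable:
  assumes d: "d > 0" and s: "s > 0"
  shows "integrable lborel (tail_kernel d q s)"
proof (rule integrableI_bounded)
  obtain N :: nat where "- Re q \<le> real N" using real_arch_simple by blast
  then have "(\<integral>\<^sup>+x. ennreal (norm (tail_kernel d q s x)) \<partial>lborel)
     \<le> ennreal (Gamma (Re q + real N + 1) / d powr (Re q + real N + 1)) * ennreal (1 / s ^ N)"
    unfolding norm_tail_kernel[OF s] by (intro nn_integral_tail_le d s) simp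
  then show "(\<integral>\<^sup>+x. ennreal (norm (tail_kernel d q s x)) \<partial>lborel) < \<infinity>"
    by (rule order_le_less_trans) (simp add: ennreal_mult_less_top)
qed measurable

lemma tail_kernel_recurrence:
  assumes d: "d > 0" and s: "s > 0"
  shows "of_real d * (LINT x|lborel. tail_kernel d q s x) - q * (LINT x|lborel. tail_kernel d (q - 1) s x)
    = of_real s powr q * of_real (exp (- d * s))"
proof -
  define F where "F = (\<lambda>z::complex. - (z powr q * exp (- of_real d * z)))"
  define f where "f = (\<lambda>x::real. (of_real d * of_real x powr q - q * of_real x powr (q - 1)) * exp (- of_real d * of_real x) :: complex)"
  have ker: "of_real d * tail_kernel d q s x - q * tail_kernel d (q - 1) s x = indicator {s<..} x *\<^sub>R f x" for x
    by (simp add: tail_kernel_def f_def indicator_def algebra_simps exp_of_real[symmetric])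
  have int: "integrable lborel (\<lambda>x. indicator {s<..} x *\<^sub>R f x)"
    unfolding ker[symmetric]
    by (intro Bochner_Integration.integrable_diff integrable_mult_right tail_kernel_integrable d s)
  have "(LBINT x=ereal s..\<infinity>. f x) = 0 - F (of_real s)"
  proof (rule interval_integral_FTC_integrable[where F = "\<lambda>x. F (of_real x)"])
    fix x assume "ereal s < ereal x"
    then have x: "x > 0" using s by simp
    then have nr: "complex_of_real x \<notin> \<real>\<^sub>\<le>\<^sub>0" by (auto simp: complex_nonpos_Reals_iff)
    have "(F has_field_derivative f x) (at (of_real x))"
      unfolding F_def f_def
      by (auto intro!: derivative_eq_intros has_field_derivative_powr nr simp: algebra_simps)
    then show "((\<lambda>x. F (of_real x)) has_vector_derivative f x) (at x)"
      by (rule has_vector_derivative_real_field)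
    show "isCont f x"
      unfolding f_def using x nr by (intro continuous_intros) auto
  next
    have "set_integrable lborel {s<..} f" using int by (simp add: set_integrable_def)
    then show "set_integrable lborel (einterval (ereal s) \<infinity>) f" by simp
  next
    have "isCont (\<lambda>x. F (of_real x)) s"
      unfolding F_def using s by (intro continuous_intros) (auto simp: complex_nonpos_Reals_iff)
    then have "((\<lambda>x. F (of_real x)) \<longlongrightarrow> F (of_real s)) (at_right s)"
      by (simp add: isCont_def filterlim_at_split)
    then show "(((\<lambda>x. F (of_real x)) \<circ> real_of_ereal) \<longlongrightarrow> F (of_real s)) (at_right (ereal s))"
      by (simp add: ereal_tendsto_simps)
  next
    have "((\<lambda>x. F (of_real x)) \<longlongrightarrow> 0) at_top"
    proof (rule tendsto_norm_zero_cancel)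
      have "((\<lambda>x. x powr Re q * exp (- d * x)) \<longlongrightarrow> 0) at_top" using d by real_asymp
      moreover have "\<forall>\<^sub>F x in at_top. x powr Re q * exp (- d * x) = norm (F (of_real x))"
        using eventually_gt_at_top[of 0]
        by eventually_elim (simp add: F_def norm_mult norm_of_real_powr)
      ultimately show "((\<lambda>x. norm (F (of_real x))) \<longlongrightarrow> 0) at_top"
        by (rule Lim_transform_eventually)
    qed
    then show "(((\<lambda>x. F (of_real x)) \<circ> real_of_ereal) \<longlongrightarrow> 0) (at_left \<infinity>)"
      by (simp add: ereal_tendsto_simps)
  qed simp
  moreover have "(LBINT x=ereal s..\<infinity>. f x) = (LINT x|lborel. indicator {s<..} x *\<^sub>R f x)"
    by (simp add: interval_integral_to_infinity_eq set_lebesgue_integral_def)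
  moreover have "\<dots> = of_real d * (LINT x|lborel. tail_kernel d q s x) - q * (LINT x|lborel. tail_kernel d (q - 1) s x)"
    unfolding ker[symmetric] by (subst Bochner_Integration.integral_diff)
      (auto intro!: integrable_mult_right tail_kernel_integrable d s)
  ultimately show ?thesis by (simp add: F_def exp_of_real[symmetric])
qed

context gamma_variables
begin

text \<open>This licenses Fubini for every complex q: inverse moments of \<open>S2\<close> of all
  orders compensate the singularity of x powr q at 0.\<close>

lemma tail_kernel_pair_integrable:
  assumes d: "d > 0"
  shows "integrable (P \<Otimes>\<^sub>M lborel) (\<lambda>(\<omega>, x). tail_kernel d q (S2 G \<omega>) x)"
proof (rule integrableI_bounded)
  obtain N :: nat where N: "- Re q \<le> real N" using real_arch_simple by blast
  let ?C = "ennreal (Gamma (Re q + real N + 1) / d powr (Re q + real N + 1))"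
  have "(\<integral>\<^sup>+p. ennreal (norm (case p of (\<omega>, x) \<Rightarrow> tail_kernel d q (S2 G \<omega>) x)) \<partial>(P \<Otimes>\<^sub>M lborel)) =
      (\<integral>\<^sup>+\<omega>. (\<integral>\<^sup>+x. ennreal (norm (tail_kernel d q (S2 G \<omega>) x)) \<partial>lborel) \<partial>P)"
    by (subst lborel.nn_integral_fst[symmetric]) auto
  also have "\<dots> \<le> (\<integral>\<^sup>+\<omega>. ?C * ennreal (1 / S2 G \<omega> ^ N) \<partial>P)"
  proof (rule nn_integral_mono_AE)
    show "AE \<omega> in P. (\<integral>\<^sup>+x. ennreal (norm (tail_kernel d q (S2 G \<omega>) x)) \<partial>lborel) \<le> ?C * ennreal (1 / S2 G \<omega> ^ N)"
      using S2_pos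
    proof eventually_elim
      case (elim \<omega>)
      show ?case unfolding norm_tail_kernel[OF elim] using N by (intro nn_integral_tail_le d elim) simp
    qed
  qed
  also have "\<dots> = ?C * (\<integral>\<^sup>+\<omega>. ennreal (1 / S2 G \<omega> ^ N) \<partial>P)" by (rule nn_integral_cmult) measurable
  also have "\<dots> < \<infinity>" using S2_inverse_moment[of N] by (simp add: ennreal_mult_less_top)
  finally show "(\<integral>\<^sup>+p. ennreal (norm (case p of (\<omega>, x) \<Rightarrow> tail_kernel d q (S2 G \<omega>) x)) \<partial>(P \<Otimes>\<^sub>M lborel)) < \<infinity>" .
qed measurable

lemma T_density_tail_kernel:
  assumes d: "d > 0"
  shows "T_density d x *\<^sub>R complex_of_real x powr q =
     of_real (d * sinh_factor d) * (LINT \<omega>|P. tail_kernel d q (S2 G \<omega>) x)"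
proof (cases "x > 0")
  case True
  have "(LINT \<omega>|P. tail_kernel d q (S2 G \<omega>) x) =
      (LINT \<omega>|P. complex_of_real (indicator {\<omega> \<in> space P. S2 G \<omega> < x} \<omega>) * (of_real (exp (- d * x)) * of_real x powr q))"
    by (intro Bochner_Integration.integral_cong) (auto simp: tail_kernel_def indicator_def)
  also have "\<dots> = of_real (measure P {\<omega> \<in> space P. S2 G \<omega> < x}) * (of_real (exp (- d * x)) * of_real x powr q)"
    by (simp only: integral_mult_left_zero integral_complex_of_real) (simp add: Int_absorb2)
  finally show ?thesis
    using True by (simp add: T_density_def sinh_factor_def scaleR_conv_of_real mult_ac)
next
  case False
  have "(LINT \<omega>|P. tail_kernel d q (S2 G \<omega>) x) = (LINT \<omega>|P. 0)"
    using S2_pos False by (intro integral_cong_AE) (auto simp: tail_kernel_def elim!: eventually_mono)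
  then show ?thesis using False by (simp add: T_density_def)
qed

lemma
  assumes d: "d > 0" and \<mu>: "\<mu> = density lborel (\<lambda>x. ennreal (T_density d x))"
  shows T_powr_integrable: "integrable \<mu> (\<lambda>x. complex_of_real x powr q)"
    and T_mellin_eq: "mellin \<mu> q = of_real (d * sinh_factor d) * (LINT \<omega>|P. LINT x|lborel. tail_kernel d q (S2 G \<omega>) x)"
proof -
  interpret pair_sigma_finite P lborel by unfold_locales
  note int = tail_kernel_pair_integrable[OF d, of q]
  show "integrable \<mu> (\<lambda>x. complex_of_real x powr q)"
    unfolding \<mu> by (subst integrable_density)
      (auto simp: T_density_tail_kernel[OF d] T_density_nonneg[OF d] intro!: integrable_mult_right integrable_snd[OF int])
  have "mellin \<mu> q = (LINT x|lborel. of_real (d * sinh_factor d) * (LINT \<omega>|P. tail_kernel d q (S2 G \<omega>) x))"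
    unfolding mellin_def \<mu> by (subst integral_density) (auto simp: T_density_tail_kernel[OF d] T_density_nonneg[OF d])
  also have "\<dots> = of_real (d * sinh_factor d) * (LINT x|lborel. LINT \<omega>|P. tail_kernel d q (S2 G \<omega>) x)"
    by (rule integral_mult_right_zero)
  also have "(LINT x|lborel. LINT \<omega>|P. tail_kernel d q (S2 G \<omega>) x) = (LINT \<omega>|P. LINT x|lborel. tail_kernel d q (S2 G \<omega>) x)"
    by (rule Fubini_integral[OF int])
  finally show "mellin \<mu> q = of_real (d * sinh_factor d) * (LINT \<omega>|P. LINT x|lborel. tail_kernel d q (S2 G \<omega>) x)" .
qed

lemma T_mellin_holomorphic:
  assumes d: "d > 0" and \<mu>: "\<mu> = density lborel (\<lambda>x. ennreal (T_density d x))"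
  shows "mellin \<mu> holomorphic_on UNIV"
  unfolding mellin_def[abs_def]
proof (rule entire_moments(2))
  show pos: "AE x in \<mu>. 0 < x"
    unfolding \<mu> by (subst AE_density) (auto simp: T_density_def indicator_def)
  fix s :: real
  show "integrable \<mu> (\<lambda>x. x powr s)"
  proof (rule Bochner_Integration.integrable_bound[OF T_powr_integrable[OF d \<mu>, of "of_real s"]])
    show "AE x in \<mu>. norm (x powr s) \<le> norm (complex_of_real x powr of_real s)"
      using pos by eventually_elim (simp add: norm_of_real_powr)
  qed (simp add: \<mu>)
qed (simp add: \<mu>)

text \<open>The recurrence for the kernel holds at each fixed value of \<open>S2\<close> and is then
  averaged over \<open>P\<close>. The factor d of the density cancels the denominator of
  q/d.\<close>

lemma T_mellin_recurrence:
  assumes d: "d > 0" and \<mu>: "\<mu> = density lborel (\<lambda>x. ennreal (T_density d x))"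
  shows "mellin \<mu> q - q / of_real d * mellin \<mu> (q - 1) =
     of_real (sinh_factor d) * (LINT \<omega>|P. complex_of_real (S2 G \<omega>) powr q * of_real (exp (- d * S2 G \<omega>)))"
proof -
  interpret pair_sigma_finite P lborel by unfold_locales
  define I where "I = (\<lambda>q \<omega>. LINT x|lborel. tail_kernel d q (S2 G \<omega>) x)"
  have int: "integrable P (I q)" for q
    unfolding I_def by (rule integrable_fst[OF tail_kernel_pair_integrable[OF d]])
  have "mellin \<mu> q - q / of_real d * mellin \<mu> (q - 1) =
      of_real (sinh_factor d) * (of_real d * (LINT \<omega>|P. I q \<omega>) - q * (LINT \<omega>|P. I (q - 1) \<omega>))"
    unfolding T_mellin_eq[OF d \<mu>] I_def using d by (simp add: algebra_simps)
  also have "of_real d * (LINT \<omega>|P. I q \<omega>) - q * (LINT \<omega>|P. I (q - 1) \<omega>) = (LINT \<omega>|P. of_real d * I q \<omega> - q * I (q - 1) \<omega>)"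
    by (subst Bochner_Integration.integral_diff) (auto intro!: integrable_mult_right int)
  also have "\<dots> = (LINT \<omega>|P. complex_of_real (S2 G \<omega>) powr q * of_real (exp (- d * S2 G \<omega>)))"
  proof (rule integral_cong_AE)
    show "AE \<omega> in P. of_real d * I q \<omega> - q * I (q - 1) \<omega> = complex_of_real (S2 G \<omega>) powr q * of_real (exp (- d * S2 G \<omega>))"
      using S2_pos unfolding I_def by eventually_elim (rule tail_kernel_recurrence[OF d])
  qed (use borel_measurable_integrable[OF int] in measurable)
  finally show ?thesis .
qed

end

section \<open>The moments of \<open>S2\<close> and the zeta function\<close>

text \<open>Weighting by exp(-x)/r turns f and g into probability densities whose transforms at n
  are those of f and g at n+1, divided by r, so the two laws agree. Testing them with h(x) exp(x)
  removes the weight, with infinite values allowed.\<close>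

lemma nn_integral_eqI_laplace:
  fixes f g h :: "real \<Rightarrow> ennreal"
  assumes [measurable]: "f \<in> borel_measurable borel" "g \<in> borel_measurable borel" "h \<in> borel_measurable borel"
    and L: "\<And>n. n \<ge> 1 \<Longrightarrow> (\<integral>\<^sup>+x. f x * ennreal (exp (- real n * x) * indicator {0<..} x) \<partial>lborel) =
                   (\<integral>\<^sup>+x. g x * ennreal (exp (- real n * x) * indicator {0<..} x) \<partial>lborel)"
    and r: "(\<integral>\<^sup>+x. f x * ennreal (exp (- real 1 * x) * indicator {0<..} x) \<partial>lborel) = ennreal r" "r > 0"
  shows "(\<integral>\<^sup>+x. f x * h x * indicator {0<..} x \<partial>lborel) = (\<integral>\<^sup>+x. g x * h x * indicator {0<..} x \<partial>lborel)"
proof -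
  define D where "D = (\<lambda>f. density lborel (\<lambda>x. ennreal (1 / r) * (f x * ennreal (exp (- x) * indicator {0<..} x))))"
  have D: "(\<integral>\<^sup>+x. k x \<partial>D f) = ennreal (1 / r) * (\<integral>\<^sup>+x. f x * ennreal (exp (- x) * indicator {0<..} x) * k x \<partial>lborel)"
    if [measurable]: "f \<in> borel_measurable borel" "k \<in> borel_measurable borel" for f k
    unfolding D_def by (subst nn_integral_density) (auto simp: mult.assoc nn_integral_cmult)
  have D_exp: "(\<integral>\<^sup>+x. ennreal (exp (- real n * x)) \<partial>D f) =
      ennreal (1 / r) * (\<integral>\<^sup>+x. f x * ennreal (exp (- real (Suc n) * x) * indicator {0<..} x) \<partial>lborel)"
    if [measurable]: "f \<in> borel_measurable borel" for f n
    by (subst D) (auto intro!: arg_cong2[where f = "(*)"] nn_integral_cong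
        simp: mult.assoc ennreal_mult'[symmetric] indicator_def algebra_simps simp flip: exp_add)
  have prob: "prob_space (D f)"
    if [measurable]: "f \<in> borel_measurable borel"
      and *: "(\<integral>\<^sup>+x. f x * ennreal (exp (- real 1 * x) * indicator {0<..} x) \<partial>lborel) = ennreal r" for f
  proof (rule prob_spaceI)
    show "emeasure (D f) (space (D f)) = 1"
      using D_exp[of f 0] * r(2) by (simp add: ennreal_mult[symmetric])
  qed
  have supp: "AE x in D f. 0 \<le> x" if [measurable]: "f \<in> borel_measurable borel" for f
    unfolding D_def by (subst AE_density) (auto simp: indicator_def)
  have eq: "D f = D g"
  proof (rule prob_space_eqI_laplace)
    show "prob_space (D f)" "prob_space (D g)"
      using r(1) L[of 1] by (auto intro!: prob)
    show "(\<integral>\<^sup>+x. ennreal (exp (- real n * x)) \<partial>D f) = (\<integral>\<^sup>+x. ennreal (exp (- real n * x)) \<partial>D g)" for n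
      by (simp only: D_exp assms(1,2) L[of "Suc n"])
  qed (auto simp: supp, auto simp: D_def)
  have "(\<integral>\<^sup>+x. f x * h x * indicator {0<..} x \<partial>lborel) = ennreal r * (\<integral>\<^sup>+x. h x * ennreal (exp x) \<partial>D f)"
    if [measurable]: "f \<in> borel_measurable borel" for f
  proof -
    have "(\<integral>\<^sup>+x. h x * ennreal (exp x) \<partial>D f) =
        ennreal (1 / r) * (\<integral>\<^sup>+x. f x * ennreal (exp (- x) * indicator {0<..} x) * (h x * ennreal (exp x)) \<partial>lborel)"
      by (rule D) measurable
    also have "(\<integral>\<^sup>+x. f x * ennreal (exp (- x) * indicator {0<..} x) * (h x * ennreal (exp x)) \<partial>lborel) =
        (\<integral>\<^sup>+x. f x * h x * indicator {0<..} x \<partial>lborel)"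
    proof (intro nn_integral_cong)
      fix x :: real
      have "ennreal (exp (- x)) * ennreal (exp x) = 1" by (simp add: ennreal_mult[symmetric] flip: exp_add)
      moreover have "f x * ennreal (exp (- x)) * (h x * ennreal (exp x)) = f x * h x * (ennreal (exp (- x)) * ennreal (exp x))"
        by (simp only: ac_simps)
      ultimately have "f x * ennreal (exp (- x)) * (h x * ennreal (exp x)) = f x * h x" by simp
      then show "f x * ennreal (exp (- x) * indicator {0<..} x) * (h x * ennreal (exp x)) = f x * h x * indicator {0<..} x"
        by (cases "x > 0") simp_all
    qed
    finally have "(\<integral>\<^sup>+x. h x * ennreal (exp x) \<partial>D f) = ennreal (1 / r) * (\<integral>\<^sup>+x. f x * h x * indicator {0<..} x \<partial>lborel)" .
    then show ?thesis using r(2) by (simp add: mult.assoc[symmetric] ennreal_mult[symmetric])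
  qed
  then show ?thesis using eq by simp
qed

lemma summable_pole_powr:
  assumes s: "s > 1 / 2"
  shows "summable (\<lambda>n. 1 / pole n powr s)"
proof -
  have "summable (\<lambda>n. real (Suc n) powr (- (2 * s)))"
    using s by (subst summable_Suc_iff[of "\<lambda>n. real n powr (- (2 * s))"]) (auto simp: summable_real_powr_iff)
  then have "summable (\<lambda>n. (pi\<^sup>2 / 2) powr (- s) * real (Suc n) powr (- (2 * s)))" by (rule summable_mult)
  moreover have "(pi\<^sup>2 / 2) powr (- s) * real (Suc n) powr (- (2 * s)) = 1 / pole n powr s" for n
  proof -
    have "pole n powr s = (pi\<^sup>2 / 2) powr s * real (Suc n) powr (2 * s)"
    proof -
      have eq: "pole n = (pi\<^sup>2 / 2) * real (Suc n) powr 2" by (simp add: pole_def del: of_nat_Suc)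
      show ?thesis unfolding eq by (subst powr_mult) (auto simp: powr_powr simp del: of_nat_Suc powr_numeral)
    qed
    then show ?thesis by (simp only: powr_minus inverse_mult_distrib divide_inverse mult_1)
  qed
  ultimately show ?thesis by (simp only:)
qed

context gamma_variables
begin

text \<open>Both sides have the same Laplace transform by the partial fraction expansion; this is the
  identity \<open>P(S2 \<ge> x) = 2 * (\<Sum>n\<ge>1. (n\<^sup>2 * pi\<^sup>2 * x - 1) * exp (- n\<^sup>2 * pi\<^sup>2 * x / 2))\<close>, rearranged so that
  every term is nonnegative.\<close>

lemma S2_tail_identity:
  fixes h :: "real \<Rightarrow> ennreal"
  assumes [measurable]: "h \<in> borel_measurable borel"
  shows "(\<integral>\<^sup>+\<omega>. (\<integral>\<^sup>+x. h x * indicator {0<..S2 G \<omega>} x \<partial>lborel) \<partial>P) +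
           (\<Sum>n. (\<integral>\<^sup>+x. h x * ennreal (2 * (exp (- pole n * x) * indicator {0<..} x)) \<partial>lborel)) =
         (\<Sum>n. (\<integral>\<^sup>+x. h x * ennreal (4 * pole n * (x * exp (- pole n * x) * indicator {0<..} x)) \<partial>lborel))"
proof -
  interpret pair_sigma_finite lborel P by unfold_locales
  \<comment> \<open>On x > 0, f is P(S2 \<ge> x) together with the negative terms of the tail
    series, moved to this side, and g collects the positive terms.\<close>
  define f where "f = (\<lambda>x. (\<integral>\<^sup>+\<omega>. (if x \<le> S2 G \<omega> then 1 else 0) \<partial>P) + (\<Sum>n. ennreal (2 * exp (- pole n * x))))"
  define g where "g = (\<lambda>x. \<Sum>n. ennreal (4 * pole n * (x * exp (- pole n * x))))"
  have [measurable]: "f \<in> borel_measurable borel" "g \<in> borel_measurable borel"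
    unfolding f_def g_def by measurable
  have f_int: "(\<integral>\<^sup>+x. f x * k x * indicator {0<..} x \<partial>lborel) =
      (\<integral>\<^sup>+\<omega>. (\<integral>\<^sup>+x. k x * indicator {0<..S2 G \<omega>} x \<partial>lborel) \<partial>P) +
           (\<Sum>n. (\<integral>\<^sup>+x. k x * ennreal (2 * (exp (- pole n * x) * indicator {0<..} x)) \<partial>lborel))"
    if [measurable]: "k \<in> borel_measurable borel" for k
  proof -
    have "(\<integral>\<^sup>+x. f x * k x * indicator {0<..} x \<partial>lborel) =
       (\<integral>\<^sup>+x. (\<integral>\<^sup>+\<omega>. k x * (if 0 < x \<and> x \<le> S2 G \<omega> then 1 else 0) \<partial>P) +
             (\<Sum>n. k x * ennreal (2 * (exp (- pole n * x) * indicator {0<..} x))) \<partial>lborel)"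
    proof (intro nn_integral_cong)
      fix x :: real
      have *: "(\<integral>\<^sup>+\<omega>. k x * (if 0 < x \<and> x \<le> S2 G \<omega> then 1 else 0) \<partial>P) = k x * (\<integral>\<^sup>+\<omega>. (if 0 < x \<and> x \<le> S2 G \<omega> then 1 else 0) \<partial>P)"
        by (rule nn_integral_cmult) measurable
      show "f x * k x * indicator {0<..} x = (\<integral>\<^sup>+\<omega>. k x * (if 0 < x \<and> x \<le> S2 G \<omega> then 1 else 0) \<partial>P) +
             (\<Sum>n. k x * ennreal (2 * (exp (- pole n * x) * indicator {0<..} x)))"
      proof (cases "x > 0")
        case True
        have "f x * k x = k x * f x" by (rule mult.commute)
        also have "\<dots> = k x * (\<integral>\<^sup>+\<omega>. (if x \<le> S2 G \<omega> then 1 else 0) \<partial>P) + (\<Sum>n. k x * ennreal (2 * exp (- pole n * x)))"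
          unfolding f_def by (simp only: distrib_left ennreal_suminf_cmult)
        finally show ?thesis using True * by simp
      qed simp
    qed
    also have "\<dots> = (\<integral>\<^sup>+x. (\<integral>\<^sup>+\<omega>. k x * (if 0 < x \<and> x \<le> S2 G \<omega> then 1 else 0) \<partial>P) \<partial>lborel) +
             (\<integral>\<^sup>+x. (\<Sum>n. k x * ennreal (2 * (exp (- pole n * x) * indicator {0<..} x))) \<partial>lborel)"
      by (rule nn_integral_add) measurable
    also have "(\<integral>\<^sup>+x. (\<Sum>n. k x * ennreal (2 * (exp (- pole n * x) * indicator {0<..} x))) \<partial>lborel) =
       (\<Sum>n. \<integral>\<^sup>+x. k x * ennreal (2 * (exp (- pole n * x) * indicator {0<..} x)) \<partial>lborel)"
      by (rule nn_integral_suminf) measurable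
    also have "(\<integral>\<^sup>+x. (\<integral>\<^sup>+\<omega>. k x * (if 0 < x \<and> x \<le> S2 G \<omega> then 1 else 0) \<partial>P) \<partial>lborel) =
       (\<integral>\<^sup>+\<omega>. (\<integral>\<^sup>+x. k x * (if 0 < x \<and> x \<le> S2 G \<omega> then 1 else 0) \<partial>lborel) \<partial>P)"
      by (rule Fubini'[symmetric]) measurable
    also have "\<dots> = (\<integral>\<^sup>+\<omega>. (\<integral>\<^sup>+x. k x * indicator {0<..S2 G \<omega>} x \<partial>lborel) \<partial>P)"
      by (intro nn_integral_cong) (auto simp: indicator_def)
    finally show ?thesis .
  qed
  have g_int: "(\<integral>\<^sup>+x. g x * k x * indicator {0<..} x \<partial>lborel) =
      (\<Sum>n. (\<integral>\<^sup>+x. k x * ennreal (4 * pole n * (x * exp (- pole n * x) * indicator {0<..} x)) \<partial>lborel))"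
    if [measurable]: "k \<in> borel_measurable borel" for k
  proof -
    have "(\<integral>\<^sup>+x. g x * k x * indicator {0<..} x \<partial>lborel) =
       (\<integral>\<^sup>+x. (\<Sum>n. k x * ennreal (4 * pole n * (x * exp (- pole n * x) * indicator {0<..} x))) \<partial>lborel)"
    proof (intro nn_integral_cong)
      fix x :: real
      show "g x * k x * indicator {0<..} x = (\<Sum>n. k x * ennreal (4 * pole n * (x * exp (- pole n * x) * indicator {0<..} x)))"
      proof (cases "x > 0")
        case True
        have "g x * k x = k x * g x" by (rule mult.commute)
        also have "\<dots> = (\<Sum>n. k x * ennreal (4 * pole n * (x * exp (- pole n * x))))"
          unfolding g_def by (simp only: ennreal_suminf_cmult)
        finally show ?thesis using True by simp
      qed simp
    qed
    also have "\<dots> = (\<Sum>n. (\<integral>\<^sup>+x. k x * ennreal (4 * pole n * (x * exp (- pole n * x) * indicator {0<..} x)) \<partial>lborel))"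
      by (rule nn_integral_suminf) measurable
    finally show ?thesis .
  qed
  \<comment> \<open>The common Laplace transform of f and g. Writing p = (l+p) - l in 4p/(l+p)^2
    produces the two series of \<open>sinh_partial_fractions\<close>.\<close>
  define R where "R = (\<lambda>l. \<Sum>n. 4 * pole n / (l + pole n)\<^sup>2)"
  have R_summable: "summable (\<lambda>n. 4 * pole n / (l + pole n)\<^sup>2)"
    and R_eq: "R l = 4 * (\<Sum>n. 1 / (l + pole n)) - 4 * l * (\<Sum>n. 1 / (l + pole n)\<^sup>2)" if l: "l > 0" for l
  proof -
    note s = summable_inverse_pole_shift[OF l]
    have eq: "4 * pole n / (l + pole n)\<^sup>2 = 4 * (1 / (l + pole n)) - 4 * l * (1 / (l + pole n)\<^sup>2)" for n
    proof -
      have "4 * (y - l) / y\<^sup>2 = 4 * (1 / y) - 4 * l * (1 / y\<^sup>2)" if "y \<noteq> 0" for y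
        using that by (simp add: field_simps power2_eq_square)
      from this[of "l + pole n"] show ?thesis using pole_pos[of n] l by simp
    qed
    show "summable (\<lambda>n. 4 * pole n / (l + pole n)\<^sup>2)"
      unfolding eq by (intro summable_diff summable_mult s)
    show "R l = 4 * (\<Sum>n. 1 / (l + pole n)) - 4 * l * (\<Sum>n. 1 / (l + pole n)\<^sup>2)"
      unfolding R_def eq suminf_mult[OF s(1), symmetric] suminf_mult[OF s(2), symmetric]
      by (intro suminf_diff[symmetric] summable_mult s)
  qed
  have g_laplace: "(\<integral>\<^sup>+x. g x * ennreal (exp (- l * x)) * indicator {0<..} x \<partial>lborel) = ennreal (R l)" if l: "l > 0" for l
  proof -
    have "(\<integral>\<^sup>+x. ennreal (exp (- l * x)) * ennreal (4 * pole n * (x * exp (- pole n * x) * indicator {0<..} x)) \<partial>lborel) =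
       ennreal (4 * pole n / (l + pole n)\<^sup>2)" for n
    proof -
      have "(\<integral>\<^sup>+x. ennreal (exp (- l * x)) * ennreal (4 * pole n * (x * exp (- pole n * x) * indicator {0<..} x)) \<partial>lborel) =
         (\<integral>\<^sup>+x. ennreal (4 * pole n) * ennreal (x * exp (- (l + pole n) * x) * indicator {0<..} x) \<partial>lborel)"
        using pole_pos[of n] by (intro nn_integral_cong)
          (auto simp: ennreal_mult'[symmetric] indicator_def algebra_simps simp flip: exp_add)
      also have "\<dots> = ennreal (4 * pole n) * ennreal (1 / (l + pole n)\<^sup>2)"
        using pole_pos[of n] l by (subst nn_integral_cmult) (auto simp only: nn_integral_x_exp add_pos_pos, measurable)
      finally show ?thesis using pole_pos[of n] by (simp add: ennreal_mult[symmetric])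
    qed
    then show ?thesis
      unfolding R_def using pole_pos R_summable[OF l] by (subst g_int) (auto intro!: suminf_ennreal2 simp: less_imp_le)
  qed
  have f_laplace: "(\<integral>\<^sup>+x. f x * ennreal (exp (- l * x)) * indicator {0<..} x \<partial>lborel) = ennreal (R l)" if l: "l > 0" for l
  proof -
    define \<phi> where "\<phi> = (sqrt (2 * l) / sinh (sqrt (2 * l)))\<^sup>2"
    have "(\<integral>\<^sup>+\<omega>. (\<integral>\<^sup>+x. ennreal (exp (- l * x)) * indicator {0<..S2 G \<omega>} x \<partial>lborel) \<partial>P) =
       (\<integral>\<^sup>+\<omega>. ennreal ((1 - exp (- l * S2 G \<omega>)) / l) \<partial>P)"
    proof (rule nn_integral_cong_AE)
      show "AE \<omega> in P. (\<integral>\<^sup>+x. ennreal (exp (- l * x)) * indicator {0<..S2 G \<omega>} x \<partial>lborel) = ennreal ((1 - exp (- l * S2 G \<omega>)) / l)"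
        using S2_pos
      proof eventually_elim
        case (elim \<omega>)
        have "(\<integral>\<^sup>+x. ennreal (exp (- l * x)) * indicator {0<..S2 G \<omega>} x \<partial>lborel) =
            (\<integral>\<^sup>+x. ennreal (exp (- l * x)) * indicator {0..S2 G \<omega>} x \<partial>lborel)"
          using AE_lborel_singleton[of 0] by (intro nn_integral_cong_AE) (auto simp: indicator_def elim!: eventually_mono)
        also have "\<dots> = ennreal (- exp (- l * S2 G \<omega>) / l - - exp (- l * 0) / l)"
          using elim l by (intro nn_integral_FTC_Icc)
            (auto intro!: derivative_eq_intros simp: has_real_derivative_iff_has_vector_derivative[symmetric])
        finally show ?case by (simp add: diff_divide_distrib)
      qed
    qed
    also have "\<dots> = ennreal ((1 - \<phi>) / l)"
    proof -
      have i: "integrable P (\<lambda>\<omega>. exp (- l * S2 G \<omega>))"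
        using S2_pos l by (intro integrable_const_bound[where B = 1]) (auto elim!: eventually_mono)
      have "(LINT \<omega>|P. exp (- l * S2 G \<omega>)) = \<phi>"
        using laplace_S2[OF l] by (simp add: integral_eq_nn_integral \<phi>_def)
      then have "(LINT \<omega>|P. (1 - exp (- l * S2 G \<omega>)) / l) = (1 - \<phi>) / l"
        using i by (simp add: prob_space)
      moreover have "(\<integral>\<^sup>+\<omega>. ennreal ((1 - exp (- l * S2 G \<omega>)) / l) \<partial>P) = ennreal (LINT \<omega>|P. (1 - exp (- l * S2 G \<omega>)) / l)"
        using i S2_pos l by (intro nn_integral_eq_integral) (auto elim!: eventually_mono)
      ultimately show ?thesis by (simp only:)
    qed
    finally have 1: "(\<integral>\<^sup>+\<omega>. (\<integral>\<^sup>+x. ennreal (exp (- l * x)) * indicator {0<..S2 G \<omega>} x \<partial>lborel) \<partial>P) = ennreal ((1 - \<phi>) / l)" .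
    have "(\<integral>\<^sup>+x. ennreal (exp (- l * x)) * ennreal (2 * (exp (- pole n * x) * indicator {0<..} x)) \<partial>lborel) = ennreal (2 * (1 / (l + pole n)))" for n
    proof -
      have "(\<integral>\<^sup>+x. ennreal (exp (- l * x)) * ennreal (2 * (exp (- pole n * x) * indicator {0<..} x)) \<partial>lborel) =
         (\<integral>\<^sup>+x. ennreal 2 * ennreal (exp (- (l + pole n) * x) * indicator {0<..} x) \<partial>lborel)"
        by (intro nn_integral_cong)
          (auto simp: ennreal_mult'[symmetric] indicator_def algebra_simps simp flip: exp_add ennreal_numeral)
      also have "\<dots> = ennreal 2 * ennreal (1 / (l + pole n))"
        using pole_pos[of n] l by (subst nn_integral_cmult) (auto simp only: nn_integral_exp add_pos_pos, measurable)
      also have "\<dots> = ennreal (2 * (1 / (l + pole n)))" by (rule ennreal_mult'[symmetric]) simp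
      finally show ?thesis .
    qed
    then have 2: "(\<Sum>n. (\<integral>\<^sup>+x. ennreal (exp (- l * x)) * ennreal (2 * (exp (- pole n * x) * indicator {0<..} x)) \<partial>lborel)) =
        ennreal (2 * (\<Sum>n. 1 / (l + pole n)))"
    proof (simp only: suminf_mult[OF summable_inverse_pole_shift(1)[OF l], symmetric])
      show "(\<Sum>n. ennreal (2 * (1 / (l + pole n)))) = ennreal (\<Sum>n. 2 * (1 / (l + pole n)))"
        using l less_imp_le[OF pole_pos]
        by (intro suminf_ennreal2 summable_mult summable_inverse_pole_shift(1) mult_nonneg_nonneg divide_nonneg_nonneg add_nonneg_nonneg) auto
    qed
    have \<phi>1: "(1 - \<phi>) / l \<ge> 0"
    proof -
      have "ennreal \<phi> \<le> (\<integral>\<^sup>+\<omega>. 1 \<partial>P)"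
        unfolding \<phi>_def laplace_S2[OF l, symmetric] using S2_pos l
        by (intro nn_integral_mono_AE) (auto elim!: eventually_mono)
      then have "\<phi> \<le> 1" by (simp add: emeasure_space_1)
      then show ?thesis using l by simp
    qed
    \<comment> \<open>The first summand is the transform of the tail P(S2 \<ge> x); the second
      raises the coefficient of the simple fractions from 2 to 4.\<close>
    have "(1 - \<phi>) / l + 2 * (\<Sum>n. 1 / (l + pole n)) = R l"
      unfolding R_eq[OF l] using sinh_partial_fractions[OF l] by (simp add: \<phi>_def)
    moreover have "(\<Sum>n. 1 / (l + pole n)) \<ge> 0"
      using pole_pos l summable_inverse_pole_shift(1)[OF l] by (intro suminf_nonneg) (auto simp: add_nonneg_nonneg less_imp_le)
    moreover have "(\<lambda>x. ennreal (exp (- l * x))) \<in> borel_measurable borel" by measurable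
    ultimately show ?thesis
      using \<phi>1 by (simp only: f_int 1 2) (simp add: ennreal_plus[symmetric] del: ennreal_plus)
  qed
  have R_pos: "R 1 > 0"
    unfolding R_def using pole_pos add_pos_pos[OF zero_less_one pole_pos] R_summable[of 1]
    by (intro suminf_pos divide_pos_pos zero_less_power) auto
  have ind: "k x * ennreal (exp (- l * x) * indicator {0<..} x) = k x * ennreal (exp (- l * x)) * indicator {0<..} x"
    for k :: "real \<Rightarrow> ennreal" and l x :: real by (simp add: indicator_def)
  have "(\<integral>\<^sup>+x. f x * h x * indicator {0<..} x \<partial>lborel) = (\<integral>\<^sup>+x. g x * h x * indicator {0<..} x \<partial>lborel)"
    by (rule nn_integral_eqI_laplace[where r = "R 1"])
       (simp_all only: ind f_laplace g_laplace R_pos, simp_all)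
  then show ?thesis by (simp only: f_int g_int assms)
qed

text \<open>With h(x) = s x^(s-1) the tail integral is the moment, and the two series become Gamma
  integrals with coefficients 2 s Gamma(s) and 4 s Gamma(s+1) = 4 s^2 Gamma(s); the difference is 2s
  (2s-1) Gamma(s). The bound on s makes the sum over the poles converge.\<close>

lemma S2_moment_formula:
  assumes s: "s > 1 / 2"
  shows "(LINT \<omega>|P. S2 G \<omega> powr s) = 2 * s * (2 * s - 1) * Gamma s * (\<Sum>n. 1 / pole n powr s)"
proof -
  define h where "h = (\<lambda>x. ennreal (s * x powr (s - 1)))"
  have [measurable]: "h \<in> borel_measurable borel" unfolding h_def by measurable
  have G0: "Gamma s > 0" using s by (intro Gamma_real_pos) auto
  note sm = summable_pole_powr[OF s]
  have Z0: "(\<Sum>n. 1 / pole n powr s) \<ge> 0" by (intro suminf_nonneg sm) auto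
  have "(\<integral>\<^sup>+\<omega>. (\<integral>\<^sup>+x. h x * indicator {0<..S2 G \<omega>} x \<partial>lborel) \<partial>P) = (\<integral>\<^sup>+\<omega>. ennreal (S2 G \<omega> powr s) \<partial>P)"
    using S2_pos s by (intro nn_integral_cong_AE) (auto simp: h_def nn_integral_powr_from_0 elim!: eventually_mono)
  also have "\<dots> = ennreal (LINT \<omega>|P. S2 G \<omega> powr s)"
    by (intro nn_integral_eq_integral S2_moment) auto
  finally have 1: "(\<integral>\<^sup>+\<omega>. (\<integral>\<^sup>+x. h x * indicator {0<..S2 G \<omega>} x \<partial>lborel) \<partial>P) = ennreal (LINT \<omega>|P. S2 G \<omega> powr s)" .
  have "(\<integral>\<^sup>+x. h x * ennreal (2 * (exp (- pole n * x) * indicator {0<..} x)) \<partial>lborel) = ennreal (2 * s * Gamma s * (1 / pole n powr s))" for n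
  proof -
    have "(\<integral>\<^sup>+x. h x * ennreal (2 * (exp (- pole n * x) * indicator {0<..} x)) \<partial>lborel) =
        (\<integral>\<^sup>+x. ennreal (2 * s) * ennreal (x powr (s - 1) * exp (- pole n * x) * indicator {0<..} x) \<partial>lborel)"
      using s by (intro nn_integral_cong) (auto simp: h_def ennreal_mult[symmetric] indicator_def mult_ac simp del: ennreal_numeral)
    also have "\<dots> = ennreal (2 * s) * ennreal (Gamma s / pole n powr s)"
      using s pole_pos[of n] by (subst nn_integral_cmult) (simp_all only: nn_integral_Gamma, auto)
    finally show ?thesis using s G0 by (simp add: ennreal_mult[symmetric])
  qed
  then have 2: "(\<Sum>n. \<integral>\<^sup>+x. h x * ennreal (2 * (exp (- pole n * x) * indicator {0<..} x)) \<partial>lborel) =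
      ennreal (2 * s * Gamma s * (\<Sum>n. 1 / pole n powr s))"
    using s G0 by (simp only: suminf_mult[OF sm, symmetric]) (subst suminf_ennreal2, auto intro!: summable_mult sm simp del: times_divide_eq_right)
  have "(\<integral>\<^sup>+x. h x * ennreal (4 * pole n * (x * exp (- pole n * x) * indicator {0<..} x)) \<partial>lborel) = ennreal (4 * s * Gamma (s + 1) * (1 / pole n powr s))" for n
  proof -
    have "(\<integral>\<^sup>+x. h x * ennreal (4 * pole n * (x * exp (- pole n * x) * indicator {0<..} x)) \<partial>lborel) =
        (\<integral>\<^sup>+x. ennreal (4 * s * pole n) * ennreal (x powr (s + 1 - 1) * exp (- pole n * x) * indicator {0<..} x) \<partial>lborel)"
    proof (intro nn_integral_cong)
      fix x :: real
      have "x powr s = x * x powr (s - 1)" if "x > 0" using that by (simp add: powr_mult_base)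
      then show "h x * ennreal (4 * pole n * (x * exp (- pole n * x) * indicator {0<..} x)) =
         ennreal (4 * s * pole n) * ennreal (x powr (s + 1 - 1) * exp (- pole n * x) * indicator {0<..} x)"
        using s pole_pos[of n] by (cases "x > 0") (simp_all add: h_def ennreal_mult[symmetric] mult_ac)
    qed
    also have "\<dots> = ennreal (4 * s * pole n) * ennreal (Gamma (s + 1) / pole n powr (s + 1))"
      using s pole_pos[of n] by (subst nn_integral_cmult) (simp_all only: nn_integral_Gamma, auto)
    also have "\<dots> = ennreal (4 * s * Gamma (s + 1) * (1 / pole n powr s))"
      using s pole_pos[of n] by (subst ennreal_mult[symmetric]) (auto simp: powr_add intro!: Gamma_real_pos less_imp_le)
    finally show ?thesis .
  qed
  then have 3: "(\<Sum>n. \<integral>\<^sup>+x. h x * ennreal (4 * pole n * (x * exp (- pole n * x) * indicator {0<..} x)) \<partial>lborel) =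
      ennreal (4 * s * Gamma (s + 1) * (\<Sum>n. 1 / pole n powr s))"
    using s Gamma_real_pos[of "s + 1"]
    by (simp only: suminf_mult[OF sm, symmetric]) (subst suminf_ennreal2, auto intro!: summable_mult sm simp del: times_divide_eq_right)
  have "ennreal (LINT \<omega>|P. S2 G \<omega> powr s) + ennreal (2 * s * Gamma s * (\<Sum>n. 1 / pole n powr s)) =
      ennreal (4 * s * Gamma (s + 1) * (\<Sum>n. 1 / pole n powr s))"
    using S2_tail_identity[of h] unfolding 1 2 3 by simp
  then have "(LINT \<omega>|P. S2 G \<omega> powr s) + 2 * s * Gamma s * (\<Sum>n. 1 / pole n powr s) = 4 * s * Gamma (s + 1) * (\<Sum>n. 1 / pole n powr s)"
  proof -
    have nn: "(LINT \<omega>|P. S2 G \<omega> powr s) \<ge> 0" "2 * s * Gamma s * (\<Sum>n. 1 / pole n powr s) \<ge> 0"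
      "4 * s * Gamma (s + 1) * (\<Sum>n. 1 / pole n powr s) \<ge> 0"
      using s G0 Z0 Gamma_real_pos[of "s + 1"] by (auto intro!: mult_nonneg_nonneg)
    assume "ennreal (LINT \<omega>|P. S2 G \<omega> powr s) + ennreal (2 * s * Gamma s * (\<Sum>n. 1 / pole n powr s)) =
      ennreal (4 * s * Gamma (s + 1) * (\<Sum>n. 1 / pole n powr s))"
    then show ?thesis using nn by (simp only: ennreal_plus[symmetric] ennreal_inj add_nonneg_nonneg)
  qed
  also have "Gamma (s + 1) = s * Gamma s" using s by (intro Gamma_plus1) (auto elim!: nonpos_Ints_cases)
  finally show ?thesis by (simp add: algebra_simps)
qed

end

section \<open>Continuation of zeta and identification with xi\<close>

lemma dirichlet_series_holomorphic:
  "(\<lambda>s. \<Sum>n. 1 / of_nat (Suc n) powr s :: complex) holomorphic_on {s. Re s > 1}"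
proof (rule holomorphic_uniform_sequence[where f = "\<lambda>N s. \<Sum>n<N. 1 / of_nat (Suc n) powr s"])
  show "open {s::complex. Re s > 1}" by (rule open_halfspace_Re_gt)
  show "(\<lambda>s. \<Sum>n<N. 1 / of_nat (Suc n) powr s :: complex) holomorphic_on {s. Re s > 1}" for N
    by (intro holomorphic_intros) (auto simp del: of_nat_Suc)
  fix z :: complex assume z: "z \<in> {s. Re s > 1}"
  \<comment> \<open>Half the distance to the line Re s = 1, which leaves Re w \<ge> 1 + d on the
    closed disc and a convergent majorant with exponent -(1+d).\<close>
  define d where "d = (Re z - 1) / 2"
  have d: "d > 0" using z by (simp add: d_def)
  have Re: "Re w \<ge> 1 + d" if "w \<in> cball z d" for w
    using that abs_Re_le_cmod[of "z - w"] by (auto simp: dist_norm d_def field_simps abs_if split: if_splits)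
  show "\<exists>d>0. cball z d \<subseteq> {s. Re s > 1} \<and>
      uniform_limit (cball z d) (\<lambda>N s. \<Sum>n<N. 1 / of_nat (Suc n) powr s) (\<lambda>s. \<Sum>n. 1 / of_nat (Suc n) powr s) sequentially"
  proof (intro exI[of _ d] conjI d)
    show "cball z d \<subseteq> {s. Re s > 1}" using Re d by fastforce
    show "uniform_limit (cball z d) (\<lambda>N s. \<Sum>n<N. 1 / of_nat (Suc n) powr s) (\<lambda>s. \<Sum>n. 1 / of_nat (Suc n) powr s) sequentially"
    proof (rule Weierstrass_m_test)
      show "summable (\<lambda>n. real (Suc n) powr (- (1 + d)))"
        using d by (subst summable_Suc_iff[of "\<lambda>n. real n powr (- (1 + d))"]) (auto simp: summable_real_powr_iff)
      fix n w assume w: "w \<in> cball z d"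
      have "norm (1 / of_nat (Suc n) powr w) = 1 / real (Suc n) powr Re w"
        using norm_of_real_powr[of "real (Suc n)" w] by (simp add: norm_divide del: of_nat_Suc)
      also have "\<dots> = real (Suc n) powr (- Re w)" by (simp only: powr_minus divide_inverse mult_1)
      also have "\<dots> \<le> real (Suc n) powr (- (1 + d))" using Re[OF w] by (intro powr_mono) auto
      finally show "norm (1 / of_nat (Suc n) powr w :: complex) \<le> real (Suc n) powr (- (1 + d))" .
    qed
  qed
qed

context gamma_variables
begin

text \<open>The moments of \<open>S2\<close> are an entire function of the exponent, so they supply the analytic
  continuation of the zeta function; no functional equation is needed.\<close>

definition zeta_cont :: "complex \<Rightarrow> complex" where
  "zeta_cont s = (if s = 1 then 0 else
     S2_mellin (s / 2) * of_real (pi\<^sup>2 / 2) powr (s / 2) * rGamma (s / 2 + 1) / (2 * (s - 1)))"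

lemma S2_mellin_half_holomorphic: "(\<lambda>s. S2_mellin (s / 2)) holomorphic_on A"
proof -
  have "(S2_mellin \<circ> (\<lambda>s. s / 2)) holomorphic_on A"
    by (rule holomorphic_on_compose_gen[OF _ S2_mellin_holomorphic]) (auto intro!: holomorphic_intros)
  then show ?thesis by (simp only: comp_def)
qed

lemma zeta_cont_holomorphic: "zeta_cont holomorphic_on - {1}"
proof -
  have "(\<lambda>s. S2_mellin (s / 2) * of_real (pi\<^sup>2 / 2) powr (s / 2) * rGamma (s / 2 + 1) / (2 * (s - 1))) holomorphic_on - {1}"
    by (intro holomorphic_intros S2_mellin_half_holomorphic) auto
  then show ?thesis
    by (rule holomorphic_transform) (simp add: zeta_cont_def)
qed

text \<open>At s = t/2 > 1/2 the moment formula applies, and the reciprocal Gamma factor with the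
  denominator 2(t-1) strips the moment down to the Dirichlet series.\<close>

lemma zeta_cont_real:
  fixes t :: real
  assumes t: "t > 1"
  shows "zeta_cont (of_real t) = (\<Sum>n. 1 / of_nat (Suc n) powr of_real t)"
proof -
  define s where "s = t / 2"
  have s: "s > 1 / 2" using t by (simp add: s_def)
  have e: "1 / of_nat (Suc n) powr complex_of_real t = complex_of_real (1 / real (Suc n) powr t)" for n
  proof -
    have "complex_of_real (real (Suc n)) powr of_real t = of_real (real (Suc n) powr t)"
      by (rule powr_of_real) simp
    then show ?thesis by (simp only: of_real_of_nat_eq of_real_divide of_real_1)
  qed
  have t2: "t = 2 * s" by (simp add: s_def)
  have pole_powr: "pole n powr s = (pi\<^sup>2 / 2) powr s * real (Suc n) powr t" for n
  proof -
    have eq: "pole n = (pi\<^sup>2 / 2) * real (Suc n) powr 2" by (simp add: pole_def del: of_nat_Suc)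
    show ?thesis unfolding eq t2 by (subst powr_mult) (auto simp: powr_powr simp del: of_nat_Suc powr_numeral)
  qed
  have summand: "1 / real (Suc n) powr t = (pi\<^sup>2 / 2) powr s * (1 / pole n powr s)" for n
    unfolding pole_powr by simp
  have D: "(\<Sum>n. 1 / real (Suc n) powr t) = (pi\<^sup>2 / 2) powr s * (\<Sum>n. 1 / pole n powr s)"
    unfolding summand by (rule suminf_mult[OF summable_pole_powr[OF s]])
  have sm: "summable (\<lambda>n. 1 / real (Suc n) powr t)"
    unfolding summand by (rule summable_mult[OF summable_pole_powr[OF s]])
  have "S2_mellin (of_real s) = (LINT \<omega>|P. complex_of_real (S2 G \<omega> powr s))"
    unfolding S2_mellin_def using S2_pos
    by (intro integral_cong_AE) (auto elim!: eventually_mono simp: powr_of_real)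
  then have M: "S2_mellin (of_real s) = of_real (2 * s * (2 * s - 1) * Gamma s * (\<Sum>n. 1 / pole n powr s))"
    using S2_moment_formula[OF s] by simp
  have r: "rGamma (s + 1) = 1 / (s * Gamma s)"
  proof -
    have "s \<notin> \<int>\<^sub>\<le>\<^sub>0" using s by (auto elim!: nonpos_Ints_cases)
    then show ?thesis by (simp only: rGamma_inverse_Gamma Gamma_plus1 divide_inverse mult_1 simp_thms)
  qed
  have "Gamma s > 0" using s by (intro Gamma_real_pos) simp
  then have G0: "Gamma s \<noteq> 0" by simp
  have "zeta_cont (of_real t) = of_real (2 * s * (2 * s - 1) * Gamma s * (\<Sum>n. 1 / pole n powr s)) *
      of_real ((pi\<^sup>2 / 2) powr s) * of_real (rGamma (s + 1)) / of_real (2 * (2 * s - 1))"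
  proof -
    have 1: "complex_of_real t / 2 = of_real s" by (simp add: s_def)
    have 2: "complex_of_real (pi\<^sup>2 / 2) powr of_real s = of_real ((pi\<^sup>2 / 2) powr s)"
      by (rule powr_of_real) auto
    have 3: "rGamma (complex_of_real s + 1) = of_real (rGamma (s + 1))"
      by (simp add: rGamma_complex_of_real[symmetric])
    have 4: "complex_of_real t \<noteq> 1" using t by (metis of_real_eq_1_iff less_irrefl)
    show ?thesis unfolding zeta_cont_def if_not_P[OF 4] 1 2 3 M by (simp add: t2)
  qed
  also have "\<dots> = of_real (2 * s * (2 * s - 1) * Gamma s * (\<Sum>n. 1 / pole n powr s) * (pi\<^sup>2 / 2) powr s * rGamma (s + 1) / (2 * (2 * s - 1)))"
    by (simp only: of_real_mult of_real_divide)
  also have "2 * s * (2 * s - 1) * Gamma s * (\<Sum>n. 1 / pole n powr s) * (pi\<^sup>2 / 2) powr s * rGamma (s + 1) / (2 * (2 * s - 1)) =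
      (\<Sum>n. 1 / real (Suc n) powr t)"
  proof -
    have alg: "2 * s * m * g * Z * p * (1 / (s * g)) / (2 * m) = p * Z" if "m \<noteq> 0" "g \<noteq> 0" for m g Z p
      using that s by (simp add: field_simps)
    show ?thesis unfolding r D using s G0 by (intro alg) auto
  qed
  finally show ?thesis unfolding e by (simp only: suminf_of_real[OF sm])
qed

text \<open>Both sides are holomorphic on the half-plane and agree on the real ray, which
  accumulates at the interior point 2.\<close>

lemma zeta_cont_dirichlet:
  assumes s: "Re s > 1"
  shows "zeta_cont s = (\<Sum>n. 1 / of_nat (Suc n) powr s)"
proof -
  let ?S = "{s::complex. Re s > 1}"
  have "zeta_cont s - (\<Sum>n. 1 / of_nat (Suc n) powr s) = 0"
  proof (rule analytic_continuation[of "\<lambda>s. zeta_cont s - (\<Sum>n. 1 / of_nat (Suc n) powr s)" ?S "of_real ` {1<..}" 2 s])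
    show "(\<lambda>s. zeta_cont s - (\<Sum>n. 1 / of_nat (Suc n) powr s)) holomorphic_on ?S"
      by (intro holomorphic_on_diff dirichlet_series_holomorphic holomorphic_on_subset[OF zeta_cont_holomorphic]) auto
    show "connected ?S" by (intro convex_connected convex_halfspace_Re_gt)
    show "(2::complex) islimpt of_real ` {1<..}"
    proof -
      have "(2::real) islimpt {1<..}" by (intro open_imp_islimpt) auto
      moreover have "\<forall>\<^sub>F x in at 2. complex_of_real x \<noteq> of_real 2"
        by (auto simp: eventually_at_filter simp del: of_real_numeral)
      ultimately have "of_real 2 islimpt (of_real ` {1<..} :: complex set)"
        by (intro islimpt_isCont_image) auto
      then show ?thesis by simp
    qed
  qed (use s in \<open>auto simp: open_halfspace_Re_gt zeta_cont_real\<close>)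
  then show ?thesis by simp
qed

text \<open>Uniqueness is the identity theorem on the punctured plane, which is connected; at 1 both
  candidates have the prescribed value 0.\<close>

lemma riemann_zeta_eq: "riemann_zeta = zeta_cont"
  unfolding riemann_zeta_def
proof (rule the_equality)
  show "zeta_cont holomorphic_on - {1} \<and> zeta_cont 1 = 0 \<and> (\<forall>s. Re s > 1 \<longrightarrow> zeta_cont s = (\<Sum>n. 1 / of_nat (Suc n) powr s))"
    using zeta_cont_holomorphic zeta_cont_dirichlet by (simp add: zeta_cont_def)
next
  fix f :: "complex \<Rightarrow> complex"
  assume f: "f holomorphic_on - {1} \<and> f 1 = 0 \<and> (\<forall>s. Re s > 1 \<longrightarrow> f s = (\<Sum>n. 1 / of_nat (Suc n) powr s))"
  show "f = zeta_cont"
  proof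
    fix z
    show "f z = zeta_cont z"
    proof (cases "z = 1")
      case False
      show ?thesis
      proof (rule analytic_continuation_open[of "{s. Re s > 1}" "- {1}" f zeta_cont])
        show "{s::complex. Re s > 1} \<noteq> {}" by (auto intro!: exI[of _ 2])
        show "connected (- {1::complex})" by (rule connected_punctured_universe) simp
      qed (use f False zeta_cont_holomorphic zeta_cont_dirichlet in \<open>auto simp: open_halfspace_Re_gt\<close>)
    qed (use f in \<open>simp add: zeta_cont_def\<close>)
  qed
qed

text \<open>Inserting \<open>zeta_cont\<close> cancels s, s - 1 and Gamma(s/2), and the powers of
  pi^2/2 and 1/pi combine into one of pi/2. What remains is entire, so \<open>remove_sings\<close>
  returns it at every point.\<close>

lemma riemann_xi_eq: "riemann_xi s = 1 / 2 * of_real (pi / 2) powr (s / 2) * S2_mellin (s / 2)"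
proof -
  let ?g = "\<lambda>s. 1 / 2 * of_real (pi / 2) powr (s / 2) * S2_mellin (s / 2)"
  let ?f = "\<lambda>s. 1 / 2 * s * (s - 1) * of_real pi powr (- s / 2) * Gamma (s / 2) * riemann_zeta s"
  \<comment> \<open>Excluding all integers removes 0, 1 and the poles of Gamma(w/2) at once, and the
    excluded set is still discrete.\<close>
  have eq: "?g w = ?f w" if w: "w \<notin> \<int>" for w
  proof -
    have w01: "w \<noteq> 0" "w \<noteq> 1" using w by auto
    have w2: "w / 2 \<notin> \<int>\<^sub>\<le>\<^sub>0"
    proof
      assume "w / 2 \<in> \<int>\<^sub>\<le>\<^sub>0"
      then have "w / 2 \<in> \<int>" by blast
      then have "2 * (w / 2) \<in> \<int>" by (intro Ints_mult) auto
      then show False using w by simp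
    qed
    have rG: "rGamma (w / 2 + 1) = 1 / (w / 2 * Gamma (w / 2))"
      using w2 by (simp only: rGamma_inverse_Gamma Gamma_plus1 divide_inverse mult_1 simp_thms)
    have G0: "Gamma (w / 2) \<noteq> 0" using w2 by (simp add: Gamma_eq_zero_iff)
    have pw: "complex_of_real (pi\<^sup>2 / 2) powr (w / 2) * of_real pi powr (- w / 2) = of_real (pi / 2) powr (w / 2)"
    proof -
      have "complex_of_real (pi\<^sup>2 / 2) = of_real (pi / 2) * of_real pi" by (simp add: power2_eq_square)
      then have "complex_of_real (pi\<^sup>2 / 2) powr (w / 2) = of_real (pi / 2) powr (w / 2) * of_real pi powr (w / 2)"
        by (simp only:) (rule powr_times_real, auto)
      moreover have "complex_of_real pi powr (w / 2) * of_real pi powr (- w / 2) = 1"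
        by (simp flip: powr_add)
      ultimately show ?thesis by (simp add: mult.assoc)
    qed
    have alg: "1 / 2 * c * m = 1 / 2 * w * v * p * g * (m * p2 * (1 / (w / 2 * g)) / (2 * v))"
      if "p2 * p = c" "g \<noteq> 0" "v \<noteq> 0" for c m v p g p2 :: complex
      using that(2,3) w01(1) by (simp add: field_simps flip: that(1))
    have "w - 1 \<noteq> 0" using w01 by simp
    then show ?thesis
      unfolding riemann_zeta_eq zeta_cont_def if_not_P[OF w01(2)] rG by (rule alg[OF pw G0])
  qed
  have "isCont ?g s"
  proof -
    have "?g holomorphic_on UNIV" by (intro holomorphic_intros S2_mellin_half_holomorphic) auto
    then show ?thesis
      using holomorphic_on_imp_continuous_on continuous_on_eq_continuous_at by blast
  qed
  then have lim: "?g \<midarrow>s\<rightarrow> ?g s" by (simp add: isCont_def)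
  \<comment> \<open>The integers other than s form a closed set, so some punctured neighbourhood of
    s contains no integer, even when s itself is one.\<close>
  have "\<forall>\<^sub>F w in nhds s. w \<in> - (of_int ` {i. of_int i \<noteq> s})"
    by (intro eventually_nhds_in_open open_Compl closed_of_int_image) auto
  then have "\<forall>\<^sub>F w in at s. ?g w = ?f w"
    unfolding eventually_at_filter
  proof eventually_elim
    case (elim w)
    show ?case
    proof (intro impI)
      assume "w \<noteq> s"
      then have "w \<notin> \<int>" using elim by (auto elim!: Ints_cases)
      then show "?g w = ?f w" by (rule eq)
    qed
  qed
  with lim have "?f \<midarrow>s\<rightarrow> ?g s" by (rule Lim_transform_eventually)
  then show ?thesis unfolding riemann_xi_def by (rule remove_sings_eqI)
qed

lemma S2_mellin_xi: "S2_mellin q = of_real (2 / pi) powr q * (2 * riemann_xi (2 * q))"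
proof -
  have "complex_of_real (2 / pi) powr q * of_real (pi / 2) powr q = (of_real (2 / pi) * of_real (pi / 2)) powr q"
    by (rule powr_times_real[symmetric]) auto
  then have "complex_of_real (2 / pi) powr q * of_real (pi / 2) powr q = 1" by simp
  then show ?thesis by (simp add: riemann_xi_eq flip: mult.assoc)
qed

text \<open>Evaluating \<open>S2_mellin_xi\<close> at q + n yields an extra (2/pi)^n, which merges
  with (-d)^n into the base -2d/pi.\<close>

lemma xi_series:
  fixes d :: real
  assumes d: "0 < d" "d < pi\<^sup>2 / 2"
  shows "(\<lambda>n. of_real (2 / pi) powr q * (of_real ((- 2 * d / pi) ^ n / fact n) * (2 * riemann_xi (2 * q + 2 * of_nat n)))) sums
     (LINT \<omega>|P. complex_of_real (S2 G \<omega>) powr q * of_real (exp (- d * S2 G \<omega>)))"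
proof -
  have "of_real ((- d) ^ n / fact n) * S2_mellin (q + of_nat n) =
    of_real (2 / pi) powr q * (of_real ((- 2 * d / pi) ^ n / fact n) * (2 * riemann_xi (2 * q + 2 * of_nat n)))" for n
  proof -
    have "of_real ((- d) ^ n / fact n) * (of_real (2 / pi) powr (q + of_nat n)) =
       of_real (2 / pi) powr q * complex_of_real ((- 2 * d / pi) ^ n / fact n)"
    proof -
      have "(- d) * (2 / pi) = - 2 * d / pi" by simp
      then have pm: "(- d) ^ n * (2 / pi) ^ n = (- 2 * d / pi) ^ n" by (simp only: power_mult_distrib[symmetric])
      have pw: "complex_of_real (2 / pi) powr (q + of_nat n) = of_real (2 / pi) powr q * of_real ((2 / pi) ^ n)"
        by (simp add: powr_add powr_nat)
      show ?thesis unfolding pw pm[symmetric] by simp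
    qed
    then show ?thesis
      unfolding S2_mellin_xi[of "q + of_nat n"] by (simp only: distrib_left mult.assoc[symmetric])
  qed
  then show ?thesis using S2_mellin_series[OF d, of q] by simp
qed

end

theorem theorem7p1:
  fixes P :: "'a measure"
    and G :: "nat \<Rightarrow> 'a \<Rightarrow> real"
    and B :: "real \<Rightarrow> 'a \<Rightarrow> real"
    and T :: "real \<Rightarrow> real measure"
  assumes "prob_space P"
    and "\<And>n. n \<ge> 1 \<Longrightarrow>
           distributed P lborel (G n) (\<lambda>x. ennreal (x * exp (- x) * indicator {0<..} x))"
    and "\<And>\<delta>. \<delta> > 0 \<Longrightarrow>
           distributed P lborel (B \<delta>) (\<lambda>x. ennreal (\<delta> * x powr (\<delta> - 1) * indicator {0<..<1} x))"
    and "\<And>\<delta>. \<delta> > 0 \<Longrightarrow>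
           prob_space.indep_vars P (\<lambda>_. borel) (\<lambda>n. if n = 0 then B \<delta> else G n) (UNIV :: nat set)"
    and "\<And>\<delta>. \<delta> > 0 \<Longrightarrow> is_T_law \<delta> (T \<delta>)"
  shows
    "(\<forall>\<delta>>0.
        (AE \<omega> in P. summable (\<lambda>n. G (Suc n) \<omega> / (pi\<^sup>2 * (real (Suc n))\<^sup>2 / 2 + \<delta>))) \<and>
        T \<delta> = distr P borel
                (\<lambda>\<omega>. (\<Sum>n. G (Suc n) \<omega> / (pi\<^sup>2 * (real (Suc n))\<^sup>2 / 2 + \<delta>)) + (- ln (B \<delta> \<omega>)))) \<and>
     (\<forall>\<delta>>0.
        T \<delta> = density lborel
                (\<lambda>x. ennreal (\<delta> * exp (- \<delta> * x) * (sinh (sqrt (2 * \<delta>)) / sqrt (2 * \<delta>))\<^sup>2 *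
                       measure P {\<omega> \<in> space P. S2 G \<omega> < x} * indicator {0<..} x))) \<and>
     (\<forall>\<delta>>0.
        (\<forall>q::complex. integrable (T \<delta>) (\<lambda>x. complex_of_real x powr q)) \<and>
        mellin (T \<delta>) holomorphic_on UNIV) \<and>
     (\<forall>\<delta>>0. \<delta> < pi\<^sup>2 / 2 \<longrightarrow> (\<forall>q::complex.
        summable (\<lambda>n. of_real ((- 2 * \<delta> / pi) ^ n / fact n) * (2 * riemann_xi (2 * q + 2 * of_nat n))) \<and>
        mellin (T \<delta>) q - q / of_real \<delta> * mellin (T \<delta>) (q - 1) =
          of_real ((sinh (sqrt (2 * \<delta>)) / sqrt (2 * \<delta>))\<^sup>2) * of_real (2 / pi) powr q *
          (\<Sum>n. of_real ((- 2 * \<delta> / pi) ^ n / fact n) * (2 * riemann_xi (2 * q + 2 * of_nat n))))) \<and>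
     (\<forall>q::complex.
        ((\<lambda>\<delta>. mellin (T \<delta>) q - q / of_real \<delta> * mellin (T \<delta>) (q - 1))
           \<longlongrightarrow> of_real (2 / pi) powr q * (2 * riemann_xi (2 * q))) (at_right 0))"
proof -
  \<comment> \<open>The value 1 of \<delta> is an arbitrary choice: only the independence of the
    gamma variables among themselves is extracted.\<close>
  have "prob_space.indep_vars P (\<lambda>_. borel) (\<lambda>n. if n = 0 then B 1 else G n) {1..}"
    using prob_space.indep_vars_subset[OF assms(1) assms(4)[of 1]] by simp
  also have "prob_space.indep_vars P (\<lambda>_. borel) (\<lambda>n. if n = 0 then B 1 else G n) {1..} =
      prob_space.indep_vars P (\<lambda>_. borel) G {1..}"
    by (rule prob_space.indep_vars_cong[OF assms(1)]) auto
  finally interpret gamma_variables P G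
    using assms(1,2) by (intro gamma_variables.intro gamma_variables_axioms.intro)
  have gb: "gamma_beta_variables P G (B \<delta>) \<delta>" if "\<delta> > 0" for \<delta>
    using that assms(3,4)[OF that]
    by (intro gamma_beta_variables.intro gamma_beta_variables_axioms.intro gamma_variables_axioms)
  note dens = T_law_eq_density[OF _ assms(5)]
  note rec = T_mellin_recurrence[OF _ dens]
  have p1: "(AE \<omega> in P. summable (\<lambda>n. G (Suc n) \<omega> / (pi\<^sup>2 * (real (Suc n))\<^sup>2 / 2 + \<delta>))) \<and>
        T \<delta> = distr P borel
                (\<lambda>\<omega>. (\<Sum>n. G (Suc n) \<omega> / (pi\<^sup>2 * (real (Suc n))\<^sup>2 / 2 + \<delta>)) + (- ln (B \<delta> \<omega>)))"
    if "\<delta> > 0" for \<delta>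
  proof -
    interpret gamma_beta_variables P G "B \<delta>" \<delta> by (rule gb[OF that])
    show ?thesis
      using G_series_summable[OF pole_shift] T_law_eq_distr[OF assms(5)[OF that]]
      by (simp only: pole_def T_sum_def[abs_def] simp_thms)
  qed
  have p2: "T \<delta> = density lborel
                (\<lambda>x. ennreal (\<delta> * exp (- \<delta> * x) * (sinh (sqrt (2 * \<delta>)) / sqrt (2 * \<delta>))\<^sup>2 *
                       measure P {\<omega> \<in> space P. S2 G \<omega> < x} * indicator {0<..} x))"
    if "\<delta> > 0" for \<delta>
    using dens[OF that that] by (simp only: T_density_def)
  have p3: "(\<forall>q. integrable (T \<delta>) (\<lambda>x. complex_of_real x powr q)) \<and> mellin (T \<delta>) holomorphic_on UNIV"
    if "\<delta> > 0" for \<delta>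
    using T_powr_integrable[OF that dens[OF that that]] T_mellin_holomorphic[OF that dens[OF that that]] by blast
  have p4: "summable (\<lambda>n. of_real ((- 2 * \<delta> / pi) ^ n / fact n) * (2 * riemann_xi (2 * q + 2 * of_nat n))) \<and>
        mellin (T \<delta>) q - q / of_real \<delta> * mellin (T \<delta>) (q - 1) =
          of_real ((sinh (sqrt (2 * \<delta>)) / sqrt (2 * \<delta>))\<^sup>2) * of_real (2 / pi) powr q *
          (\<Sum>n. of_real ((- 2 * \<delta> / pi) ^ n / fact n) * (2 * riemann_xi (2 * q + 2 * of_nat n)))"
    if \<delta>: "\<delta> > 0" "\<delta> < pi\<^sup>2 / 2" for \<delta> q
  proof -
    let ?t = "\<lambda>n. complex_of_real ((- 2 * \<delta> / pi) ^ n / fact n) * (2 * riemann_xi (2 * q + 2 * of_nat n))"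
    \<comment> \<open>The terms in \<open>xi_series\<close> carry this factor; being nonzero, it can
      be divided out, so the series without it is summable too.\<close>
    have c: "complex_of_real (2 / pi) powr q \<noteq> 0" by simp
    note S = xi_series[OF \<delta>, of q]
    have sm: "summable ?t" using sums_summable[OF S] c by (simp only: summable_cmult_iff simp_thms)
    have "mellin (T \<delta>) q - q / of_real \<delta> * mellin (T \<delta>) (q - 1) =
        of_real (sinh_factor \<delta>) * (\<Sum>n. of_real (2 / pi) powr q * ?t n)"
      unfolding rec[OF \<delta>(1) \<delta>(1) \<delta>(1)] by (rule arg_cong[OF sums_unique[OF S]])
    also have "\<dots> = of_real (sinh_factor \<delta>) * of_real (2 / pi) powr q * (\<Sum>n. ?t n)"
      unfolding suminf_mult[OF sm] by (rule mult.assoc[symmetric])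
    finally show ?thesis using sm unfolding sinh_factor_def by (rule conjI[rotated])
  qed
  have p5: "((\<lambda>\<delta>. mellin (T \<delta>) q - q / of_real \<delta> * mellin (T \<delta>) (q - 1))
           \<longlongrightarrow> of_real (2 / pi) powr q * (2 * riemann_xi (2 * q))) (at_right 0)" for q
  proof -
    have "((\<lambda>\<delta>. of_real (sinh_factor \<delta>) *
            (LINT \<omega>|P. complex_of_real (S2 G \<omega>) powr q * of_real (exp (- \<delta> * S2 G \<omega>)))) \<longlongrightarrow>
          of_real 1 * S2_mellin q) (at_right 0)"
      by (intro tendsto_mult tendsto_of_real sinh_factor_tendsto S2_mellin_limit)
    moreover have "\<forall>\<^sub>F \<delta> in at_right 0. of_real (sinh_factor \<delta>) *
            (LINT \<omega>|P. complex_of_real (S2 G \<omega>) powr q * of_real (exp (- \<delta> * S2 G \<omega>))) =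
          mellin (T \<delta>) q - q / of_real \<delta> * mellin (T \<delta>) (q - 1)"
      using eventually_at_right_less[of 0] by eventually_elim (rule rec[symmetric])
    ultimately have "((\<lambda>\<delta>. mellin (T \<delta>) q - q / of_real \<delta> * mellin (T \<delta>) (q - 1)) \<longlongrightarrow> of_real 1 * S2_mellin q) (at_right 0)"
      by (rule Lim_transform_eventually)
    then show ?thesis by (simp only: S2_mellin_xi of_real_1 mult_1)
  qed
  show ?thesis
    apply (rule conjI, intro allI impI, erule p1)
    apply (rule conjI, intro allI impI, erule p2)
    apply (rule conjI, intro allI impI, erule p3)
    apply (rule conjI, intro allI impI, erule (1) p4)
    apply (intro allI, rule p5)
    done
qed

end
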